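(* Let $d\ge3$ and let $F:[0,\infty)\to\mathbb{R}$ satisfy: (F1) $F$ is continuous on $[0,\infty)$ and of class $\mathcal{C}^1$ in a neighborhood of $1$, $F(1)=0$ and $F'(1)=-1$; (F2) $\limsup_{s\to\infty}|F(s)|/s^{\frac{2^*-2}{2}}=0$, where $2^*=\frac{2d}{d-2}$. Let $(u_n)\subset\mathcal{X}$ be a sequence such that $(E_{GL}(u_n))$ is bounded and $$\lim_{n\to\infty}\sup_{y\in\mathbb{R}^d}\int_{B(y,1)}|u_n|^2+\left(\varphi^2(|1+u_n|)-1\right)^2\,dx=0.$$ Then, for any $c\in(0,\sqrt2)$, $$\liminf_{n\to\infty}E_c(u_n)=\liminf_{n\to\infty}\big(E_{GL}(u_n)+c\,\mathcal{Q}(u_n)\big)\ge0.$$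
   Context: Functions $u:\mathbb{R}^d\to\mathbb{C}$ are complex-valued, $x=(x_1,x')\in\mathbb{R}\times\mathbb{R}^{d-1}$, $B(y,1)$ is the unit ball centered at $y\in\mathbb{R}^d$, and $\langle f,g\rangle=\Re(f)\Re(g)+\Im(f)\Im(g)$. $\mathcal{D}^{1,2}(\mathbb{R}^d)$ is the completion of $\mathcal{C}_0^\infty(\mathbb{R}^d)$ with respect to the norm $\|u\|=|\nabla u|_2$, and $$\mathcal{X}=\{u\in\mathcal{D}^{1,2}(\mathbb{R}^d):\ |1+u|-1\in L^2(\mathbb{R}^d)\}.$$ $\varphi\in\mathcal{C}^\infty(\mathbb{R})$ is a fixed odd function such that $\varphi(s)=s$ for $s\in[0,2]$, $\varphi(s)=3$ for $s\ge4$, and $0\le\varphi'(s)\le1$ for $s\in\mathbb{R}$. The Ginzburg-Landau energy of $u\in\mathcal{X}$ is $$E_{GL}(u)=\frac12\int_{\mathbb{R}^d}|\nabla u|^2\,dx+\frac14\int_{\mathbb{R}^d}\left(\varphi^2(|1+u|)-1\right)^2\,dx.$$ With $V(s)=\int_s^1F(t)\,dt$ for $s\ge0$, the Lagrangian is $$E_c(u)=\frac12\int_{\mathbb{R}^d}|\nabla u|^2+V(|1+u|^2)\,dx+c\,\mathcal{Q}(u),\qquad u\in\mathcal{X}.$$ The (first component of the) momentum $\mathcal{Q}(u)$ is formally $\mathcal{Q}(u)=\frac12\int_{\mathbb{R}^d}\langle i\partial_{x_1}u,u\rangle\,dx$; since the integrand need not be in $L^1$ for $u\in\mathcal{X}$,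 it is defined on $\mathcal{X}$ following Mari\c{s}: let $\mathcal{Y}=\{\partial_{x_1}\phi:\ \phi\in\mathcal{D}^{1,2}(\mathbb{R}^d),\ \phi\text{ real-valued}\}$. Any $v\in L^1(\mathbb{R}^d)\cap\mathcal{Y}$ satisfies $\int_{\mathbb{R}^d} v\,dx=0$, so $\Lambda(v+w):=\int_{\mathbb{R}^d}v\,dx$ for $v\in L^1(\mathbb{R}^d)$, $w\in\mathcal{Y}$ is a well-defined linear functional on $L^1(\mathbb{R}^d)+\mathcal{Y}$. For every $u\in\mathcal{X}$ one has $\langle i\partial_{x_1}u,u\rangle\in L^1(\mathbb{R}^d)+\mathcal{Y}$, and $\mathcal{Q}(u):=\frac12\Lambda(\langle i\partial_{x_1}u,u\rangle)$, which is finite. *)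

theory Defs
  imports "HOL-Analysis.Analysis"
begin

text \<open>
  The space is \<open>real ^ 'n\<close> with \<open>d = CARD('n)\<close>. The index type carries no order, so the
  distinguished (``first'') coordinate is passed as an arbitrary index \<open>k :: 'n\<close>.
  Elements of the function spaces below are functions, not classes of functions; all the notions
  are invariant under modification on Lebesgue null sets.
\<close>

primrec C_diff :: "nat \<Rightarrow> ('a::real_normed_vector \<Rightarrow> 'b::real_normed_vector) \<Rightarrow> bool" where
  "C_diff 0 f \<longleftrightarrow> continuous_on UNIV f"
| "C_diff (Suc m) f \<longleftrightarrow>
     (\<forall>x. f differentiable (at x)) \<and> (\<forall>v. C_diff m (\<lambda>x. frechet_derivative f (at x) v))"

definition smooth :: "('a::real_normed_vector \<Rightarrow> 'b::real_normed_vector) \<Rightarrow> bool" where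
  "smooth f \<longleftrightarrow> (\<forall>m. C_diff m f)"

definition test_fun :: "(real ^ 'n \<Rightarrow> complex) \<Rightarrow> bool" where
  "test_fun \<psi> \<longleftrightarrow> smooth \<psi> \<and> compact (closure {x. \<psi> x \<noteq> 0})"

definition classical_grad :: "(real ^ 'n \<Rightarrow> complex) \<Rightarrow> real ^ 'n \<Rightarrow> complex ^ 'n" where
  "classical_grad \<psi> x = (\<chi> i. frechet_derivative \<psi> (at x) (axis i 1))"

definition in_Lp :: "real \<Rightarrow> ('a::euclidean_space \<Rightarrow> 'b::euclidean_space) \<Rightarrow> bool" where
  "in_Lp p f \<longleftrightarrow> f \<in> borel_measurable lebesgue \<and> integrable lebesgue (\<lambda>x. norm (f x) powr p)"

definition crit_exp :: "nat \<Rightarrow> real" where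
  "crit_exp d = 2 * real d / (real d - 2)"

text \<open>
  For \<open>d \<ge> 3\<close> the Sobolev inequality bounds the norm of a test function in \<open>L\<^sup>p\<close>, \<open>p = crit_exp d\<close>,
  by the \<open>L\<^sup>2\<close> norm of its gradient. Hence a sequence of test functions that is Cauchy for the latter
  converges in \<open>L\<^sup>p\<close>, and the completion is realised as the set of these limits, with the gradient
  extended by continuity. \<open>D12_grad u G\<close> says that \<open>u\<close> is such a limit and \<open>G\<close> is its gradient.
\<close>

definition D12_grad :: "(real ^ 'n \<Rightarrow> complex) \<Rightarrow> (real ^ 'n \<Rightarrow> complex ^ 'n) \<Rightarrow> bool" where
  "D12_grad u G \<longleftrightarrow> in_Lp (crit_exp CARD('n)) u \<and> in_Lp 2 G \<and>
     (\<exists>\<psi>. (\<forall>j::nat. test_fun (\<psi> j)) \<and>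
        (\<lambda>j. \<integral>x. norm (\<psi> j x - u x) powr crit_exp CARD('n) \<partial>lebesgue) \<longlonglongrightarrow> 0 \<and>
        (\<lambda>j. \<integral>x. (norm (classical_grad (\<psi> j) x - G x))\<^sup>2 \<partial>lebesgue) \<longlonglongrightarrow> 0)"

definition D12 :: "(real ^ 'n \<Rightarrow> complex) set" where
  "D12 = {u. \<exists>G. D12_grad u G}"

text \<open>The gradient is determined only up to a null set, so one representative is chosen.\<close>

definition grad :: "(real ^ 'n \<Rightarrow> complex) \<Rightarrow> real ^ 'n \<Rightarrow> complex ^ 'n" where
  "grad u = (SOME G. D12_grad u G)"

definition X_space :: "(real ^ 'n \<Rightarrow> complex) set" where
  "X_space = {u \<in> D12. in_Lp 2 (\<lambda>x. cmod (1 + u x) - 1)}"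

definition Y_space :: "'n \<Rightarrow> (real ^ 'n \<Rightarrow> real) set" where
  "Y_space k = {w. w \<in> borel_measurable lebesgue \<and>
     (\<exists>\<phi> \<in> D12. (\<forall>x. \<phi> x \<in> \<real>) \<and> (AE x in lebesgue. complex_of_real (w x) = grad \<phi> x $ k))}"

definition Lam :: "'n \<Rightarrow> (real ^ 'n \<Rightarrow> real) \<Rightarrow> real" where
  "Lam k f = (THE l. \<exists>v w. integrable lebesgue v \<and> w \<in> Y_space k \<and>
     (AE x in lebesgue. f x = v x + w x) \<and> l = (\<integral>x. v x \<partial>lebesgue))"

text \<open>The real inner product of \<^typ>\<open>complex\<close> is \<open>Re f * Re g + Im f * Im g\<close>.\<close>

definition momentum :: "'n \<Rightarrow> (real ^ 'n \<Rightarrow> complex) \<Rightarrow> real" where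
  "momentum k u = 1/2 * Lam k (\<lambda>x. (\<i> * grad u x $ k) \<bullet> u x)"

definition admissible_phi :: "(real \<Rightarrow> real) \<Rightarrow> bool" where
  "admissible_phi \<phi> \<longleftrightarrow> smooth \<phi> \<and> (\<forall>s. \<phi> (- s) = - \<phi> s) \<and> (\<forall>s\<in>{0..2}. \<phi> s = s) \<and>
     (\<forall>s\<ge>4. \<phi> s = 3) \<and> (\<forall>s. 0 \<le> deriv \<phi> s \<and> deriv \<phi> s \<le> 1)"

definition E_GL :: "(real \<Rightarrow> real) \<Rightarrow> (real ^ 'n \<Rightarrow> complex) \<Rightarrow> real" where
  "E_GL \<phi> u = 1/2 * (\<integral>x. (norm (grad u x))\<^sup>2 \<partial>lebesgue)
            + 1/4 * (\<integral>x. ((\<phi> (cmod (1 + u x)))\<^sup>2 - 1)\<^sup>2 \<partial>lebesgue)"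

text \<open>The interval integral is oriented, as needed for \<open>s > 1\<close>.\<close>

definition V_pot :: "(real \<Rightarrow> real) \<Rightarrow> real \<Rightarrow> real" where
  "V_pot F s = (LBINT t=ereal s..ereal 1. F t)"

definition E_lag :: "(real \<Rightarrow> real) \<Rightarrow> 'n \<Rightarrow> real \<Rightarrow> (real ^ 'n \<Rightarrow> complex) \<Rightarrow> real" where
  "E_lag F k c u = 1/2 * (\<integral>x. (norm (grad u x))\<^sup>2 + V_pot F ((cmod (1 + u x))\<^sup>2) \<partial>lebesgue)
            + c * momentum k u"

definition cond_F1 :: "(real \<Rightarrow> real) \<Rightarrow> bool" where
  "cond_F1 F \<longleftrightarrow> continuous_on {0..} F \<and>
     (\<exists>\<delta>>0. (\<forall>s\<in>ball 1 \<delta>. F differentiable (at s)) \<and> continuous_on (ball 1 \<delta>) (deriv F)) \<and>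
     F 1 = 0 \<and> deriv F 1 = - 1"

definition cond_F2 :: "nat \<Rightarrow> (real \<Rightarrow> real) \<Rightarrow> bool" where
  "cond_F2 d F \<longleftrightarrow>
     Limsup at_top (\<lambda>s. ereal (\<bar>F s\<bar> / s powr ((crit_exp d - 2) / 2))) = 0"

end

theory Submission
  imports Defs
begin

text \<open>
  Write \<open>\<rho> = |1 + u|\<^sup>2 - 1\<close> and \<open>p = 2\<^sup>*\<close>. The vanishing hypothesis makes the set \<open>|u\<^sub>n| > \<delta>\<close>
  uniformly small on small balls. Averaging the translation estimate
  \<open>\<parallel>g(\<cdot> + h) - g\<parallel>\<^sub>2 \<le> |h| \<parallel>\<nabla>u\<^sub>n\<parallel>\<^sub>2\<close> for \<open>g = (|u\<^sub>n| - \<delta>)\<^sub>+\<close> over \<open>|h| < l\<close> bounds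
  \<open>\<parallel>g\<parallel>\<^sub>2\<close> by a multiple of \<open>l\<close>, so \<open>\<integral> |u\<^sub>n|\<^sup>2\<close> over \<open>|u\<^sub>n| > \<delta>\<close> tends to \<open>0\<close> for every
  \<open>\<delta> > 0\<close>. The same averaging, applied to truncations of
  \<open>|u|\<close> between the levels \<open>t\<close> and \<open>2t\<close>, yields the Sobolev inequality and hence a bound in \<open>L\<^sup>p\<close>.

  The potentials \<open>V(|1 + u|\<^sup>2) / 2\<close> and \<open>(\<phi>\<^sup>2(|1 + u|) - 1)\<^sup>2 / 4\<close> agree up to
  \<open>\<epsilon> (\<phi>\<^sup>2 - 1)\<^sup>2\<close> where \<open>|u| \<le> \<delta>\<close> and up to \<open>\<epsilon> |u|\<^sup>p + C |u|\<^sup>2\<close> elsewhere, so the energies differ by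
  \<open>o(1)\<close>. For the momentum, subtracting from \<open>\<langle>\<i>\<partial>u, u\<rangle>\<close> the derivative of a suitable bounded-gradient
  function of \<open>u\<close> leaves \<open>- \<rho> \<partial>(Im u)\<close> plus \<open>O(\<delta>) (\<rho>\<^sup>2 + |u|\<^sup>p + |\<nabla>u|\<^sup>2)\<close> where \<open>|u| \<le> \<delta>\<close>. Since
  \<open>|\<rho>| |\<nabla>u| \<le> \<surd>2 (|\<nabla>u|\<^sup>2 / 2 + \<rho>\<^sup>2 / 4)\<close>, the condition \<open>c < \<surd>2\<close> gives the lower bound.
\<close>

section \<open>Test functions\<close>

text \<open>The function whose derivative is removed from the momentum density is forced by an
  identity. As \<open>Re u = (\<rho> - |u|\<^sup>2) / 2\<close>, one has \<open>Im u \<partial>(Re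
  u) - Re u \<partial>(Im u) = \<partial>(Re u Im u) - (\<rho> - |u|\<^sup>2) \<partial>(Im
  u)\<close>, and \<open>|u|\<^sup>2 \<partial>(Im u)\<close> is
  \<open>\<partial>((Im u)^3 / 3)\<close> plus \<open>(Re u)\<^sup>2 \<partial>(Im u)\<close>, which
  is harmless because \<open>Re u\<close> is controlled by \<open>\<rho>\<close> and
  \<open>|u|\<^sup>2\<close>. A second obstacle is that the vanishing hypothesis is local, on unit
  balls, while the conclusion is global; translation estimates integrate over the whole space at
  once and thus replace a covering by balls. Finally, gradients exist only through approximating
  test functions, so estimates are proved for test functions and passed to the limit, at the price
  of non-optimal constants.\<close>

lemma C_diff_Suc_imp: "C_diff (Suc m) f \<Longrightarrow> C_diff m f"
proof (induction m arbitrary: f)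
  case 0
  then show ?case
    by (simp add: continuous_on_eq_continuous_at differentiable_imp_continuous_within)
next
  case (Suc m)
  then show ?case by (metis C_diff.simps(2))
qed

lemma C_diff_continuous: "C_diff m f \<Longrightarrow> continuous_on UNIV f"
proof (induction m)
  case (Suc m)
  then show ?case using C_diff_Suc_imp by blast
qed simp

text \<open>\<open>frechet_derivative\<close> is a choice operator. Uniqueness of the derivative
  lets an explicit candidate \<open>f'\<close> take its place, and the closure rules for sums,
  products and inverses go through this rule.\<close>

lemma C_diff_SucI:
  assumes "\<And>x. (f has_derivative f' x) (at x)" "\<And>v. C_diff m (\<lambda>x. f' x v)"
  shows "C_diff (Suc m) f"
proof -
  have "frechet_derivative f (at x) = f' x" for x
    using assms(1) frechet_derivative_at by metis
  moreover have "f differentiable (at x)" for x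
    using assms(1) by (rule differentiableI)
  ultimately show ?thesis
    using assms(2) by simp
qed

lemma C_diff_has_derivative:
  "C_diff (Suc m) f \<Longrightarrow> (f has_derivative frechet_derivative f (at x)) (at x)"
  by (simp add: frechet_derivative_works)

lemma C_diff_const: "C_diff m (\<lambda>x. c)"
proof (induction m arbitrary: c)
  case (Suc m)
  show ?case by (rule C_diff_SucI[where f' = "\<lambda>x v. 0"]) (use Suc in auto)
qed simp

lemma C_diff_linear:
  assumes "bounded_linear L" shows "C_diff m f \<Longrightarrow> C_diff m (\<lambda>x. L (f x))"
proof (induction m arbitrary: f)
  case 0
  then show ?case using assms by (simp add: bounded_linear.continuous_on)
next
  case (Suc m)
  show ?case
    by (rule C_diff_SucI[where f' = "\<lambda>x v. L (frechet_derivative f (at x) v)"])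
      (use Suc in \<open>auto intro!: bounded_linear.has_derivative[OF assms] C_diff_has_derivative[of m]\<close>)
qed

lemma C_diff_add: "C_diff m f \<Longrightarrow> C_diff m g \<Longrightarrow> C_diff m (\<lambda>x. f x + g x)"
proof (induction m arbitrary: f g)
  case 0
  then show ?case by (simp add: continuous_on_add)
next
  case (Suc m)
  show ?case
    by (rule C_diff_SucI[where f' = "\<lambda>x v. frechet_derivative f (at x) v + frechet_derivative g (at x) v"])
      (use Suc in \<open>auto intro!: has_derivative_add C_diff_has_derivative[of m]\<close>)
qed

lemma C_diff_mult:
  fixes f g :: "'a::real_normed_vector \<Rightarrow> 'b::real_normed_algebra"
  shows "C_diff m f \<Longrightarrow> C_diff m g \<Longrightarrow> C_diff m (\<lambda>x. f x * g x)"
proof (induction m arbitrary: f g)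
  case 0
  then show ?case by (simp add: continuous_on_mult)
next
  case (Suc m)
  show ?case
  proof (rule C_diff_SucI[where f' = "\<lambda>x v. f x * frechet_derivative g (at x) v
                                      + frechet_derivative f (at x) v * g x"])
    show "((\<lambda>x. f x * g x) has_derivative (\<lambda>v. f x * frechet_derivative g (at x) v
                                      + frechet_derivative f (at x) v * g x)) (at x)" for x
      by (intro has_derivative_mult C_diff_has_derivative[of m] Suc.prems)
    show "C_diff m (\<lambda>x. f x * frechet_derivative g (at x) v
                                      + frechet_derivative f (at x) v * g x)" for v
      using Suc.prems C_diff_Suc_imp[OF Suc.prems(1)] C_diff_Suc_imp[OF Suc.prems(2)]
      by (intro C_diff_add Suc.IH) simp_all
  qed
qed

lemma C_diff_power:
  fixes f :: "'a::real_normed_vector \<Rightarrow> 'b::real_normed_algebra_1"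
  shows "C_diff m f \<Longrightarrow> C_diff m (\<lambda>x. f x ^ k)"
  by (induction k) (simp_all add: C_diff_mult C_diff_const)

lemma C_diff_inverse:
  fixes f :: "'a::real_normed_vector \<Rightarrow> 'b::real_normed_field"
  assumes nz: "\<And>x. f x \<noteq> 0"
  shows "C_diff m f \<Longrightarrow> C_diff m (\<lambda>x. inverse (f x))"
proof (induction m)
  case 0
  then show ?case using nz by (simp add: continuous_on_inverse)
next
  case (Suc m)
  show ?case
  proof (rule C_diff_SucI[where f' = "\<lambda>x v. - (inverse (f x) * frechet_derivative f (at x) v * inverse (f x))"])
    show "((\<lambda>x. inverse (f x)) has_derivative
         (\<lambda>v. - (inverse (f x) * frechet_derivative f (at x) v * inverse (f x)))) (at x)" for x
      by (rule Deriv.has_derivative_inverse[OF nz C_diff_has_derivative[OF Suc.prems]])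
    \<comment> \<open>The derivative of the inverse contains the inverse again, so the induction
      hypothesis about the same function closes the step and \<open>f\<close> can stay
      fixed.\<close>
    have "C_diff m (\<lambda>x. inverse (f x))"
      using Suc C_diff_Suc_imp by blast
    then show "C_diff m (\<lambda>x. - (inverse (f x) * frechet_derivative f (at x) v * inverse (f x)))" for v
      using Suc.prems by (intro C_diff_mult C_diff_linear[OF bounded_linear_minus[OF bounded_linear_ident]]) auto
  qed
qed

lemma test_fun_smooth: "test_fun \<psi> \<Longrightarrow> C_diff m \<psi>"
  by (simp add: test_fun_def smooth_def)

lemma test_fun_has_derivative:
  "test_fun \<psi> \<Longrightarrow> (\<psi> has_derivative frechet_derivative \<psi> (at x)) (at x)"
  using C_diff_has_derivative test_fun_smooth by blast

lemma test_fun_continuous: "test_fun \<psi> \<Longrightarrow> continuous_on UNIV \<psi>"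
  using C_diff_continuous test_fun_smooth by blast

text \<open>The complement of the closed support is open and the function vanishes on it, so the
  derivative vanishes there too; one radius serves both.\<close>

lemma test_fun_supp:
  assumes "test_fun \<psi>"
  obtains B where "B > 0" "\<And>x. norm x \<ge> B \<Longrightarrow> \<psi> x = 0"
    "\<And>x. norm x \<ge> B \<Longrightarrow> frechet_derivative \<psi> (at x) = (\<lambda>h. 0)"
proof -
  let ?S = "closure {x. \<psi> x \<noteq> 0}"
  have "bounded ?S"
    using assms by (simp add: test_fun_def compact_imp_bounded)
  then obtain B where B: "\<And>x. x \<in> ?S \<Longrightarrow> norm x \<le> B"
    by (meson bounded_iff)
  define B' where "B' = max B 0 + 1"
  have out: "x \<notin> ?S" if "norm x \<ge> B'" for x
    using B[of x] that by (auto simp: B'_def)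
  show ?thesis
  proof
    show "B' > 0" by (simp add: B'_def)
    show "\<psi> x = 0" if "norm x \<ge> B'" for x
      using out[OF that] closure_subset[of "{x. \<psi> x \<noteq> 0}"] by blast
    show "frechet_derivative \<psi> (at x) = (\<lambda>h. 0)" if "norm x \<ge> B'" for x
    proof -
      have op: "open (- ?S)" and x: "x \<in> - ?S"
        using out[OF that] by (simp_all add: open_Compl)
      have z: "\<psi> y = 0" if "y \<in> - ?S" for y
        using that closure_subset[of "{x. \<psi> x \<noteq> 0}"] by blast
      have c: "((\<lambda>y. 0::complex) has_derivative (\<lambda>h. 0)) (at x)"
        by (rule has_derivative_const)
      have "(\<psi> has_derivative (\<lambda>h. 0)) (at x)"
        by (rule has_derivative_transform_within_open[OF c op x]) (metis z)
      then show ?thesis by (rule frechet_derivative_at[symmetric])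
    qed
  qed
qed

lemma test_funI:
  assumes "\<And>m. C_diff m f" "\<And>x. norm x \<ge> B \<Longrightarrow> f x = 0"
  shows "test_fun f"
proof -
  have "{x. f x \<noteq> 0} \<subseteq> ball 0 B"
    using assms(2) by force
  then have "bounded (closure {x. f x \<noteq> 0})"
    using bounded_subset bounded_closure by blast
  then show ?thesis
    using assms(1) by (simp add: test_fun_def smooth_def compact_eq_bounded_closed)
qed

lemma classical_grad_nth: "classical_grad \<psi> x $ i = frechet_derivative \<psi> (at x) (axis i 1)"
  by (simp add: classical_grad_def)

lemma frechet_eq_sum_classical_grad:
  assumes "test_fun \<psi>"
  shows "frechet_derivative \<psi> (at x) h = (\<Sum>i\<in>UNIV. h $ i *\<^sub>R (classical_grad \<psi> x $ i))"
proof -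
  interpret D: bounded_linear "frechet_derivative \<psi> (at x)"
    using test_fun_has_derivative[OF assms] has_derivative_bounded_linear by blast
  have "h = (\<Sum>i\<in>UNIV. h $ i *\<^sub>R axis i 1)"
    using basis_expansion[of h] by (simp add: scalar_mult_eq_scaleR)
  then have "frechet_derivative \<psi> (at x) h = frechet_derivative \<psi> (at x) (\<Sum>i\<in>UNIV. h $ i *\<^sub>R axis i 1)"
    by simp
  also have "\<dots> = (\<Sum>i\<in>UNIV. h $ i *\<^sub>R (classical_grad \<psi> x $ i))"
    by (simp add: D.sum D.scaleR classical_grad_nth)
  finally show ?thesis .
qed

text \<open>Cauchy-Schwarz in the coordinate index. The increment \<open>h\<close> is real while the
  gradient has complex entries, hence the detour through \<open>L2_set\<close>.\<close>

lemma norm_frechet_le_classical_grad: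
  assumes "test_fun \<psi>"
  shows "norm (frechet_derivative \<psi> (at x) h) \<le> norm h * norm (classical_grad \<psi> x)"
proof -
  have "norm (frechet_derivative \<psi> (at x) h) \<le> (\<Sum>i\<in>UNIV. \<bar>h $ i\<bar> * norm (classical_grad \<psi> x $ i))"
    unfolding frechet_eq_sum_classical_grad[OF assms] by (rule sum_norm_le) simp
  also have "\<dots> \<le> L2_set (\<lambda>i. h $ i) UNIV * L2_set (\<lambda>i. norm (classical_grad \<psi> x $ i)) UNIV"
    using L2_set_mult_ineq[of "\<lambda>i. h $ i" "\<lambda>i. norm (classical_grad \<psi> x $ i)" UNIV] by simp
  finally show ?thesis by (simp add: norm_vec_def L2_set_def)
qed

lemma test_fun_grad_continuous:
  assumes "test_fun \<psi>" shows "continuous_on UNIV (classical_grad \<psi>)"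
  unfolding classical_grad_def
proof (rule continuous_on_vec_lambda)
  show "continuous_on UNIV (\<lambda>x. frechet_derivative \<psi> (at x) (axis i 1))" for i
    using test_fun_smooth[OF assms, of "Suc 0"] by simp
qed

lemma test_fun_diff:
  assumes "test_fun f" "test_fun g"
  shows "test_fun (\<lambda>x. f x - g x)"
    and "classical_grad (\<lambda>x. f x - g x) x = classical_grad f x - classical_grad g x"
proof -
  obtain B B' where "\<And>x. norm x \<ge> B \<Longrightarrow> f x = 0" "\<And>x. norm x \<ge> B' \<Longrightarrow> g x = 0"
    using test_fun_supp[OF assms(1)] test_fun_supp[OF assms(2)] by metis
  then show "test_fun (\<lambda>x. f x - g x)"
    using C_diff_add[OF test_fun_smooth[OF assms(1)] C_diff_linear[OF bounded_linear_minus[OF bounded_linear_ident] test_fun_smooth[OF assms(2)]]]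
    by (intro test_funI[where B = "max B B'"]) auto
  have "((\<lambda>x. f x - g x) has_derivative (\<lambda>h. frechet_derivative f (at x) h - frechet_derivative g (at x) h)) (at x)"
    by (intro has_derivative_diff test_fun_has_derivative assms)
  note frechet_derivative_at[OF this, symmetric]
  then show "classical_grad (\<lambda>x. f x - g x) x = classical_grad f x - classical_grad g x"
    by (simp add: vec_eq_iff classical_grad_nth)
qed

lemma test_fun_partial:
  assumes "test_fun f"
  shows "test_fun (\<lambda>x. classical_grad f x $ i)"
proof -
  obtain B where B: "\<And>x. norm x \<ge> B \<Longrightarrow> frechet_derivative f (at x) = (\<lambda>h. 0)"
    using test_fun_supp[OF assms(1)] by metis
  have "C_diff m (\<lambda>x. frechet_derivative f (at x) (axis i 1))" for m
    using test_fun_smooth[OF assms, of "Suc m"] by simp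
  then show ?thesis
    using B by (intro test_funI[where B = B]) (auto simp: classical_grad_nth)
qed

section \<open>Integration by parts\<close>

lemma borel_measurable_lebesgueI: "f \<in> borel_measurable borel \<Longrightarrow> f \<in> borel_measurable lebesgue"
  by (simp add: measurable_completion)

lemma continuous_lebesgue_measurable:
  "continuous_on UNIV f \<Longrightarrow> f \<in> borel_measurable lebesgue"
  by (intro borel_measurable_lebesgueI borel_measurable_continuous_onI)

lemma vec_nth_measurable[measurable]:
  "(\<lambda>x::'a::euclidean_space ^ 'n. x $ i) \<in> borel_measurable borel"
  by (intro borel_measurable_continuous_onI continuous_intros)

lemma nn_integral_translation:
  fixes f :: "'a::euclidean_space \<Rightarrow> ennreal"
  assumes [measurable]: "f \<in> borel_measurable borel"
  shows "(\<integral>\<^sup>+x. f (c + x) \<partial>lborel) = (\<integral>\<^sup>+x. f x \<partial>lborel)"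
proof -
  have "(\<integral>\<^sup>+x. f x \<partial>lborel) = (\<integral>\<^sup>+x. f x \<partial>distr lborel borel ((+) c))"
    by (simp only: lborel_distr_plus)
  also have "\<dots> = (\<integral>\<^sup>+x. f (c + x) \<partial>lborel)"
    by (subst nn_integral_distr) auto
  finally show ?thesis ..
qed

lemma integral_translation:
  fixes f :: "'a::euclidean_space \<Rightarrow> 'b::{banach, second_countable_topology}"
  assumes [measurable]: "f \<in> borel_measurable borel"
  shows "(\<integral>x. f (c + x) \<partial>lborel) = (\<integral>x. f x \<partial>lborel)"
proof -
  have "(\<integral>x. f x \<partial>lborel) = (\<integral>x. f x \<partial>distr lborel borel ((+) c))"
    by (simp only: lborel_distr_plus)
  also have "\<dots> = (\<integral>x. f (c + x) \<partial>lborel)"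
    by (subst integral_distr) auto
  finally show ?thesis ..
qed

lemma integrable_continuous_bounded_support:
  fixes f :: "'a::euclidean_space \<Rightarrow> 'b::{banach, second_countable_topology}"
  assumes "continuous_on UNIV f" "\<And>x. norm x \<ge> B \<Longrightarrow> f x = 0"
  shows "integrable lborel f"
proof -
  have "integrable lborel (\<lambda>x. indicator (cball 0 B) x *\<^sub>R f x)"
    using assms(1) continuous_on_subset by (intro borel_integrable_compact) auto
  also have "(\<lambda>x. indicator (cball 0 B) x *\<^sub>R f x) = f"
    using assms(2) by (auto simp: fun_eq_iff indicator_def)
  finally show ?thesis .
qed

lemma bounded_continuous_bounded_support:
  fixes f :: "'a::euclidean_space \<Rightarrow> 'b::real_normed_vector"
  assumes "continuous_on UNIV f" "\<And>x. norm x \<ge> B \<Longrightarrow> f x = 0"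
  obtains M where "M > 0" "\<And>x. norm (f x) \<le> M"
proof -
  have "compact (f ` cball 0 B)"
    using assms(1) continuous_on_subset by (intro compact_continuous_image) auto
  then obtain M where M: "\<And>x. x \<in> cball 0 B \<Longrightarrow> norm (f x) \<le> M"
    by (metis bounded_iff compact_imp_bounded imageI)
  show ?thesis
  proof
    show "max 1 M > 0" by simp
    show "norm (f x) \<le> max 1 M" for x
      using M[of x] assms(2)[of x] by (cases "norm x \<le> B") auto
  qed
qed

lemma has_derivative_along_line:
  assumes "\<And>x. (f has_derivative f' x) (at x)"
  shows "((\<lambda>t. f (x + t *\<^sub>R v)) has_vector_derivative f' (x + t *\<^sub>R v) v) (at t within S)"
proof -
  have "((\<lambda>t. x + t *\<^sub>R v) has_derivative (\<lambda>t. t *\<^sub>R v)) (at t within S)"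
    by (auto intro!: derivative_eq_intros)
  then have "((\<lambda>t. f (x + t *\<^sub>R v)) has_derivative (\<lambda>s. f' (x + t *\<^sub>R v) (s *\<^sub>R v))) (at t within S)"
    using has_derivative_compose[OF _ assms] by blast
  moreover have "f' (x + t *\<^sub>R v) (s *\<^sub>R v) = s *\<^sub>R f' (x + t *\<^sub>R v) v" for s
    using assms[of "x + t *\<^sub>R v"] by (simp add: has_derivative_bounded_linear linear_simps(5))
  ultimately show ?thesis
    by (simp add: has_vector_derivative_def)
qed

text \<open>Difference quotients of \<open>f\<close> along \<open>v\<close> integrate to zero by
  translation invariance and are dominated by means of the mean value inequality, so their pointwise
  limit integrates to zero as well.\<close>

lemma integral_directional_derivative_eq_0:
  fixes f :: "'a::euclidean_space \<Rightarrow> 'b::euclidean_space"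
  assumes der: "\<And>x. (f has_derivative f' x) (at x)"
    and cont: "continuous_on UNIV (\<lambda>x. f' x v)"
    and supp: "\<And>x. norm x \<ge> B \<Longrightarrow> f x = 0" "\<And>x. norm x \<ge> B \<Longrightarrow> f' x v = 0"
  shows "(\<integral>x. f' x v \<partial>lborel) = 0"
proof -
  obtain M where M: "M > 0" "\<And>x. norm (f' x v) \<le> M"
    using bounded_continuous_bounded_support[OF cont supp(2)] by blast
  have fcont: "continuous_on UNIV f"
    by (intro continuous_at_imp_continuous_on ballI has_derivative_continuous[OF der])
  note fm[measurable] = borel_measurable_continuous_onI[OF fcont]
  note dm[measurable] = borel_measurable_continuous_onI[OF cont]
  have fint: "integrable lborel f"
    using integrable_continuous_bounded_support[OF fcont supp(1)] by blast
  define q where "q n x = real (Suc n) *\<^sub>R (f (x + (1 / real (Suc n)) *\<^sub>R v) - f x)" for n x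
  have qm[measurable]: "q n \<in> borel_measurable borel" for n
    unfolding q_def by measurable
  have fint': "integrable lborel (\<lambda>x. f (x + c))" for c
  proof -
    have "integrable (distr lborel borel ((+) c)) f"
      unfolding lborel_distr_plus by (rule fint)
    then show ?thesis
      by (subst (asm) integrable_distr_eq) (auto simp: add.commute)
  qed
  have q0: "(\<integral>x. q n x \<partial>lborel) = 0" for n
  proof -
    have "(\<integral>x. f (x + c) \<partial>lborel) = (\<integral>x. f x \<partial>lborel)" for c
      using integral_translation[OF fm, of c] by (simp add: add.commute)
    then show ?thesis
      unfolding q_def using fint fint' by simp
  qed
  have "(\<lambda>n. \<integral>x. q n x \<partial>lborel) \<longlonglongrightarrow> (\<integral>x. f' x v \<partial>lborel)"
  proof (rule integral_dominated_convergence)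
    \<comment> \<open>The steps of the quotients have length at most \<open>norm v\<close>, so
      outside this ball both evaluation points lie where \<open>f\<close> vanishes.\<close>
    show "integrable lborel (\<lambda>x. indicator (ball 0 (B + norm v + 1)) x *\<^sub>R M)"
      using emeasure_lborel_ball_finite
      by (intro integrable_scaleR_left impI integrable_real_indicator) auto
    show "AE x in lborel. norm (q n x) \<le> indicator (ball 0 (B + norm v + 1)) x *\<^sub>R M" for n
    proof (rule AE_I2)
      fix x
      let ?h = "1 / real (Suc n)"
      show "norm (q n x) \<le> indicator (ball 0 (B + norm v + 1)) x *\<^sub>R M"
      proof (cases "x \<in> ball 0 (B + norm v + 1)")
        case True
        have "norm (f (x + ?h *\<^sub>R v) - f (x + 0 *\<^sub>R v)) \<le> M * norm (?h - 0)"
        proof (rule differentiable_bound[where S = "{0..?h}"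
              and f' = "\<lambda>t s. s *\<^sub>R f' (x + t *\<^sub>R v) v"])
          show "((\<lambda>t. f (x + t *\<^sub>R v)) has_derivative (\<lambda>s. s *\<^sub>R f' (x + t *\<^sub>R v) v)) (at t within {0..?h})" for t
            using has_derivative_along_line[OF der] by (simp add: has_vector_derivative_def)
          show "onorm (\<lambda>s. s *\<^sub>R f' (x + t *\<^sub>R v) v) \<le> M" for t
            using M by (intro onorm_le) (simp add: mult.commute[of M] mult_left_mono)
        qed auto
        then have "norm (f (x + ?h *\<^sub>R v) - f x) \<le> M * ?h" by simp
        then have "real (Suc n) * norm (f (x + ?h *\<^sub>R v) - f x) \<le> M"
          by (simp add: pos_le_divide_eq mult.commute del: of_nat_Suc)
        then show ?thesis
          using True by (simp add: q_def del: of_nat_Suc)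
      next
        case False
        then have nx: "norm x \<ge> B + norm v + 1" by simp
        have "norm (?h *\<^sub>R v) \<le> norm v"
          using mult_right_mono[of ?h 1 "norm v"] by simp
        moreover have "norm x \<le> norm (x + ?h *\<^sub>R v) + norm (?h *\<^sub>R v)"
          using norm_triangle_ineq4[of "x + ?h *\<^sub>R v" "?h *\<^sub>R v"] by simp
        ultimately have "norm (x + ?h *\<^sub>R v) \<ge> B" "norm x \<ge> B"
          using nx norm_ge_zero[of v] by linarith+
        then have "q n x = 0"
          unfolding q_def by (simp only: supp(1) diff_self scaleR_zero_right)
        then show ?thesis using M(1) by simp
      qed
    qed
    show "AE x in lborel. (\<lambda>n. q n x) \<longlonglongrightarrow> f' x v"
    proof (rule AE_I2)
      fix x
      have "((\<lambda>t. f (x + t *\<^sub>R v)) has_vector_derivative f' (x + 0 *\<^sub>R v) v) (at 0)"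
        by (rule has_derivative_along_line[OF der])
      then have lim: "((\<lambda>t. norm (f (x + t *\<^sub>R v) - f x - t *\<^sub>R f' x v) / norm t) \<longlongrightarrow> 0) (at 0)"
        by (simp add: has_vector_derivative_def has_derivative_at)
      have eq: "norm (f (x + t *\<^sub>R v) - f x - t *\<^sub>R f' x v) / norm t
          = norm ((f (x + t *\<^sub>R v) - f x) /\<^sub>R t - f' x v)" if "t \<noteq> 0" for t
      proof -
        have "(f (x + t *\<^sub>R v) - f x) /\<^sub>R t - f' x v
            = (f (x + t *\<^sub>R v) - f x - t *\<^sub>R f' x v) /\<^sub>R t"
          using that by (simp add: scaleR_diff_right)
        then show ?thesis by (simp add: divide_inverse mult.commute)
      qed
      have "((\<lambda>t. norm ((f (x + t *\<^sub>R v) - f x) /\<^sub>R t - f' x v)) \<longlongrightarrow> 0) (at 0)"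
        by (rule Lim_transform_eventually[OF lim]) (intro eventually_at_filter[THEN iffD2] always_eventually allI impI eq)
      then have "((\<lambda>t. (f (x + t *\<^sub>R v) - f x) /\<^sub>R t) \<longlongrightarrow> f' x v) (at 0)"
        by (rule LIM_zero_cancel[OF tendsto_norm_zero_cancel])
      moreover have "filterlim (\<lambda>n. 1 / real (Suc n)) (at 0) sequentially"
        using LIMSEQ_inverse_real_of_nat by (auto simp: filterlim_at inverse_eq_divide)
      ultimately have "(\<lambda>n. (f (x + (1 / real (Suc n)) *\<^sub>R v) - f x) /\<^sub>R (1 / real (Suc n))) \<longlonglongrightarrow> f' x v"
        by (rule filterlim_compose)
      then show "(\<lambda>n. q n x) \<longlonglongrightarrow> f' x v"
        by (simp add: q_def)
    qed
  qed auto
  then show ?thesis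
    by (simp add: q0 LIMSEQ_const_iff)
qed

lemma integration_by_parts:
  fixes f :: "'a::euclidean_space \<Rightarrow> real" and g :: "'a \<Rightarrow> 'b::euclidean_space"
  assumes f: "\<And>x. (f has_derivative f' x) (at x)" "continuous_on UNIV (\<lambda>x. f' x v)"
    and g: "\<And>x. (g has_derivative g' x) (at x)" "continuous_on UNIV (\<lambda>x. g' x v)"
    and supp: "\<And>x. norm x \<ge> B \<Longrightarrow> g x = 0" "\<And>x. norm x \<ge> B \<Longrightarrow> g' x v = 0"
  shows "(\<integral>x. f x *\<^sub>R g' x v \<partial>lborel) = - (\<integral>x. f' x v *\<^sub>R g x \<partial>lborel)"
proof -
  have fc: "continuous_on UNIV f" and gc: "continuous_on UNIV g"
    by (intro continuous_at_imp_continuous_on ballI has_derivative_continuous[OF f(1)]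
        has_derivative_continuous[OF g(1)])+
  have "(\<integral>x. f x *\<^sub>R g' x v + f' x v *\<^sub>R g x \<partial>lborel) = 0"
  proof (rule integral_directional_derivative_eq_0[where f = "\<lambda>x. f x *\<^sub>R g x" and B = B])
    show "((\<lambda>x. f x *\<^sub>R g x) has_derivative (\<lambda>v. f x *\<^sub>R g' x v + f' x v *\<^sub>R g x)) (at x)" for x
      by (intro has_derivative_scaleR f g)
    show "continuous_on UNIV (\<lambda>x. f x *\<^sub>R g' x v + f' x v *\<^sub>R g x)"
      by (intro continuous_intros fc gc f g)
  qed (use supp in auto)
  moreover have "integrable lborel (\<lambda>x. f x *\<^sub>R g' x v)"
    by (intro integrable_continuous_bounded_support[where B = B] continuous_on_scaleR fc g)
      (simp add: supp)
  moreover have "integrable lborel (\<lambda>x. f' x v *\<^sub>R g x)"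
    by (intro integrable_continuous_bounded_support[where B = B] continuous_on_scaleR gc f)
      (simp add: supp)
  ultimately show ?thesis
    by (simp add: eq_neg_iff_add_eq_0)
qed

section \<open>Approximation in \<open>L\<^sup>p\<close>\<close>

text \<open>Either \<open>t \<le> \<tau>\<close>, or the nonpositive exponent \<open>1 - p\<close>
  gives \<open>t powr (1 - p) \<le> \<tau> powr (1 - p)\<close>. On bounded sets this plays the part
  of Hoelder's inequality, with \<open>\<tau>\<close> left free for later tuning.\<close>

lemma le_add_powr:
  fixes t \<tau> p :: real
  assumes "t \<ge> 0" "\<tau> > 0" "p \<ge> 1"
  shows "t \<le> \<tau> + \<tau> powr (1 - p) * t powr p"
proof (cases "t \<le> \<tau>")
  case True
  then show ?thesis by (simp add: add_increasing2)
next
  case False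
  then have "t = t powr (1 - p) * t powr p"
    using assms by (simp flip: powr_add)
  also have "\<dots> \<le> \<tau> powr (1 - p) * t powr p"
    using False assms by (intro mult_right_mono powr_mono2') auto
  finally show ?thesis using assms by linarith
qed

lemma integrable_lebesgue_iff_lborel:
  fixes f :: "'a::euclidean_space \<Rightarrow> 'b::{banach, second_countable_topology}"
  shows "f \<in> borel_measurable borel \<Longrightarrow> integrable lebesgue f \<longleftrightarrow> integrable lborel f"
  by (simp add: integrable_completion)

lemma integral_lebesgue_eq_lborel:
  fixes f :: "'a::euclidean_space \<Rightarrow> 'b::{banach, second_countable_topology}"
  shows "f \<in> borel_measurable borel \<Longrightarrow> integral\<^sup>L lebesgue f = integral\<^sup>L lborel f"
  by (simp add: integral_completion)

lemma integrable_indicator_ball [simp]: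
  "integrable lebesgue (indicat_real (ball 0 B :: 'a::euclidean_space set))"
  using emeasure_lborel_ball_finite[of 0 B] by (intro integrable_real_indicator) simp_all

context
  fixes \<beta> :: "'a::euclidean_space \<Rightarrow> real" and M B p :: real
  assumes \<beta>: "\<beta> \<in> borel_measurable lebesgue" "\<And>x. \<bar>\<beta> x\<bar> \<le> M" "\<And>x. norm x \<ge> B \<Longrightarrow> \<beta> x = 0"
    and M: "M \<ge> 0" and p: "p \<ge> 1"
begin

lemma norm_weighted_le:
  assumes "\<tau> > 0"
  shows "norm (\<beta> x *\<^sub>R y) \<le> M * \<tau> * indicat_real (ball 0 B) x + M * \<tau> powr (1 - p) * norm y powr p"
proof (cases "norm x < B")
  case True
  have "norm (\<beta> x *\<^sub>R y) \<le> M * norm y"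
    using \<beta>(2) by (simp add: mult_right_mono)
  also have "\<dots> \<le> M * (\<tau> + \<tau> powr (1 - p) * norm y powr p)"
    using M assms p by (intro mult_left_mono le_add_powr) auto
  finally show ?thesis using True by (simp add: algebra_simps)
next
  case False
  then show ?thesis using \<beta>(3)[of x] M by simp
qed

lemma integrable_weighted:
  fixes f :: "'a \<Rightarrow> 'b::euclidean_space"
  assumes [measurable]: "f \<in> borel_measurable lebesgue" and f: "integrable lebesgue (\<lambda>x. norm (f x) powr p)"
  shows "integrable lebesgue (\<lambda>x. \<beta> x *\<^sub>R f x)"
proof (rule Bochner_Integration.integrable_bound)
  show "integrable lebesgue (\<lambda>x. M * 1 * indicat_real (ball 0 B) x + M * 1 powr (1 - p) * norm (f x) powr p)"
    using f by (intro Bochner_Integration.integrable_add integrable_mult_right) auto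
  show "(\<lambda>x. \<beta> x *\<^sub>R f x) \<in> borel_measurable lebesgue"
    using \<beta>(1) by measurable
  show "AE x in lebesgue. norm (\<beta> x *\<^sub>R f x)
      \<le> norm (M * 1 * indicat_real (ball 0 B) x + M * 1 powr (1 - p) * norm (f x) powr p)"
    using norm_weighted_le[of 1] by (auto intro!: AE_I2 order_trans[OF _ abs_ge_self])
qed

lemma norm_integral_weighted_le:
  fixes f :: "'a \<Rightarrow> 'b::euclidean_space"
  assumes "f \<in> borel_measurable lebesgue" and f: "integrable lebesgue (\<lambda>x. norm (f x) powr p)"
    and "\<tau> > 0"
  shows "norm (\<integral>x. \<beta> x *\<^sub>R f x \<partial>lebesgue)
      \<le> M * \<tau> * measure lebesgue (ball (0::'a) B) + M * \<tau> powr (1 - p) * (\<integral>x. norm (f x) powr p \<partial>lebesgue)"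
proof -
  have "norm (\<integral>x. \<beta> x *\<^sub>R f x \<partial>lebesgue) \<le> (\<integral>x. norm (\<beta> x *\<^sub>R f x) \<partial>lebesgue)"
    by (rule integral_norm_bound)
  also have "\<dots> \<le> (\<integral>x. M * \<tau> * indicat_real (ball 0 B) x + M * \<tau> powr (1 - p) * norm (f x) powr p \<partial>lebesgue)"
    using f integrable_weighted[OF assms(1,2)]
    by (intro integral_mono norm_weighted_le[OF assms(3)] integrable_norm Bochner_Integration.integrable_add integrable_mult_right) auto
  also have "\<dots> = M * \<tau> * measure lebesgue (ball (0::'a) B)
      + M * \<tau> powr (1 - p) * (\<integral>x. norm (f x) powr p \<partial>lebesgue)"
    using f by (subst Bochner_Integration.integral_add) auto
  finally show ?thesis .
qed

text \<open>\<open>\<tau>\<close> is fixed first, making the volume term at most half the tolerance;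
  then the \<open>L\<^sup>p\<close> term, whatever its factor, falls below the other half as
  \<open>j\<close> grows.\<close>

lemma tendsto_integral_weighted_0:
  fixes f :: "nat \<Rightarrow> 'a \<Rightarrow> 'b::euclidean_space"
  assumes "\<And>j. f j \<in> borel_measurable lebesgue" and "\<And>j. integrable lebesgue (\<lambda>x. norm (f j x) powr p)"
    and lim: "(\<lambda>j. \<integral>x. norm (f j x) powr p \<partial>lebesgue) \<longlonglongrightarrow> 0"
  shows "(\<lambda>j. \<integral>x. \<beta> x *\<^sub>R f j x \<partial>lebesgue) \<longlonglongrightarrow> 0"
proof (rule tendsto_norm_zero_cancel, rule order_tendstoI)
  fix a :: real assume "a > 0"
  define m where "m = measure lebesgue (ball (0::'a) B)"
  \<comment> \<open>The summand 1 keeps the denominator positive when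
    \<open>M * m = 0\<close>.\<close>
  define \<tau> where "\<tau> = a / (2 * (M * m + 1))"
  have m: "m \<ge> 0" by (simp add: m_def)
  have Mm: "M * m \<ge> 0" using M m by simp
  then have \<tau>: "\<tau> > 0" "M * \<tau> * m \<le> a / 2"
    using \<open>a > 0\<close> by (auto simp: \<tau>_def field_simps intro!: divide_pos_pos add_nonneg_pos)
  have "(\<lambda>j. M * \<tau> powr (1 - p) * (\<integral>x. norm (f j x) powr p \<partial>lebesgue)) \<longlonglongrightarrow> 0"
    using tendsto_mult_right_zero[OF lim] by simp
  then have "\<forall>\<^sub>F j in sequentially. M * \<tau> powr (1 - p) * (\<integral>x. norm (f j x) powr p \<partial>lebesgue) < a / 2"
    using \<open>a > 0\<close> by (intro order_tendstoD) auto
  then show "\<forall>\<^sub>F j in sequentially. norm (\<integral>x. \<beta> x *\<^sub>R f j x \<partial>lebesgue) < a"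
  proof eventually_elim
    case (elim j)
    show ?case
      using norm_integral_weighted_le[OF assms(1,2) \<tau>(1), of j] \<tau>(2) elim by (simp add: m_def)
  qed
qed (auto intro!: always_eventually less_le_trans[OF _ norm_ge_zero])

end

section \<open>Lebesgue spaces and approximation by test functions\<close>

lemma crit_exp_gt_2: "d \<ge> 3 \<Longrightarrow> crit_exp d > 2"
  by (simp add: crit_exp_def field_simps)

text \<open>Equality holds for \<open>d = 3\<close>. In the momentum estimate this bound lets the
  cube of a small \<open>|u|\<close> be dominated by \<open>|u| powr (p / 2)\<close>.\<close>

lemma crit_exp_le_6: "d \<ge> 3 \<Longrightarrow> crit_exp d \<le> 6"
  by (simp add: crit_exp_def field_simps)

lemma powr_add_le:
  fixes a b p :: real
  assumes "a \<ge> 0" "b \<ge> 0" "p \<ge> 0"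
  shows "(a + b) powr p \<le> 2 powr p * (a powr p + b powr p)"
proof -
  have "(a + b) powr p \<le> (2 * max a b) powr p"
    using assms by (intro powr_mono2) auto
  also have "\<dots> = 2 powr p * max a b powr p"
    using assms by (simp add: powr_mult)
  also have "\<dots> \<le> 2 powr p * (a powr p + b powr p)"
    by (intro mult_left_mono) (auto simp: max_def)
  finally show ?thesis .
qed

lemma in_Lp_add:
  assumes "in_Lp p f" "in_Lp p g" "p \<ge> 0"
  shows "in_Lp p (\<lambda>x. f x + g x)"
proof -
  have [measurable]: "f \<in> borel_measurable lebesgue" "g \<in> borel_measurable lebesgue"
    using assms by (auto simp: in_Lp_def)
  have "integrable lebesgue (\<lambda>x. norm (f x + g x) powr p)"
  proof (rule Bochner_Integration.integrable_bound)
    show "integrable lebesgue (\<lambda>x. 2 powr p * (norm (f x) powr p + norm (g x) powr p))"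
      using assms by (auto simp: in_Lp_def)
    show "AE x in lebesgue. norm (norm (f x + g x) powr p) \<le> norm (2 powr p * (norm (f x) powr p + norm (g x) powr p))"
    proof (rule AE_I2)
      fix x
      have "norm (f x + g x) powr p \<le> (norm (f x) + norm (g x)) powr p"
        using assms(3) by (intro powr_mono2 norm_triangle_ineq) auto
      also have "\<dots> \<le> 2 powr p * (norm (f x) powr p + norm (g x) powr p)"
        using assms(3) by (intro powr_add_le) auto
      finally show "norm (norm (f x + g x) powr p) \<le> norm (2 powr p * (norm (f x) powr p + norm (g x) powr p))"
        by simp
    qed
  qed measurable
  then show ?thesis by (simp add: in_Lp_def)
qed

lemma in_Lp_mono:
  assumes "in_Lp p f" "g \<in> borel_measurable lebesgue" "\<And>x. norm (g x) \<le> C * norm (f x)" "p \<ge> 0" "C \<ge> 0"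
  shows "in_Lp p g"
proof -
  have [measurable]: "f \<in> borel_measurable lebesgue" "g \<in> borel_measurable lebesgue"
    using assms by (auto simp: in_Lp_def)
  have "integrable lebesgue (\<lambda>x. norm (g x) powr p)"
  proof (rule Bochner_Integration.integrable_bound)
    show "integrable lebesgue (\<lambda>x. C powr p * norm (f x) powr p)"
      using assms by (auto simp: in_Lp_def)
    show "AE x in lebesgue. norm (norm (g x) powr p) \<le> norm (C powr p * norm (f x) powr p)"
      using assms(3-5) by (auto intro!: AE_I2 powr_mono2 simp flip: powr_mult)
  qed measurable
  then show ?thesis by (simp add: in_Lp_def)
qed

lemma in_Lp_minus: "in_Lp p f \<Longrightarrow> in_Lp p (\<lambda>x. - f x)"
  by (simp add: in_Lp_def)

lemma in_Lp_diff:
  assumes "in_Lp p f" "in_Lp p g" "p \<ge> 0"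
  shows "in_Lp p (\<lambda>x. f x - g x)"
  using in_Lp_add[OF assms(1) in_Lp_minus[OF assms(2)] assms(3)] by simp

lemma in_Lp_continuous_bounded_support:
  fixes f :: "'a::euclidean_space \<Rightarrow> 'b::euclidean_space"
  assumes "continuous_on UNIV f" "\<And>x. norm x \<ge> B \<Longrightarrow> f x = 0" "p > 0"
  shows "in_Lp p f"
proof -
  have c: "continuous_on UNIV (\<lambda>x. norm (f x) powr p)"
    using assms by (intro continuous_on_powr' continuous_intros) auto
  have "integrable lborel (\<lambda>x. norm (f x) powr p)"
    using assms by (intro integrable_continuous_bounded_support[OF c, of B]) auto
  then show ?thesis
    using assms(1) c borel_measurable_continuous_onI continuous_lebesgue_measurable
    by (auto simp: in_Lp_def integrable_lebesgue_iff_lborel)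
qed

lemma test_fun_in_Lp: "test_fun \<psi> \<Longrightarrow> p > 0 \<Longrightarrow> in_Lp p \<psi>"
  using test_fun_supp in_Lp_continuous_bounded_support test_fun_continuous by metis

lemma classical_grad_supp:
  assumes "test_fun \<psi>"
  obtains B where "B > 0" "\<And>x. norm x \<ge> B \<Longrightarrow> \<psi> x = 0" "\<And>x. norm x \<ge> B \<Longrightarrow> classical_grad \<psi> x = 0"
  using test_fun_supp[OF assms] by (metis (no_types, lifting) classical_grad_nth vec_eq_iff zero_index)

lemma classical_grad_in_Lp: "test_fun \<psi> \<Longrightarrow> p > 0 \<Longrightarrow> in_Lp p (classical_grad \<psi>)"
  using classical_grad_supp in_Lp_continuous_bounded_support test_fun_grad_continuous by metis

lemma in_Lp_2_iff:
  "in_Lp 2 f \<longleftrightarrow> f \<in> borel_measurable lebesgue \<and> integrable lebesgue (\<lambda>x. (norm (f x))\<^sup>2)"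
  by (simp add: in_Lp_def)

lemma Lp_tendsto_AE_subseq:
  fixes f :: "nat \<Rightarrow> 'a \<Rightarrow> 'b::euclidean_space"
  assumes f: "\<And>j. integrable M (\<lambda>x. norm (f j x) powr p)" and p: "p > 0"
    and lim: "(\<lambda>j. \<integral>x. norm (f j x) powr p \<partial>M) \<longlonglongrightarrow> 0"
  obtains r :: "nat \<Rightarrow> nat" where "strict_mono r" "AE x in M. (\<lambda>j. f (r j) x) \<longlonglongrightarrow> 0"
proof -
  have "(\<lambda>j. \<integral>x. norm (norm (f j x) powr p) \<partial>M) \<longlonglongrightarrow> 0"
    using lim by simp
  then obtain r :: "nat \<Rightarrow> nat" where r: "strict_mono r" "AE x in M. (\<lambda>j. norm (f (r j) x) powr p) \<longlonglongrightarrow> 0"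
    using tendsto_L1_AE_subseq[of M "\<lambda>j x. norm (f j x) powr p"] f by blast
  have "AE x in M. (\<lambda>j. f (r j) x) \<longlonglongrightarrow> 0"
    using r(2)
  proof eventually_elim
    case (elim x)
    have "(\<lambda>j. (norm (f (r j) x) powr p) powr (1 / p)) \<longlonglongrightarrow> 0 powr (1 / p)"
      using p by (intro tendsto_powr'[OF elim]) auto
    then show ?case
      using p by (intro tendsto_norm_zero_cancel[of "\<lambda>j. f (r j) x"]) (simp add: powr_powr)
  qed
  with r(1) show ?thesis using that by blast
qed

text \<open>The sequence behind \<open>D12_grad\<close> after passing to a subsequence that also
  converges almost everywhere, as Fatou's lemma and dominated convergence require. The differences
  are recorded as elements of the Lebesgue spaces because a Bochner integral tending to zero says
  nothing about a non-integrable function.\<close>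

definition D12_approx ::
    "(real ^ 'n \<Rightarrow> complex) \<Rightarrow> (real ^ 'n \<Rightarrow> complex ^ 'n) \<Rightarrow> (nat \<Rightarrow> real ^ 'n \<Rightarrow> complex) \<Rightarrow> bool" where
  "D12_approx u G \<psi> \<longleftrightarrow> (\<forall>j. test_fun (\<psi> j)) \<and>
    (\<lambda>j. \<integral>x. norm (\<psi> j x - u x) powr crit_exp CARD('n) \<partial>lebesgue) \<longlonglongrightarrow> 0 \<and>
    (\<lambda>j. \<integral>x. (norm (classical_grad (\<psi> j) x - G x))\<^sup>2 \<partial>lebesgue) \<longlonglongrightarrow> 0 \<and>
    (\<forall>j. in_Lp (crit_exp CARD('n)) (\<lambda>x. \<psi> j x - u x)) \<and>
    (\<forall>j. in_Lp 2 (\<lambda>x. classical_grad (\<psi> j) x - G x)) \<and>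
    (AE x in lebesgue. (\<lambda>j. \<psi> j x) \<longlonglongrightarrow> u x)"

lemma D12_approxD:
  fixes u :: "real ^ 'n \<Rightarrow> complex"
  assumes "D12_approx u G \<psi>"
  shows "test_fun (\<psi> j)"
    and "(\<lambda>j. \<integral>x. norm (\<psi> j x - u x) powr crit_exp CARD('n) \<partial>lebesgue) \<longlonglongrightarrow> 0"
    and "(\<lambda>j. \<integral>x. (norm (classical_grad (\<psi> j) x - G x))\<^sup>2 \<partial>lebesgue) \<longlonglongrightarrow> 0"
    and "in_Lp (crit_exp CARD('n)) (\<lambda>x. \<psi> j x - u x)"
    and "in_Lp 2 (\<lambda>x. classical_grad (\<psi> j) x - G x)"
    and "AE x in lebesgue. (\<lambda>j. \<psi> j x) \<longlonglongrightarrow> u x"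
  using assms by (auto simp: D12_approx_def)

lemma D12_grad_approx:
  fixes u :: "real ^ 'n \<Rightarrow> complex"
  assumes D: "D12_grad u G" and d: "CARD('n) \<ge> 3"
  obtains \<psi> where "D12_approx u G \<psi>"
proof -
  let ?p = "crit_exp CARD('n)"
  have p: "?p > 0" using crit_exp_gt_2[OF d] by simp
  obtain \<psi> where \<psi>: "\<And>j::nat. test_fun (\<psi> j)"
    "(\<lambda>j. \<integral>x. norm (\<psi> j x - u x) powr ?p \<partial>lebesgue) \<longlonglongrightarrow> 0"
    "(\<lambda>j. \<integral>x. (norm (classical_grad (\<psi> j) x - G x))\<^sup>2 \<partial>lebesgue) \<longlonglongrightarrow> 0"
    using D by (auto simp: D12_grad_def)
  have "in_Lp ?p u" "in_Lp 2 G"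
    using D by (auto simp: D12_grad_def)
  then have L: "in_Lp ?p (\<lambda>x. \<psi> j x - u x)" "in_Lp 2 (\<lambda>x. classical_grad (\<psi> j) x - G x)" for j
    using p \<psi>(1) by (simp_all add: in_Lp_diff test_fun_in_Lp classical_grad_in_Lp)
  have i: "integrable lebesgue (\<lambda>x. norm (\<psi> j x - u x) powr ?p)" for j
    using L(1) by (auto simp: in_Lp_def)
  obtain r where r: "strict_mono r" "AE x in lebesgue. (\<lambda>j. \<psi> (r j) x - u x) \<longlonglongrightarrow> 0"
    by (rule Lp_tendsto_AE_subseq[OF i p \<psi>(2)])
  have "AE x in lebesgue. (\<lambda>j. \<psi> (r j) x) \<longlonglongrightarrow> u x"
    using r(2) by eventually_elim (rule LIM_zero_cancel)
  then have "D12_approx u G (\<lambda>j. \<psi> (r j))"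
    using \<psi>(1) L LIMSEQ_subseq_LIMSEQ[OF \<psi>(2) r(1)] LIMSEQ_subseq_LIMSEQ[OF \<psi>(3) r(1)]
    by (simp add: D12_approx_def o_def)
  then show ?thesis by (rule that)
qed

text \<open>The identity for test functions passes to the limit on both sides because
  \<open>\<eta>\<close> and its partial derivative are bounded with bounded support: the gradients
  converge in \<open>L\<^sup>2\<close>, the functions in \<open>L\<^sup>p\<close>.\<close>

lemma D12_grad_by_parts:
  fixes u :: "real ^ 'n \<Rightarrow> complex" and \<eta> :: "real ^ 'n \<Rightarrow> real"
  assumes D: "D12_grad u G" and d: "CARD('n) \<ge> 3"
    and \<eta>: "\<And>x. (\<eta> has_derivative \<eta>' x) (at x)" "continuous_on UNIV (\<lambda>x. \<eta>' x (axis i 1))"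
    and supp: "\<And>x. norm x \<ge> B \<Longrightarrow> \<eta> x = 0" "\<And>x. norm x \<ge> B \<Longrightarrow> \<eta>' x (axis i 1) = 0"
  shows "(\<integral>x. \<eta> x *\<^sub>R (G x $ i) \<partial>lebesgue) = - (\<integral>x. \<eta>' x (axis i 1) *\<^sub>R u x \<partial>lebesgue)"
    and "integrable lebesgue (\<lambda>x. \<eta> x *\<^sub>R (G x $ i))"
    and "integrable lebesgue (\<lambda>x. \<eta>' x (axis i 1) *\<^sub>R u x)"
proof -
  let ?p = "crit_exp CARD('n)"
  have p: "?p \<ge> 1" using crit_exp_gt_2[OF d] by simp
  obtain \<psi> where "D12_approx u G \<psi>"
    by (rule D12_grad_approx[OF D d])
  note \<psi> = D12_approxD[OF this]
  have uG: "in_Lp ?p u" "in_Lp 2 G"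
    using D by (auto simp: D12_grad_def)
  have \<eta>c: "continuous_on UNIV \<eta>"
    by (intro continuous_at_imp_continuous_on ballI has_derivative_continuous[OF \<eta>(1)])
  obtain M where M: "M > 0" "\<And>x. norm (\<eta> x) \<le> M"
    using bounded_continuous_bounded_support[OF \<eta>c supp(1)] by blast
  obtain M' where M': "M' > 0" "\<And>x. norm (\<eta>' x (axis i 1)) \<le> M'"
    using bounded_continuous_bounded_support[OF \<eta>(2) supp(2)] by blast
  note w1 = continuous_lebesgue_measurable[OF \<eta>c] M(2)[unfolded real_norm_def] supp(1) less_imp_le[OF M(1)]
  note w2 = continuous_lebesgue_measurable[OF \<eta>(2)] M'(2)[unfolded real_norm_def] supp(2) less_imp_le[OF M'(1)]
  have nth: "in_Lp 2 (\<lambda>x. H x $ i)" if "in_Lp 2 H" for H :: "real ^ 'n \<Rightarrow> complex ^ 'n"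
    using that measurable_compose[OF _ vec_nth_measurable, of H lebesgue i] Finite_Cartesian_Product.norm_nth_le
    by (intro in_Lp_mono[OF that, where C = 1]) (auto simp: in_Lp_def)
  have int: "integrable lebesgue (\<lambda>x. \<eta> x *\<^sub>R (H x $ i))" if "in_Lp 2 H" for H :: "real ^ 'n \<Rightarrow> complex ^ 'n"
    using nth[OF that] by (intro integrable_weighted[OF w1, where p = 2]) (auto simp: in_Lp_def)
  have int': "integrable lebesgue (\<lambda>x. \<eta>' x (axis i 1) *\<^sub>R h x)" if "in_Lp ?p h" for h :: "real ^ 'n \<Rightarrow> complex"
    using that by (intro integrable_weighted[OF w2 p]) (auto simp: in_Lp_def)
  show intG: "integrable lebesgue (\<lambda>x. \<eta> x *\<^sub>R (G x $ i))" and intu: "integrable lebesgue (\<lambda>x. \<eta>' x (axis i 1) *\<^sub>R u x)"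
    using int int' uG by auto
  have c0: "(\<lambda>j. \<integral>x. \<eta> x *\<^sub>R ((classical_grad (\<psi> j) x - G x) $ i) \<partial>lebesgue) \<longlonglongrightarrow> 0"
  proof (rule tendsto_integral_weighted_0[OF w1, where p = 2])
    show m: "(\<lambda>x. (classical_grad (\<psi> j) x - G x) $ i) \<in> borel_measurable lebesgue"
      and "integrable lebesgue (\<lambda>x. norm ((classical_grad (\<psi> j) x - G x) $ i) powr 2)" for j
      using nth[OF \<psi>(5)] by (simp_all only: in_Lp_def)
    show "(\<lambda>j. \<integral>x. norm ((classical_grad (\<psi> j) x - G x) $ i) powr 2 \<partial>lebesgue) \<longlonglongrightarrow> 0"
    proof (rule tendsto_sandwich[OF _ _ tendsto_const \<psi>(3)])
      show "\<forall>\<^sub>F j in sequentially. (\<integral>x. norm ((classical_grad (\<psi> j) x - G x) $ i) powr 2 \<partial>lebesgue)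
          \<le> (\<integral>x. (norm (classical_grad (\<psi> j) x - G x))\<^sup>2 \<partial>lebesgue)"
      proof (intro always_eventually allI integral_mono)
        fix j
        show "integrable lebesgue (\<lambda>x. norm ((classical_grad (\<psi> j) x - G x) $ i) powr 2)"
          using nth[OF \<psi>(5)] by (simp only: in_Lp_def)
        show "integrable lebesgue (\<lambda>x. (norm (classical_grad (\<psi> j) x - G x))\<^sup>2)"
          using \<psi>(5) by (simp add: in_Lp_2_iff)
        show "norm ((classical_grad (\<psi> j) x - G x) $ i) powr 2 \<le> (norm (classical_grad (\<psi> j) x - G x))\<^sup>2" for x
          using Finite_Cartesian_Product.norm_nth_le[of "classical_grad (\<psi> j) x - G x" i] by (simp add: power_mono)
      qed
    qed (auto intro!: always_eventually integral_nonneg_AE)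
  qed simp_all
  have c1: "(\<lambda>j. \<integral>x. \<eta>' x (axis i 1) *\<^sub>R (\<psi> j x - u x) \<partial>lebesgue) \<longlonglongrightarrow> 0"
    using \<psi>(2,4) by (intro tendsto_integral_weighted_0[OF w2 p]) (auto simp: in_Lp_def)
  have parts: "(\<integral>x. \<eta> x *\<^sub>R (classical_grad (\<psi> j) x $ i) \<partial>lebesgue) = - (\<integral>x. \<eta>' x (axis i 1) *\<^sub>R \<psi> j x \<partial>lebesgue)" for j
  proof -
    obtain B where B: "\<And>x. norm x \<ge> B \<Longrightarrow> \<psi> j x = 0" "\<And>x. norm x \<ge> B \<Longrightarrow> classical_grad (\<psi> j) x = 0"
      using classical_grad_supp[OF \<psi>(1)] by metis
    have cg: "continuous_on UNIV (\<lambda>x. classical_grad (\<psi> j) x $ i)"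
      by (intro continuous_intros test_fun_grad_continuous \<psi>)
    have "(\<integral>x. \<eta> x *\<^sub>R (frechet_derivative (\<psi> j) (at x) (axis i 1)) \<partial>lborel) = - (\<integral>x. \<eta>' x (axis i 1) *\<^sub>R \<psi> j x \<partial>lborel)"
      using cg B by (intro integration_by_parts[where B = B] \<eta> test_fun_has_derivative \<psi>)
        (auto simp flip: classical_grad_nth)
    moreover have "(\<lambda>x. \<eta> x *\<^sub>R (classical_grad (\<psi> j) x $ i)) \<in> borel_measurable borel"
      by (intro borel_measurable_continuous_onI continuous_on_scaleR \<eta>c cg)
    moreover have "(\<lambda>x. \<eta>' x (axis i 1) *\<^sub>R \<psi> j x) \<in> borel_measurable borel"
      by (intro borel_measurable_continuous_onI continuous_on_scaleR \<eta> test_fun_continuous \<psi>)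
    ultimately show ?thesis
      by (simp add: integral_lebesgue_eq_lborel classical_grad_nth)
  qed
  have e0: "(\<integral>x. \<eta> x *\<^sub>R ((classical_grad (\<psi> j) x - G x) $ i) \<partial>lebesgue)
      = (\<integral>x. \<eta> x *\<^sub>R (classical_grad (\<psi> j) x $ i) \<partial>lebesgue) - (\<integral>x. \<eta> x *\<^sub>R (G x $ i) \<partial>lebesgue)" for j
    using int[OF classical_grad_in_Lp[OF \<psi>(1)]] intG by (simp add: scaleR_diff_right)
  have e1: "(\<integral>x. \<eta>' x (axis i 1) *\<^sub>R (\<psi> j x - u x) \<partial>lebesgue)
      = (\<integral>x. \<eta>' x (axis i 1) *\<^sub>R \<psi> j x \<partial>lebesgue) - (\<integral>x. \<eta>' x (axis i 1) *\<^sub>R u x \<partial>lebesgue)" for j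
    using int'[OF test_fun_in_Lp[OF \<psi>(1)]] p intu by (simp add: scaleR_diff_right)
  \<comment> \<open>By \<open>parts\<close> the terms depending on \<open>j\<close> cancel in the
    sum of the two null sequences, so this sum is a constant, necessarily zero.\<close>
  have "(\<lambda>j::nat. - (\<integral>x. \<eta> x *\<^sub>R (G x $ i) \<partial>lebesgue) - (\<integral>x. \<eta>' x (axis i 1) *\<^sub>R u x \<partial>lebesgue)) \<longlonglongrightarrow> 0"
    using tendsto_add[OF c0 c1] unfolding e0 e1 parts by simp
  then have "- (\<integral>x. \<eta> x *\<^sub>R (G x $ i) \<partial>lebesgue) = (\<integral>x. \<eta>' x (axis i 1) *\<^sub>R u x \<partial>lebesgue)"
    by (simp only: LIMSEQ_const_iff right_minus_eq)
  from this[symmetric] show "(\<integral>x. \<eta> x *\<^sub>R (G x $ i) \<partial>lebesgue) = - (\<integral>x. \<eta>' x (axis i 1) *\<^sub>R u x \<partial>lebesgue)"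
    by (simp only: minus_minus)
qed

section \<open>Integrable partial derivatives have mean zero\<close>

text \<open>The squared positive part is a simple continuously differentiable profile; the cutoff
  below and \<open>smooth_step\<close> are both built from it.\<close>

lemma DERIV_max_0_power2:
  "((\<lambda>s::real. (max 0 s)\<^sup>2) has_real_derivative 2 * max 0 s) (at s)"
proof -
  consider "s < 0" | "s = 0" | "s > 0" by linarith
  then show ?thesis
  proof cases
    case 1
    have z: "((\<lambda>s::real. 0) has_real_derivative 0) (at s)" by simp
    have "((\<lambda>s::real. (max 0 s)\<^sup>2) has_real_derivative 0) (at s)"
      using 1 by (intro has_field_derivative_transform_within_open[OF z, where S = "{..<0}"]) (auto simp: max_def)
    then show ?thesis using 1 by simp
  next
    case 2
    have "((\<lambda>h::real. (max 0 h)\<^sup>2 / h) \<longlongrightarrow> 0) (at 0)"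
    proof (rule Lim_null_comparison)
      show "((\<lambda>h::real. \<bar>h\<bar>) \<longlongrightarrow> 0) (at 0)"
        using tendsto_rabs[OF tendsto_ident_at, of "0::real" UNIV] by simp
      show "\<forall>\<^sub>F h::real in at 0. norm ((max 0 h)\<^sup>2 / h) \<le> \<bar>h\<bar>"
        by (auto intro!: always_eventually simp: max_def power2_eq_square)
    qed
    then show ?thesis
      using 2 by (simp add: has_field_derivative_iff)
  next
    case 3
    have z: "((\<lambda>s::real. s\<^sup>2) has_real_derivative 2 * s) (at s)"
      by (auto intro!: derivative_eq_intros)
    have "((\<lambda>s::real. (max 0 s)\<^sup>2) has_real_derivative 2 * s) (at s)"
      using 3 by (intro has_field_derivative_transform_within_open[OF z, where S = "{0<..}"]) (auto simp: max_def)
    then show ?thesis using 3 by simp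
  qed
qed

text \<open>The cutoff \<open>\<eta>\<close> is supported in a cylinder of length \<open>S\<close> along the axis \<open>k\<close> and of radius \<open>R\<close>;
  \<open>S\<close> must be a large power of \<open>R\<close> for \<open>\<integral> \<phi> \<partial>\<^sub>k\<eta>\<close> to tend to \<open>0\<close> when \<open>\<phi>\<close> is merely in \<open>L\<^sup>p\<close>.\<close>

context
  fixes k :: "'n::finite" and R S :: real and Q :: "real ^ 'n::finite \<Rightarrow> real" and \<eta> :: "real ^ 'n \<Rightarrow> real"
    and \<eta>' :: "real ^ 'n \<Rightarrow> real ^ 'n \<Rightarrow> real"
  defines "Q \<equiv> \<lambda>x. 1 - ((x $ k)\<^sup>2 / S\<^sup>2 + (x \<bullet> x - (x $ k)\<^sup>2) / R\<^sup>2)"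
    and "\<eta> \<equiv> \<lambda>x. (max 0 (Q x))\<^sup>2"
    and "\<eta>' \<equiv> \<lambda>x h. 2 * max 0 (Q x) * - (2 * (x $ k) * (h $ k) / S\<^sup>2 + (2 * (x \<bullet> h) - 2 * (x $ k) * (h $ k)) / R\<^sup>2)"
  assumes R: "R \<ge> 1" and S: "S \<ge> R"
begin

lemma cutoff_has_derivative: "(\<eta> has_derivative \<eta>' x) (at x)"
proof -
  have "(Q has_derivative (\<lambda>h. - (2 * (x $ k) * (h $ k) / S\<^sup>2 + (2 * (x \<bullet> h) - 2 * (x $ k) * (h $ k)) / R\<^sup>2))) (at x)"
    unfolding Q_def using R S
    by (auto intro!: derivative_eq_intros bounded_linear.has_derivative[OF bounded_linear_vec_nth]
        simp: fun_eq_iff inner_commute power2_eq_square field_simps)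
  from has_derivative_compose[OF this DERIV_max_0_power2[unfolded has_field_derivative_def]]
  show ?thesis
    unfolding \<eta>_def \<eta>'_def by simp
qed

text \<open>Differentiation along the axis \<open>k\<close> removes the transverse part of
  \<open>Q\<close>, so only \<open>1 / S\<^sup>2\<close> survives and \<open>R\<close> does not
  enter the size of this derivative.\<close>

lemma cutoff_partial: "\<eta>' x (axis k 1) = - 4 * max 0 (Q x) * (x $ k) / S\<^sup>2"
  unfolding \<eta>'_def by (simp add: inner_axis)

text \<open>Because \<open>S \<ge> R\<close>, the ellipsoid \<open>Q > 0\<close> lies in the ball of
  radius \<open>S\<close>, and also in the box of half-length \<open>S\<close> along
  \<open>k\<close> and \<open>R\<close> across.\<close>

lemma Q_le: "(x $ k)\<^sup>2 / S\<^sup>2 \<le> 1 - Q x" "(x \<bullet> x) / S\<^sup>2 \<le> 1 - Q x" "i \<noteq> k \<Longrightarrow> (x $ i)\<^sup>2 / R\<^sup>2 \<le> 1 - Q x"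
proof -
  have e: "x \<bullet> x - (x $ k)\<^sup>2 = (\<Sum>i\<in>UNIV - {k}. (x $ i)\<^sup>2)"
    by (simp add: inner_vec_def power2_eq_square sum_diff1)
  then have nn: "x \<bullet> x - (x $ k)\<^sup>2 \<ge> 0" by (simp add: sum_nonneg)
  have RS: "0 < R\<^sup>2" "R\<^sup>2 \<le> S\<^sup>2" using R S by (auto intro: power_mono)
  show "(x $ k)\<^sup>2 / S\<^sup>2 \<le> 1 - Q x"
    using nn unfolding Q_def by simp
  have "(x \<bullet> x - (x $ k)\<^sup>2) / S\<^sup>2 \<le> (x \<bullet> x - (x $ k)\<^sup>2) / R\<^sup>2"
    using nn RS R S by (intro divide_left_mono) auto
  then show "(x \<bullet> x) / S\<^sup>2 \<le> 1 - Q x"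
    unfolding Q_def by (simp add: diff_divide_distrib)
  assume "i \<noteq> k"
  then have "(x $ i)\<^sup>2 \<le> x \<bullet> x - (x $ k)\<^sup>2"
    unfolding e by (intro member_le_sum) auto
  then have "(x $ i)\<^sup>2 / R\<^sup>2 \<le> (x \<bullet> x - (x $ k)\<^sup>2) / R\<^sup>2"
    by (intro divide_right_mono) auto
  moreover have "(x $ k)\<^sup>2 / S\<^sup>2 \<ge> 0" by simp
  ultimately show "(x $ i)\<^sup>2 / R\<^sup>2 \<le> 1 - Q x"
    unfolding Q_def by linarith
qed

lemma Q_le_1: "Q x \<le> 1"
proof -
  have "0 \<le> (x $ k)\<^sup>2 / S\<^sup>2" by simp
  then show ?thesis using Q_le(1)[of x] by linarith
qed

lemma cutoff_0: "norm x \<ge> S \<Longrightarrow> max 0 (Q x) = 0"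
proof -
  assume "norm x \<ge> S"
  then have "S\<^sup>2 \<le> x \<bullet> x"
    using R S by (auto simp flip: power2_norm_eq_inner)
  then have "1 \<le> (x \<bullet> x) / S\<^sup>2" using R S by (simp add: le_divide_eq)
  then show ?thesis using Q_le(2)[of x] by simp
qed

lemma cutoff_partial_le:
  "\<bar>\<eta>' x (axis k 1)\<bar> \<le> 4 / S * indicator (cbox (\<chi> i. if i = k then - S else - R) (\<chi> i. if i = k then S else R)) x"
proof (cases "Q x > 0")
  case False
  then show ?thesis using R S by (simp add: cutoff_partial)
next
  case True
  have k: "\<bar>x $ k\<bar> \<le> S"
  proof -
    have "(x $ k)\<^sup>2 / S\<^sup>2 \<le> 1" using Q_le(1)[of x] True by simp
    then have "(x $ k)\<^sup>2 \<le> S\<^sup>2" using R S by (simp add: divide_le_eq)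
    then show ?thesis using R S by (simp add: power2_le_iff_abs_le)
  qed
  have i: "\<bar>x $ i\<bar> \<le> R" if "i \<noteq> k" for i
  proof -
    have "(x $ i)\<^sup>2 / R\<^sup>2 \<le> 1" using Q_le(3)[OF that, of x] True by simp
    then have "(x $ i)\<^sup>2 \<le> R\<^sup>2" using R by (simp add: divide_le_eq)
    then show ?thesis using R by (simp add: power2_le_iff_abs_le)
  qed
  have "x \<in> cbox (\<chi> i. if i = k then - S else - R) (\<chi> i. if i = k then S else R)"
    using k i by (auto simp: mem_box_cart abs_le_iff split: if_splits) (metis minus_le_iff)+
  moreover have "\<bar>\<eta>' x (axis k 1)\<bar> \<le> 4 / S"
  proof -
    have "\<bar>\<eta>' x (axis k 1)\<bar> = 4 * Q x * \<bar>x $ k\<bar> / S\<^sup>2"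
      using True by (simp add: cutoff_partial abs_mult)
    also have "\<dots> \<le> 4 * 1 * S / S\<^sup>2"
      using True k Q_le_1[of x] R S by (intro divide_right_mono mult_mono) auto
    finally show ?thesis using R S by (simp add: power2_eq_square split: if_splits)
  qed
  ultimately show ?thesis by (simp only: indicator_simps mult_1_right)
qed

lemma cutoff_box_measure:
  "measure lebesgue (cbox (\<chi> i. if i = k then - S else - R) (\<chi> i. if i = k then S else R) :: (real ^ 'n) set)
     = 2 * S * (2 * R) ^ (CARD('n) - 1)"
proof -
  have "measure lebesgue (cbox (\<chi> i. if i = k then - S else - R) (\<chi> i. if i = k then S else R) :: (real ^ 'n) set)
     = (\<Prod>i\<in>UNIV. (if i = k then 2 * S else 2 * R))"
    using R S by (subst measure_completion, simp, subst content_cbox_cart)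
      (auto simp: interval_ne_empty_cart intro!: prod.cong)
  also have "\<dots> = 2 * S * (2 * R) ^ (CARD('n) - 1)"
    by (subst prod.remove[of _ k]) (auto simp: card_Diff_singleton)
  finally show ?thesis .
qed

end

text \<open>This is the vanishing mean on \<open>L\<^sup>1 \<inter> Y\<close> behind the functional
  \<open>Lam\<close>. Integration by parts moves the derivative onto the cutoff; as
  \<open>\<phi>\<close> is merely in \<open>L\<^sup>p\<close>, the volume of the support enters
  through \<open>le_add_powr\<close> and the two radii have to be balanced.\<close>

lemma integral_D12_partial_eq_0:
  fixes \<phi> :: "real ^ 'n \<Rightarrow> complex"
  assumes D: "D12_grad \<phi> G" and d: "CARD('n) \<ge> 3" and int: "integrable lebesgue (\<lambda>x. G x $ k)"
  shows "(\<integral>x. G x $ k \<partial>lebesgue) = 0"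
proof -
  let ?d = "CARD('n)" let ?p = "crit_exp CARD('n)"
  have p: "?p > 2" using crit_exp_gt_2[OF d] .
  define R where "R n = real (Suc n)" for n
  \<comment> \<open>With \<open>\<tau> = R powr (- d)\<close> the two error terms have order
    \<open>R powr (d - 1) * \<tau> = 1 / R\<close> and
    \<open>\<tau> powr (1 - p) / S = R powr (- d)\<close>; the exponent \<open>d * p\<close> is
    chosen for the latter.\<close>
  define S where "S n = R n powr (?d * ?p)" for n
  have R1: "R n \<ge> 1" for n by (simp add: R_def)
  have "?d * ?p \<ge> 1" using p d mult_mono[of 1 "real ?d" 1 ?p] by simp
  then have RS: "S n \<ge> R n" for n
    unfolding S_def using powr_mono[of 1 "?d * ?p" "R n"] R1[of n] by simp
  define Q where "Q n x = 1 - ((x $ k)\<^sup>2 / (S n)\<^sup>2 + (x \<bullet> x - (x $ k)\<^sup>2) / (R n)\<^sup>2)" for n and x :: "real ^ 'n"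
  define \<eta> where "\<eta> n x = (max 0 (Q n x))\<^sup>2" for n x
  define \<eta>' where "\<eta>' n x h = 2 * max 0 (Q n x) * - (2 * (x $ k) * (h $ k) / (S n)\<^sup>2 + (2 * (x \<bullet> h) - 2 * (x $ k) * (h $ k)) / (R n)\<^sup>2)" for n x h
  have Qeq: "Q n = (\<lambda>x. 1 - ((x $ k)\<^sup>2 / (S n)\<^sup>2 + (x \<bullet> x - (x $ k)\<^sup>2) / (R n)\<^sup>2))" for n
    by (simp add: Q_def fun_eq_iff)
  have der: "(\<eta> n has_derivative \<eta>' n x) (at x)" for n x
    using cutoff_has_derivative[OF R1[of n] RS[of n], where k = k and x = x] unfolding \<eta>_def \<eta>'_def Qeq .
  have partial: "\<eta>' n x (axis k 1) = - 4 * max 0 (Q n x) * (x $ k) / (S n)\<^sup>2" for n x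
    using cutoff_partial[OF R1[of n] RS[of n], where k = k and x = x] unfolding \<eta>'_def Qeq .
  have Q1: "Q n x \<le> 1" for n x
    using Q_le_1[OF R1[of n] RS[of n], where k = k and x = x] unfolding Qeq .
  have zero: "max 0 (Q n x) = 0" if "norm x \<ge> S n" for n x
    using cutoff_0[OF R1[of n] RS[of n], where k = k and x = x] that unfolding Qeq by blast
  define K where "K n = (cbox (\<chi> i. if i = k then - S n else - R n) (\<chi> i. if i = k then S n else R n) :: (real ^ 'n) set)" for n
  have bound: "\<bar>\<eta>' n x (axis k 1)\<bar> \<le> 4 / S n * indicat_real (K n) x" for n x
    using cutoff_partial_le[OF R1[of n] RS[of n], where k = k and x = x] unfolding \<eta>'_def Qeq K_def .
  have meas: "measure lebesgue (K n) = 2 * S n * (2 * R n) ^ (?d - 1)" for n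
    using cutoff_box_measure[OF R1[of n] RS[of n], where k = k] unfolding K_def .
  have Qc: "continuous_on UNIV (Q n)" for n
    unfolding Qeq using R1[of n] RS[of n] by (intro continuous_intros) auto
  have cont: "continuous_on UNIV (\<lambda>x. \<eta>' n x (axis k 1))" for n
    unfolding partial using R1[of n] RS[of n] by (intro continuous_intros Qc) auto
  have s: "\<eta> n x = 0" "\<eta>' n x (axis k 1) = 0" if "norm x \<ge> S n" for n x
    unfolding partial \<eta>_def using zero[OF that] by simp_all
  have parts: "(\<integral>x. \<eta> n x *\<^sub>R (G x $ k) \<partial>lebesgue) = - (\<integral>x. \<eta>' n x (axis k 1) *\<^sub>R \<phi> x \<partial>lebesgue)"
    "integrable lebesgue (\<lambda>x. \<eta> n x *\<^sub>R (G x $ k))"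
    "integrable lebesgue (\<lambda>x. \<eta>' n x (axis k 1) *\<^sub>R \<phi> x)" for n
    using D12_grad_by_parts[OF D d der cont s] by blast+
  have \<phi>: "\<phi> \<in> borel_measurable lebesgue" "integrable lebesgue (\<lambda>x. norm (\<phi> x) powr ?p)"
    using D by (auto simp: D12_grad_def in_Lp_def)
  define I where "I = (\<integral>x. norm (\<phi> x) powr ?p \<partial>lebesgue)"
  have "(\<lambda>n. \<integral>x. \<eta> n x *\<^sub>R (G x $ k) \<partial>lebesgue) \<longlonglongrightarrow> 0"
  proof (rule Lim_null_comparison)
    have "norm (\<integral>x. \<eta> n x *\<^sub>R (G x $ k) \<partial>lebesgue) \<le> (2 ^ (?d + 2) + 4 * I) / R n" for n
    proof -
      define \<tau> where "\<tau> = R n powr (- real ?d)"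
      have \<tau>: "\<tau> > 0" using R1[of n] by (simp add: \<tau>_def)
      have Sp: "S n > 0" using R1[of n] RS[of n] by linarith
      have fm: "integrable lebesgue (indicat_real (K n))"
        unfolding K_def by (intro integrable_real_indicator) (simp_all add: emeasure_lborel_cbox_finite[unfolded infinity_ennreal_def])
      have "norm (\<integral>x. \<eta> n x *\<^sub>R (G x $ k) \<partial>lebesgue) \<le> (\<integral>x. norm (\<eta>' n x (axis k 1) *\<^sub>R \<phi> x) \<partial>lebesgue)"
        unfolding parts(1) norm_minus_cancel by (rule integral_norm_bound)
      also have "\<dots> \<le> (\<integral>x. 4 / S n * (\<tau> * indicat_real (K n) x + \<tau> powr (1 - ?p) * norm (\<phi> x) powr ?p) \<partial>lebesgue)"
      proof (rule integral_mono)
        show "integrable lebesgue (\<lambda>x. norm (\<eta>' n x (axis k 1) *\<^sub>R \<phi> x))"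
          using parts(3) by (rule integrable_norm)
        show "integrable lebesgue (\<lambda>x. 4 / S n * (\<tau> * indicat_real (K n) x + \<tau> powr (1 - ?p) * norm (\<phi> x) powr ?p))"
          using \<phi>(2) fm by (intro integrable_mult_right Bochner_Integration.integrable_add) auto
        fix x
        have t: "norm (\<phi> x) \<le> \<tau> + \<tau> powr (1 - ?p) * norm (\<phi> x) powr ?p"
          using p \<tau> by (intro le_add_powr) auto
        have "norm (\<eta>' n x (axis k 1) *\<^sub>R \<phi> x) \<le> (4 / S n * indicat_real (K n) x) * norm (\<phi> x)"
          using mult_right_mono[OF bound[of n x] norm_ge_zero[of "\<phi> x"]] by simp
        also have "\<dots> \<le> 4 / S n * (\<tau> * indicat_real (K n) x + \<tau> powr (1 - ?p) * norm (\<phi> x) powr ?p)"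
          using t Sp by (cases "x \<in> K n") (auto intro!: divide_right_mono)
        finally show "norm (\<eta>' n x (axis k 1) *\<^sub>R \<phi> x) \<le> 4 / S n * (\<tau> * indicat_real (K n) x + \<tau> powr (1 - ?p) * norm (\<phi> x) powr ?p)" .
      qed
      also have "\<dots> = 4 / S n * (\<tau> * measure lebesgue (K n) + \<tau> powr (1 - ?p) * I)"
        using \<phi>(2) fm unfolding I_def by (subst integral_mult_right_zero, subst Bochner_Integration.integral_add) (auto simp: K_def)
      also have "\<dots> = 8 * (2 * R n) ^ (?d - 1) * \<tau> + 4 * (\<tau> powr (1 - ?p) / S n) * I"
        unfolding meas using Sp by (simp add: field_simps)
      also have "\<tau> powr (1 - ?p) / S n = 1 / R n powr ?d"
      proof -
        have "\<tau> powr (1 - ?p) / S n = R n powr (- real ?d * (1 - ?p) - real ?d * ?p)"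
          unfolding \<tau>_def S_def powr_powr by (simp only: powr_diff[symmetric])
        also have "- real ?d * (1 - ?p) - real ?d * ?p = - real ?d"
          by (simp add: algebra_simps)
        finally show ?thesis by (simp add: powr_minus_divide)
      qed
      also have "8 * (2 * R n) ^ (?d - 1) * \<tau> = 2 ^ (?d + 2) / R n"
      proof -
        obtain m where m: "?d = Suc m" using d by (cases "?d") auto
        show ?thesis
          unfolding \<tau>_def m using R1[of n] by (simp add: powr_minus_divide powr_realpow power_mult_distrib field_simps del: of_nat_Suc)
      qed
      also have "4 * (1 / R n powr ?d) * I \<le> 4 * I / R n"
      proof -
        have "R n \<le> R n powr ?d" using powr_mono[of 1 "real ?d" "R n"] d R1[of n] by simp
        moreover have "I \<ge> 0" unfolding I_def by (intro integral_nonneg_AE) auto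
        ultimately show ?thesis using R1[of n] by (simp add: divide_left_mono)
      qed
      finally show ?thesis by (simp add: add_divide_distrib)
    qed
    then show "\<forall>\<^sub>F n in sequentially. norm (\<integral>x. \<eta> n x *\<^sub>R (G x $ k) \<partial>lebesgue) \<le> (2 ^ (?d + 2) + 4 * I) / R n"
      by simp
    show "(\<lambda>n. (2 ^ (?d + 2) + 4 * I) / R n) \<longlonglongrightarrow> 0"
      unfolding R_def using LIMSEQ_inverse_real_of_nat[THEN tendsto_mult_right_zero, of "2 ^ (?d + 2) + 4 * I"]
      by (simp add: divide_inverse)
  qed
  moreover have "(\<lambda>n. \<integral>x. \<eta> n x *\<^sub>R (G x $ k) \<partial>lebesgue) \<longlonglongrightarrow> (\<integral>x. G x $ k \<partial>lebesgue)"
  proof (rule integral_dominated_convergence[where w = "\<lambda>x. norm (G x $ k)"])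
    show "(\<lambda>x. G x $ k) \<in> borel_measurable lebesgue" "integrable lebesgue (\<lambda>x. norm (G x $ k))"
      using int by auto
    show "(\<lambda>x. \<eta> n x *\<^sub>R (G x $ k)) \<in> borel_measurable lebesgue" for n
      using parts(2) by auto
    have \<eta>1: "\<eta> n x \<le> 1" "\<eta> n x \<ge> 0" for n x
      unfolding \<eta>_def using Q1[of n x] by (auto simp: power_le_one)
    show "AE x in lebesgue. norm (\<eta> n x *\<^sub>R (G x $ k)) \<le> norm (G x $ k)" for n
      using \<eta>1 by (intro AE_I2) (simp add: mult_left_le_one_le)
    have lim: "(\<lambda>n. \<eta> n x) \<longlonglongrightarrow> 1" for x
    proof -
      have "(\<lambda>n. inverse (R n)) \<longlonglongrightarrow> 0"
        unfolding R_def by (rule LIMSEQ_inverse_real_of_nat)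
      moreover have "(\<lambda>n. inverse (S n)) \<longlonglongrightarrow> 0"
      proof (rule Lim_null_comparison[OF always_eventually calculation], rule allI)
        show "norm (inverse (S n)) \<le> inverse (R n)" for n
          using R1[of n] RS[of n] by (simp add: le_imp_inverse_le)
      qed
      ultimately have "(\<lambda>n. (max 0 (1 - ((x $ k)\<^sup>2 * (inverse (S n))\<^sup>2 + (x \<bullet> x - (x $ k)\<^sup>2) * (inverse (R n))\<^sup>2)))\<^sup>2)
          \<longlonglongrightarrow> (max 0 (1 - ((x $ k)\<^sup>2 * 0\<^sup>2 + (x \<bullet> x - (x $ k)\<^sup>2) * 0\<^sup>2)))\<^sup>2"
        by (intro tendsto_intros)
      then show ?thesis
        unfolding \<eta>_def Q_def by (simp add: divide_inverse power_inverse)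
    qed
    show "AE x in lebesgue. (\<lambda>n. \<eta> n x *\<^sub>R (G x $ k)) \<longlonglongrightarrow> G x $ k"
    proof (rule AE_I2)
      show "(\<lambda>n. \<eta> n x *\<^sub>R (G x $ k)) \<longlonglongrightarrow> G x $ k" for x
        using tendsto_scaleR[OF lim tendsto_const, of x "G x $ k"] by simp
    qed
  qed
  ultimately show ?thesis
    using LIMSEQ_unique by blast
qed

section \<open>Uniqueness of the gradient and of the momentum functional\<close>

lemma D12_grad_grad: "u \<in> D12 \<Longrightarrow> D12_grad u (grad u)"
  unfolding D12_def grad_def by (auto intro: someI[of "D12_grad u"])

lemma D12_grad_diff:
  fixes u v :: "real ^ 'n \<Rightarrow> complex"
  assumes D: "D12_grad u G" "D12_grad v H" and d: "CARD('n) \<ge> 3"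
  shows "D12_grad (\<lambda>x. u x - v x) (\<lambda>x. G x - H x)"
proof -
  let ?p = "crit_exp CARD('n)"
  have p: "?p \<ge> 0" using crit_exp_gt_2[OF d] by simp
  obtain \<psi> where "D12_approx u G \<psi>"
    by (rule D12_grad_approx[OF D(1) d])
  note \<psi> = D12_approxD[OF this]
  obtain \<xi> where "D12_approx v H \<xi>"
    by (rule D12_grad_approx[OF D(2) d])
  note \<xi> = D12_approxD[OF this]
  \<comment> \<open>One statement for two uses: the critical exponent for the functions and
    \<open>q = 2\<close> for the gradients.\<close>
  have lim: "(\<lambda>j. \<integral>x. norm ((f j x - g j x) - (f0 x - g0 x)) powr q \<partial>lebesgue) \<longlonglongrightarrow> 0"
    if q: "q \<ge> 0" and f: "\<And>j. in_Lp q (\<lambda>x. f j x - f0 x)" and g: "\<And>j. in_Lp q (\<lambda>x. g j x - g0 x)"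
      and l: "(\<lambda>j. \<integral>x. norm (f j x - f0 x) powr q \<partial>lebesgue) \<longlonglongrightarrow> 0"
        "(\<lambda>j. \<integral>x. norm (g j x - g0 x) powr q \<partial>lebesgue) \<longlonglongrightarrow> 0"
    for f g :: "nat \<Rightarrow> real ^ 'n \<Rightarrow> 'c::euclidean_space" and f0 g0 q
  proof (rule Lim_null_comparison)
    let ?c = "\<lambda>j. 2 powr q * ((\<integral>x. norm (f j x - f0 x) powr q \<partial>lebesgue) + (\<integral>x. norm (g j x - g0 x) powr q \<partial>lebesgue))"
    have "?c \<longlonglongrightarrow> 2 powr q * (0 + 0)"
      by (intro tendsto_intros l)
    then show "?c \<longlonglongrightarrow> 0" by simp
    have "(\<integral>x. norm ((f j x - g j x) - (f0 x - g0 x)) powr q \<partial>lebesgue) \<le> ?c j" for j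
    proof -
      have i: "integrable lebesgue (\<lambda>x. norm (f j x - f0 x) powr q)" "integrable lebesgue (\<lambda>x. norm (g j x - g0 x) powr q)"
        using f g by (auto simp: in_Lp_def)
      have "(\<integral>x. norm ((f j x - g j x) - (f0 x - g0 x)) powr q \<partial>lebesgue)
        \<le> (\<integral>x. 2 powr q * (norm (f j x - f0 x) powr q + norm (g j x - g0 x) powr q) \<partial>lebesgue)"
      proof (rule integral_mono)
        show "integrable lebesgue (\<lambda>x. norm ((f j x - g j x) - (f0 x - g0 x)) powr q)"
          using in_Lp_diff[OF f g q, of j j] by (simp add: in_Lp_def algebra_simps)
        show "integrable lebesgue (\<lambda>x. 2 powr q * (norm (f j x - f0 x) powr q + norm (g j x - g0 x) powr q))"
          using i by auto
        fix x
        have "norm ((f j x - g j x) - (f0 x - g0 x)) \<le> norm (f j x - f0 x) + norm (g j x - g0 x)"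
          using norm_triangle_ineq4[of "f j x - f0 x" "g j x - g0 x"] by (simp add: algebra_simps)
        then have "norm ((f j x - g j x) - (f0 x - g0 x)) powr q \<le> (norm (f j x - f0 x) + norm (g j x - g0 x)) powr q"
          using q by (intro powr_mono2) auto
        also have "\<dots> \<le> 2 powr q * (norm (f j x - f0 x) powr q + norm (g j x - g0 x) powr q)"
          using q by (intro powr_add_le) auto
        finally show "norm ((f j x - g j x) - (f0 x - g0 x)) powr q \<le> 2 powr q * (norm (f j x - f0 x) powr q + norm (g j x - g0 x) powr q)" .
      qed
      also have "\<dots> = ?c j" using i by simp
      finally show ?thesis .
    qed
    then show "\<forall>\<^sub>F j in sequentially. norm (\<integral>x. norm ((f j x - g j x) - (f0 x - g0 x)) powr q \<partial>lebesgue) \<le> ?c j"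
      by (auto intro!: always_eventually simp: integral_nonneg_AE)
  qed
  have "in_Lp ?p (\<lambda>x. u x - v x)" "in_Lp 2 (\<lambda>x. G x - H x)"
    using D p by (auto simp: D12_grad_def intro!: in_Lp_diff)
  moreover have "\<exists>\<psi>. (\<forall>j::nat. test_fun (\<psi> j)) \<and>
        (\<lambda>j. \<integral>x. norm (\<psi> j x - (u x - v x)) powr ?p \<partial>lebesgue) \<longlonglongrightarrow> 0 \<and>
        (\<lambda>j. \<integral>x. (norm (classical_grad (\<psi> j) x - (G x - H x)))\<^sup>2 \<partial>lebesgue) \<longlonglongrightarrow> 0"
  proof (intro exI[of _ "\<lambda>j x. \<psi> j x - \<xi> j x"] conjI allI)
    show "test_fun (\<lambda>x. \<psi> j x - \<xi> j x)" for j
      by (intro test_fun_diff \<psi> \<xi>)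
    show "(\<lambda>j. \<integral>x. norm ((\<psi> j x - \<xi> j x) - (u x - v x)) powr ?p \<partial>lebesgue) \<longlonglongrightarrow> 0"
      by (rule lim[OF p \<psi>(4) \<xi>(4) \<psi>(2) \<xi>(2)])
    show "(\<lambda>j. \<integral>x. (norm (classical_grad (\<lambda>x. \<psi> j x - \<xi> j x) x - (G x - H x)))\<^sup>2 \<partial>lebesgue) \<longlonglongrightarrow> 0"
      using lim[OF _ \<psi>(5) \<xi>(5)] \<psi>(3) \<xi>(3) by (simp add: test_fun_diff(2)[OF \<psi>(1) \<xi>(1)])
  qed
  ultimately show ?thesis
    by (simp add: D12_grad_def)
qed

text \<open>Closability of the gradient. Integration by parts against the partial derivatives of the
  approximants, for the function zero, makes \<open>H\<close> orthogonal to every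
  \<open>classical_grad (\<psi> j)\<close>. By Pythagoras the norm of \<open>H\<close> is at most
  its distance to these gradients, which tends to zero.\<close>

lemma D12_grad_0:
  fixes H :: "real ^ 'n \<Rightarrow> complex ^ 'n"
  assumes D: "D12_grad (\<lambda>x. 0) H" and d: "CARD('n) \<ge> 3"
  shows "AE x in lebesgue. H x = 0"
proof -
  obtain \<psi> where "D12_approx (\<lambda>x. 0) H \<psi>"
    by (rule D12_grad_approx[OF D d])
  note \<psi> = D12_approxD[OF this]
  \<comment> \<open>The weight in \<open>D12_grad_by_parts\<close> is real, so each partial
    derivative is tested through its real and imaginary parts separately; the inner product is
    reassembled from them.\<close>
  have orth_L: "(\<integral>x. L (classical_grad (\<psi> j) x $ i) *\<^sub>R (H x $ i) \<partial>lebesgue) = 0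
      \<and> integrable lebesgue (\<lambda>x. L (classical_grad (\<psi> j) x $ i) *\<^sub>R (H x $ i))"
    if L: "bounded_linear L" for L :: "complex \<Rightarrow> real" and i j
  proof -
    define f where "f x = classical_grad (\<psi> j) x $ i" for x
    have f: "test_fun f" unfolding f_def by (intro test_fun_partial \<psi>)
    obtain B where B: "\<And>x. norm x \<ge> B \<Longrightarrow> f x = 0" "\<And>x. norm x \<ge> B \<Longrightarrow> classical_grad f x = 0"
      using classical_grad_supp[OF f] by metis
    have der: "((\<lambda>x. L (f x)) has_derivative (\<lambda>h. L (frechet_derivative f (at x) h))) (at x)" for x
      by (intro bounded_linear.has_derivative[OF L] test_fun_has_derivative f)
    have "continuous_on UNIV (\<lambda>x. classical_grad f x $ i)"
      by (intro continuous_intros test_fun_grad_continuous f)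
    then have cont: "continuous_on UNIV (\<lambda>x. L (frechet_derivative f (at x) (axis i 1)))"
      using bounded_linear.continuous_on[OF L] by (simp add: classical_grad_nth)
    have s: "L (f x) = 0" "L (frechet_derivative f (at x) (axis i 1)) = 0" if "norm x \<ge> B" for x
      using B[OF that] linear_0[OF bounded_linear.linear[OF L]] by (simp_all flip: classical_grad_nth)
    show ?thesis
      using D12_grad_by_parts(1,2)[OF D d der cont s] by (simp add: f_def)
  qed
  have orth: "(\<integral>x. classical_grad (\<psi> j) x \<bullet> H x \<partial>lebesgue) = 0 \<and> integrable lebesgue (\<lambda>x. classical_grad (\<psi> j) x \<bullet> H x)" for j
  proof -
    have "(\<integral>x. (classical_grad (\<psi> j) x $ i) \<bullet> (H x $ i) \<partial>lebesgue) = 0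
       \<and> integrable lebesgue (\<lambda>x. (classical_grad (\<psi> j) x $ i) \<bullet> (H x $ i))" for i
    proof -
      have eq: "z \<bullet> w = Re (Re z *\<^sub>R w) + Im (Im z *\<^sub>R w)" for z w :: complex
        by (simp add: inner_complex_def)
      show ?thesis
        unfolding eq
        using orth_L[OF bounded_linear_Re, of j i] orth_L[OF bounded_linear_Im, of j i]
        by (auto simp del: scaleR_complex.sel)
    qed
    then show ?thesis
      by (simp add: inner_vec_def)
  qed
  have int: "integrable lebesgue (\<lambda>x. (norm (classical_grad (\<psi> j) x - H x))\<^sup>2)" "integrable lebesgue (\<lambda>x. (norm (H x))\<^sup>2)" for j
    using \<psi>(5) D by (auto simp: in_Lp_2_iff D12_grad_def)
  have "(\<integral>x. (norm (H x))\<^sup>2 \<partial>lebesgue) \<le> (\<integral>x. (norm (classical_grad (\<psi> j) x - H x))\<^sup>2 \<partial>lebesgue)" for j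
  proof -
    have "(\<integral>x. (norm (H x))\<^sup>2 \<partial>lebesgue) = (\<integral>x. (norm (H x))\<^sup>2 - 2 * (classical_grad (\<psi> j) x \<bullet> H x) \<partial>lebesgue)"
      using orth[of j] int by simp
    also have "\<dots> \<le> (\<integral>x. (norm (classical_grad (\<psi> j) x - H x))\<^sup>2 \<partial>lebesgue)"
    proof (rule integral_mono)
      show "(norm (H x))\<^sup>2 - 2 * (classical_grad (\<psi> j) x \<bullet> H x) \<le> (norm (classical_grad (\<psi> j) x - H x))\<^sup>2" for x
        by (simp add: power2_norm_eq_inner inner_diff_left inner_diff_right inner_commute)
    qed (use orth[of j] int in simp_all)
    finally show ?thesis .
  qed
  then have "(\<integral>x. (norm (H x))\<^sup>2 \<partial>lebesgue) \<le> 0"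
    using \<psi>(3) by (intro LIMSEQ_le_const) auto
  then have "(\<integral>x. (norm (H x))\<^sup>2 \<partial>lebesgue) = 0"
    by (intro antisym) (auto intro!: integral_nonneg_AE)
  then have "AE x in lebesgue. (norm (H x))\<^sup>2 = 0"
    using int(2) by (subst (asm) integral_nonneg_eq_0_iff_AE) auto
  then show ?thesis by simp
qed

lemma D12_grad_unique:
  fixes u :: "real ^ 'n \<Rightarrow> complex"
  assumes "D12_grad u G" "D12_grad u G'" and d: "CARD('n) \<ge> 3"
  shows "AE x in lebesgue. G x = G' x"
  using D12_grad_0[OF _ d] D12_grad_diff[OF assms] by fastforce

text \<open>The integrable parts of two decompositions differ by a function that is also a partial
  derivative of an element of \<open>D12\<close>, hence has mean zero. This makes the description
  operator in \<open>Lam\<close> denote a value.\<close>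

lemma Lam_eq:
  fixes f v w :: "real ^ 'n \<Rightarrow> real"
  assumes d: "CARD('n) \<ge> 3"
    and v: "integrable lebesgue v" and w: "w \<in> Y_space k" and f: "AE x in lebesgue. f x = v x + w x"
  shows "Lam k f = (\<integral>x. v x \<partial>lebesgue)"
  unfolding Lam_def
proof (rule the_equality)
  show "\<exists>v' w'. integrable lebesgue v' \<and> w' \<in> Y_space k \<and> (AE x in lebesgue. f x = v' x + w' x)
      \<and> (\<integral>x. v x \<partial>lebesgue) = (\<integral>x. v' x \<partial>lebesgue)"
    using v w f by blast
next
  fix l
  assume "\<exists>v' w'. integrable lebesgue v' \<and> w' \<in> Y_space k \<and> (AE x in lebesgue. f x = v' x + w' x)
      \<and> l = (\<integral>x. v' x \<partial>lebesgue)"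
  then obtain v' w' where v': "integrable lebesgue v'" and w': "w' \<in> Y_space k"
    and f': "AE x in lebesgue. f x = v' x + w' x" and l: "l = (\<integral>x. v' x \<partial>lebesgue)" by blast
  obtain a where a: "a \<in> D12" "AE x in lebesgue. complex_of_real (w x) = grad a x $ k"
    using w by (auto simp: Y_space_def)
  obtain b where b: "b \<in> D12" "AE x in lebesgue. complex_of_real (w' x) = grad b x $ k"
    using w' by (auto simp: Y_space_def)
  have D: "D12_grad (\<lambda>x. a x - b x) (\<lambda>x. grad a x - grad b x)"
    by (intro D12_grad_diff D12_grad_grad a b d)
  have ae: "AE x in lebesgue. complex_of_real (v' x - v x) = (grad a x - grad b x) $ k"
    using a(2) b(2) f f'
  proof eventually_elim
    case (elim x)
    then have "v' x - v x = w x - w' x" by linarith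
    show ?case unfolding \<open>v' x - v x = w x - w' x\<close> using elim by simp
  qed
  have "(\<lambda>x. (grad a x - grad b x) $ k) \<in> borel_measurable lebesgue"
    using D measurable_compose[OF _ vec_nth_measurable, of "\<lambda>x. grad a x - grad b x" lebesgue k]
    by (auto simp: D12_grad_def in_Lp_def)
  moreover have m: "(\<lambda>x. complex_of_real (v' x - v x)) \<in> borel_measurable lebesgue"
    using v v' by measurable
  moreover have i: "integrable lebesgue (\<lambda>x. complex_of_real (v' x - v x))"
    using v v' by simp
  ultimately have "integrable lebesgue (\<lambda>x. (grad a x - grad b x) $ k)"
    using ae integrable_cong_AE by blast
  then have "(\<integral>x. (grad a x - grad b x) $ k \<partial>lebesgue) = 0"
    by (rule integral_D12_partial_eq_0[OF D d])
  then have "(\<integral>x. complex_of_real (v' x - v x) \<partial>lebesgue) = 0"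
    using integral_cong_AE[OF m _ ae] \<open>(\<lambda>x. (grad a x - grad b x) $ k) \<in> _\<close> by simp
  then show "l = (\<integral>x. v x \<partial>lebesgue)"
    using v v' l by (simp flip: of_real_diff)
qed

section \<open>The total derivative in the momentum density\<close>

text \<open>Modulo a total derivative, \<open>\<langle>\<i>\<partial>u, u\<rangle>\<close> is \<open>- \<rho> \<partial>(Im u)\<close> with \<open>\<rho> = |1 + u|\<^sup>2 - 1 = 2 Re u + |u|\<^sup>2\<close>,
  up to terms of fourth order when \<open>Re u\<close> counts as second order. The total derivative is that of
  \<open>Re u Im u + (Im u)\<^sup>3 / 3\<close>; the denominator makes this function globally Lipschitz and alters it only
  at order seven.\<close>

definition primH :: "complex \<Rightarrow> real" where
  "primH z = (Re z * Im z + Im z ^ 3 / 3) / (1 + ((Re z)\<^sup>2 + (Im z)\<^sup>2)\<^sup>2)"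

text \<open>The partial derivative of \<open>primH\<close> in the real part, kept as the two terms
  of the quotient rule: the first carries the leading order, the second is a remainder.
  \<open>primH2\<close> is its counterpart for the imaginary part.\<close>

definition primH1 :: "complex \<Rightarrow> real" where
  "primH1 z = Im z / (1 + ((Re z)\<^sup>2 + (Im z)\<^sup>2)\<^sup>2)
    - (Re z * Im z + Im z ^ 3 / 3) * (4 * Re z * ((Re z)\<^sup>2 + (Im z)\<^sup>2)) / (1 + ((Re z)\<^sup>2 + (Im z)\<^sup>2)\<^sup>2)\<^sup>2"

definition primH2 :: "complex \<Rightarrow> real" where
  "primH2 z = (Re z + (Im z)\<^sup>2) / (1 + ((Re z)\<^sup>2 + (Im z)\<^sup>2)\<^sup>2)
    - (Re z * Im z + Im z ^ 3 / 3) * (4 * Im z * ((Re z)\<^sup>2 + (Im z)\<^sup>2)) / (1 + ((Re z)\<^sup>2 + (Im z)\<^sup>2)\<^sup>2)\<^sup>2"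

lemma primH_denom: "1 + ((Re z)\<^sup>2 + (Im z)\<^sup>2)\<^sup>2 = 1 + cmod z ^ 4" "1 + ((Re z)\<^sup>2 + (Im z)\<^sup>2)\<^sup>2 > 0"
proof -
  show "1 + ((Re z)\<^sup>2 + (Im z)\<^sup>2)\<^sup>2 = 1 + cmod z ^ 4"
    by (simp add: cmod_power2[symmetric] flip: power_mult)
  show "1 + ((Re z)\<^sup>2 + (Im z)\<^sup>2)\<^sup>2 > 0"
    by (rule add_pos_nonneg) auto
qed

lemma primH_has_derivative:
  "(primH has_derivative (\<lambda>h. primH1 z * Re h + primH2 z * Im h)) (at z)"
proof -
  let ?N = "\<lambda>z. 1 + ((Re z)\<^sup>2 + (Im z)\<^sup>2)\<^sup>2" and ?P = "\<lambda>z. Re z * Im z + Im z ^ 3 / 3"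
  have N: "?N z \<noteq> 0" using primH_denom(2)[of z] by simp
  have R: "(Re has_derivative Re) (at z)" and I: "(Im has_derivative Im) (at z)"
    by (simp_all add: bounded_linear_imp_has_derivative bounded_linear_Re bounded_linear_Im)
  have dP: "(?P has_derivative (\<lambda>h. Im z * Re h + (Re z + (Im z)\<^sup>2) * Im h)) (at z)"
  proof -
    have "((\<lambda>z. Re z * Im z + (1 / 3) * Im z ^ 3) has_derivative
        (\<lambda>h. (Re z * Im h + Re h * Im z) + (1 / 3) * (of_nat 3 * Im h * Im z ^ (3 - 1)))) (at z)"
      by (intro has_derivative_add has_derivative_mult has_derivative_mult_right has_derivative_power R I)
    then show ?thesis
      by (simp add: algebra_simps)
  qed
  have dN: "(?N has_derivative (\<lambda>h. 4 * ((Re z)\<^sup>2 + (Im z)\<^sup>2) * (Re z * Re h + Im z * Im h))) (at z)"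
  proof -
    have "(?N has_derivative (\<lambda>h. 0 + of_nat 2 * (of_nat 2 * Re h * Re z ^ (2 - 1) + of_nat 2 * Im h * Im z ^ (2 - 1))
        * ((Re z)\<^sup>2 + (Im z)\<^sup>2) ^ (2 - 1))) (at z)"
      by (intro has_derivative_add has_derivative_const has_derivative_power R I)
    then show ?thesis
      by (simp add: algebra_simps)
  qed
  have "((\<lambda>z. ?P z / ?N z) has_derivative
      (\<lambda>h. ((Im z * Re h + (Re z + (Im z)\<^sup>2) * Im h) * ?N z - ?P z * (4 * ((Re z)\<^sup>2 + (Im z)\<^sup>2) * (Re z * Re h + Im z * Im h)))
        / (?N z * ?N z))) (at z)"
    by (rule has_derivative_divide'[OF dP dN N])
  moreover have "((Im z * Re h + (Re z + (Im z)\<^sup>2) * Im h) * ?N z - ?P z * (4 * ((Re z)\<^sup>2 + (Im z)\<^sup>2) * (Re z * Re h + Im z * Im h)))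
        / (?N z * ?N z) = primH1 z * Re h + primH2 z * Im h" for h
  proof -
    have "(B * x + A * y) * n / (n * n) - p * (4 * r * (a * x + b * y)) / (n * n)
        = (B / n - p * (4 * a * r) / n\<^sup>2) * x + (A / n - p * (4 * b * r) / n\<^sup>2) * y"
      if "n \<noteq> 0" for B A x y n p r a b :: real
      using that by (simp add: field_simps power2_eq_square)
    from this[OF N] show ?thesis
      unfolding primH1_def primH2_def diff_divide_distrib by metis
  qed
  ultimately show ?thesis
    by (simp add: primH_def[abs_def])
qed

lemma continuous_primH: "continuous_on UNIV primH" "continuous_on UNIV primH1" "continuous_on UNIV primH2"
proof -
  have nz: "1 + ((Re z)\<^sup>2 + (Im z)\<^sup>2)\<^sup>2 \<noteq> 0" for z
    using primH_denom(2)[of z] by simp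
  show "continuous_on UNIV primH" "continuous_on UNIV primH1" "continuous_on UNIV primH2"
    unfolding primH_def[abs_def] primH1_def[abs_def] primH2_def[abs_def]
    by (auto intro!: continuous_intros simp: nz)
qed

text \<open>The powers 4, 5 and 6 are at most \<open>1 + n ^ 8\<close>, by comparing
  \<open>n\<close> with 1. The first form yields uniform bounds for the remainders of
  \<open>primH1\<close> and \<open>primH2\<close>, the second yields bounds linear in
  \<open>|z|\<close>.\<close>

lemma pow56_le:
  fixes n :: real
  assumes "n \<ge> 0"
  shows "n ^ 5 + n ^ 6 \<le> 2 * (1 + n ^ 4)\<^sup>2" "n ^ 5 + n ^ 6 \<le> 2 * n * (1 + n ^ 4)\<^sup>2"
proof -
  have e: "(1 + n ^ 4)\<^sup>2 = 1 + 2 * n ^ 4 + n ^ 8"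
    by (simp add: power2_eq_square algebra_simps flip: power_add)
  have "n ^ 4 \<le> 1 + n ^ 8 \<and> n ^ 5 \<le> 1 + n ^ 8 \<and> n ^ 6 \<le> 1 + n ^ 8"
  proof (cases "n \<le> 1")
    case True
    then have "n ^ 4 \<le> 1" "n ^ 5 \<le> 1" "n ^ 6 \<le> 1" "n ^ 8 \<ge> 0"
      using assms by (auto intro: power_le_one)
    then show ?thesis by linarith
  next
    case False
    then have "n ^ 4 \<le> n ^ 8" "n ^ 5 \<le> n ^ 8" "n ^ 6 \<le> n ^ 8"
      by (auto intro: power_increasing)
    then show ?thesis by linarith
  qed
  moreover have "n ^ 4 \<ge> 0" using assms by simp
  ultimately have le: "n ^ 4 \<le> (1 + n ^ 4)\<^sup>2" "n ^ 5 \<le> (1 + n ^ 4)\<^sup>2" "n ^ 6 \<le> (1 + n ^ 4)\<^sup>2"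
    unfolding e by linarith+
  then show "n ^ 5 + n ^ 6 \<le> 2 * (1 + n ^ 4)\<^sup>2" by linarith
  have "n * n ^ 4 \<le> n * (1 + n ^ 4)\<^sup>2" "n * n ^ 5 \<le> n * (1 + n ^ 4)\<^sup>2"
    using le assms by (auto intro: mult_left_mono)
  moreover have "n * n ^ 4 = n ^ 5" "n * n ^ 5 = n ^ 6" by (simp_all flip: power_Suc)
  ultimately show "n ^ 5 + n ^ 6 \<le> 2 * n * (1 + n ^ 4)\<^sup>2" by linarith
qed

text \<open>Here \<open>c\<close> stands for \<open>Re z\<close> or \<open>Im z\<close>, which
  covers both quotient-rule remainders. With \<open>n = |z|\<close> the two factors of the numerator
  are at most \<open>n\<^sup>2 + n ^ 3\<close> and \<open>4 * n ^ 3\<close>, whence the degrees 5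
  and 6.\<close>

lemma primH_remainder_le:
  assumes "\<bar>c\<bar> \<le> cmod z"
  shows "\<bar>(Re z * Im z + Im z ^ 3 / 3) * (4 * c * ((Re z)\<^sup>2 + (Im z)\<^sup>2)) / (1 + ((Re z)\<^sup>2 + (Im z)\<^sup>2)\<^sup>2)\<^sup>2\<bar>
    \<le> 4 * (cmod z ^ 5 + cmod z ^ 6) / (1 + cmod z ^ 4)\<^sup>2"
proof -
  let ?n = "cmod z"
  have P: "\<bar>Re z * Im z + Im z ^ 3 / 3\<bar> \<le> ?n ^ 2 + ?n ^ 3"
  proof -
    have "\<bar>Re z * Im z\<bar> \<le> ?n * ?n"
      unfolding abs_mult by (intro mult_mono abs_Re_le_cmod abs_Im_le_cmod) auto
    moreover have "\<bar>Im z\<bar> ^ 3 \<le> ?n ^ 3"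
      by (intro power_mono abs_Im_le_cmod) auto
    moreover have "\<bar>Im z ^ 3 / 3\<bar> \<le> \<bar>Im z\<bar> ^ 3" by (simp add: power_abs)
    ultimately show ?thesis unfolding power2_eq_square by linarith
  qed
  have "\<bar>4 * c * ((Re z)\<^sup>2 + (Im z)\<^sup>2)\<bar> \<le> 4 * ?n * ?n\<^sup>2"
    using assms by (simp add: abs_mult cmod_power2 mult_right_mono)
  with P have "\<bar>(Re z * Im z + Im z ^ 3 / 3) * (4 * c * ((Re z)\<^sup>2 + (Im z)\<^sup>2))\<bar> \<le> (?n ^ 2 + ?n ^ 3) * (4 * ?n * ?n\<^sup>2)"
    unfolding abs_mult[of "Re z * Im z + Im z ^ 3 / 3"] by (intro mult_mono) auto
  also have "\<dots> = 4 * (?n ^ 5 + ?n ^ 6)"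
    by (simp add: algebra_simps eval_nat_numeral)
  finally show ?thesis
    unfolding primH_denom(1) abs_divide by (simp add: divide_right_mono)
qed

text \<open>The uniform bounds make \<open>primH\<close> Lipschitz, so that composition with it
  preserves \<open>D12\<close>; the linear ones serve where \<open>|u|\<close> is not small. Each
  constant is 1 or 2 for the leading term plus 8 for the remainder.\<close>

lemma primH_bounds:
  "\<bar>primH1 z\<bar> \<le> 9" "\<bar>primH2 z\<bar> \<le> 10" "\<bar>primH1 z\<bar> \<le> 9 * cmod z" "\<bar>primH2 z\<bar> \<le> 10 * cmod z"
proof -
  let ?n = "cmod z" and ?N = "1 + cmod z ^ 4"
  have n: "?n \<ge> 0" by simp
  have N: "?N \<ge> 1" by simp
  then have Np: "?N > 0" by linarith
  have r: "4 * (?n ^ 5 + ?n ^ 6) / ?N\<^sup>2 \<le> 8" "4 * (?n ^ 5 + ?n ^ 6) / ?N\<^sup>2 \<le> 8 * ?n"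
    using pow56_le[OF n] Np by (simp_all add: pos_divide_le_eq)
  note R1 = primH_remainder_le[OF abs_Re_le_cmod[of z]] and R2 = primH_remainder_le[OF abs_Im_le_cmod[of z]]
  have nN: "?n \<le> ?N \<and> ?n\<^sup>2 \<le> ?N"
  proof (cases "?n \<le> 1")
    case True
    then have "?n\<^sup>2 \<le> 1" by (simp add: power_le_one)
    then show ?thesis using True N by linarith
  next
    case False
    then have "?n ^ 1 \<le> ?n ^ 4" "?n\<^sup>2 \<le> ?n ^ 4" by (intro power_increasing; simp)+
    then show ?thesis by simp
  qed
  have b: "\<bar>Im z / ?N\<bar> \<le> ?n / ?N"
    using N abs_Im_le_cmod[of z] by (simp add: divide_right_mono)
  have ab: "\<bar>(Re z + (Im z)\<^sup>2) / ?N\<bar> \<le> (?n + ?n\<^sup>2) / ?N"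
  proof -
    have "(Im z)\<^sup>2 \<le> ?n\<^sup>2" by (simp add: cmod_power2)
    then have "\<bar>Re z + (Im z)\<^sup>2\<bar> \<le> ?n + ?n\<^sup>2" using abs_Re_le_cmod[of z] zero_le_power2[of "Im z"] by linarith
    then show ?thesis using N by (simp add: divide_right_mono)
  qed
  have s: "?n / ?N \<le> 1" "?n / ?N \<le> ?n" "(?n + ?n\<^sup>2) / ?N \<le> 2" "(?n + ?n\<^sup>2) / ?N \<le> 2 * ?n"
  proof -
    show 1: "?n / ?N \<le> 1" and 2: "?n / ?N \<le> ?n" and "(?n + ?n\<^sup>2) / ?N \<le> 2"
      using nN Np mult_left_mono[OF N n] by (simp_all add: pos_divide_le_eq)
    have "?n * (?n / ?N) \<le> ?n * 1" using 1 n by (rule mult_left_mono)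
    then show "(?n + ?n\<^sup>2) / ?N \<le> 2 * ?n"
      using 2 by (simp add: add_divide_distrib power2_eq_square)
  qed
  have "\<bar>primH1 z\<bar> \<le> ?n / ?N + 4 * (?n ^ 5 + ?n ^ 6) / ?N\<^sup>2"
    unfolding primH1_def primH_denom(1)
    by (rule order_trans[OF abs_triangle_ineq4 add_mono[OF b R1[unfolded primH_denom(1)]]])
  then show "\<bar>primH1 z\<bar> \<le> 9" "\<bar>primH1 z\<bar> \<le> 9 * ?n"
    using r s by linarith+
  have "\<bar>primH2 z\<bar> \<le> (?n + ?n\<^sup>2) / ?N + 4 * (?n ^ 5 + ?n ^ 6) / ?N\<^sup>2"
    unfolding primH2_def primH_denom(1)
    by (rule order_trans[OF abs_triangle_ineq4 add_mono[OF ab R2[unfolded primH_denom(1)]]])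
  then show "\<bar>primH2 z\<bar> \<le> 10" "\<bar>primH2 z\<bar> \<le> 10 * ?n"
    using r s by linarith+
qed

text \<open>Replacing the denominator by 1 costs a relative error \<open>|z| ^ 4\<close>, and the
  remainders have degree at least 5. In the second bound \<open>\<rho> - Re z\<close>, with
  \<open>\<rho> = |1 + z|\<^sup>2 - 1\<close>, exceeds the leading numerator
  \<open>Re z + (Im z)\<^sup>2\<close> by exactly \<open>(Re z)\<^sup>2\<close>.\<close>

lemma primH_bounds_small:
  assumes "cmod z \<le> 1"
  shows "\<bar>Im z - primH1 z\<bar> \<le> 9 * cmod z ^ 4"
    and "\<bar>((cmod (1 + z))\<^sup>2 - 1) - Re z - primH2 z\<bar> \<le> ((cmod (1 + z))\<^sup>2 - 1)\<^sup>2 + 11 * cmod z ^ 4"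
proof -
  let ?n = "cmod z" and ?N = "1 + cmod z ^ 4" and ?\<rho> = "(cmod (1 + z))\<^sup>2 - 1"
  have N: "?N \<ge> 1" by simp
  then have Np: "?N > 0" by linarith
  have pw: "?n ^ 5 \<le> ?n ^ 4" "?n ^ 6 \<le> ?n ^ 4" "?n\<^sup>2 \<le> ?n"
    using assms power_decreasing[of 1 2 ?n] by (auto intro: power_decreasing)
  have r: "4 * (?n ^ 5 + ?n ^ 6) / ?N\<^sup>2 \<le> 8 * ?n ^ 4"
  proof -
    have "4 * (?n ^ 5 + ?n ^ 6) / ?N\<^sup>2 \<le> 4 * (?n ^ 5 + ?n ^ 6) / 1"
      by (intro divide_left_mono mult_pos_pos zero_less_power Np one_le_power N) simp_all
    also have "\<dots> \<le> 8 * ?n ^ 4" using pw by simp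
    finally show ?thesis .
  qed
  note R1 = order_trans[OF primH_remainder_le[OF abs_Re_le_cmod[of z], unfolded primH_denom(1)] r]
    and R2 = order_trans[OF primH_remainder_le[OF abs_Im_le_cmod[of z], unfolded primH_denom(1)] r]
  have comb: "\<bar>y - (y' - X)\<bar> \<le> A + C" if "\<bar>y - y'\<bar> \<le> A" "\<bar>X\<bar> \<le> C" for y y' X A C :: real
    using that by linarith
  have dif: "\<bar>y - y / ?N\<bar> \<le> Y * ?n ^ 4" if "\<bar>y\<bar> \<le> Y" for y Y
  proof -
    have nz: "?N \<noteq> 0" using Np by linarith
    have "y - y / ?N = y * (?n ^ 4 / ?N)" by (simp add: nz field_simps)
    moreover have "?n ^ 4 / ?N \<le> ?n ^ 4" using Np by (simp add: pos_divide_le_eq algebra_simps)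
    ultimately show ?thesis
      using that N by (simp add: abs_mult del: times_divide_eq_right) (intro mult_mono; simp)
  qed
  have "\<bar>Im z\<bar> \<le> 1" using abs_Im_le_cmod[of z] assms by linarith
  from comb[OF dif[OF this] R1] show "\<bar>Im z - primH1 z\<bar> \<le> 9 * ?n ^ 4"
    unfolding primH1_def primH_denom(1) by simp
  have \<rho>: "?\<rho> = 2 * Re z + ?n\<^sup>2"
    unfolding cmod_power2 by (simp add: power2_eq_square algebra_simps)
  \<comment> \<open>\<open>(Re z)\<^sup>2\<close> counts as fourth order because \<open>Re z\<close>
    is half of \<open>\<rho> - |z|\<^sup>2\<close>.\<close>
  have a2: "(Re z)\<^sup>2 \<le> ?\<rho>\<^sup>2 + ?n ^ 4"
  proof -
    have sq: "((r - m) / 2)\<^sup>2 \<le> r\<^sup>2 + m\<^sup>2" for r m :: real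
    proof -
      have "(r - m)\<^sup>2 \<le> 4 * (r\<^sup>2 + m\<^sup>2)"
      proof -
        have "4 * (r\<^sup>2 + m\<^sup>2) - (r - m)\<^sup>2 = (r + m)\<^sup>2 + 2 * r\<^sup>2 + 2 * m\<^sup>2"
          by (simp add: power2_eq_square algebra_simps)
        moreover have "(r + m)\<^sup>2 + 2 * r\<^sup>2 + 2 * m\<^sup>2 \<ge> 0" by simp
        ultimately show ?thesis by (metis diff_ge_0_iff_ge)
      qed
      then show ?thesis by (simp add: power_divide)
    qed
    have "Re z = (?\<rho> - ?n\<^sup>2) / 2" using \<rho> by simp
    then have "(Re z)\<^sup>2 \<le> ?\<rho>\<^sup>2 + (?n\<^sup>2)\<^sup>2" using sq by metis
    then show ?thesis by (simp flip: power_mult)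
  qed
  have "\<bar>Re z + (Im z)\<^sup>2\<bar> \<le> 2"
  proof -
    have "(Im z)\<^sup>2 \<le> ?n\<^sup>2" by (simp add: cmod_power2)
    then show ?thesis using pw assms abs_Re_le_cmod[of z] zero_le_power2[of "Im z"] by linarith
  qed
  from comb[OF dif[OF this] R2] have "\<bar>(Re z + (Im z)\<^sup>2) - primH2 z\<bar> \<le> 10 * ?n ^ 4"
    unfolding primH2_def primH_denom(1) by simp
  moreover have "?\<rho> - Re z = (Re z)\<^sup>2 + (Re z + (Im z)\<^sup>2)"
    unfolding \<rho> by (simp add: cmod_power2)
  ultimately show "\<bar>?\<rho> - Re z - primH2 z\<bar> \<le> ?\<rho>\<^sup>2 + 11 * ?n ^ 4"
    using a2 zero_le_power2[of "Re z"] by linarith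
qed

lemma primH_lipschitz: "\<bar>primH z - primH w\<bar> \<le> 19 * cmod (z - w)"
proof -
  have "norm (primH z - primH w) \<le> 19 * norm (z - w)"
  proof (rule differentiable_bound[where S = UNIV])
    show "(primH has_derivative (\<lambda>h. primH1 z * Re h + primH2 z * Im h)) (at z within UNIV)" for z
      using primH_has_derivative by simp
    show "onorm (\<lambda>h. primH1 z * Re h + primH2 z * Im h) \<le> 19" for z
    proof (rule onorm_le)
      fix h
      have "\<bar>primH1 z * Re h\<bar> \<le> 9 * cmod h" "\<bar>primH2 z * Im h\<bar> \<le> 10 * cmod h"
        unfolding abs_mult by (intro mult_mono primH_bounds abs_Re_le_cmod abs_Im_le_cmod; simp)+
      then show "norm (primH1 z * Re h + primH2 z * Im h) \<le> 19 * norm h" by simp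
    qed
  qed auto
  then show ?thesis by simp
qed

lemma primH_0: "primH 0 = 0"
  by (simp add: primH_def)

section \<open>Chain rule in \<open>D12\<close> for a real-valued function of
  \<open>u\<close>\<close>

definition real_comb :: "real \<Rightarrow> real \<Rightarrow> complex ^ 'n \<Rightarrow> complex ^ 'n" where
  "real_comb a b g = (\<chi> i. complex_of_real (a * Re (g $ i) + b * Im (g $ i)))"

lemma real_comb_diff:
  "real_comb a b g - real_comb a b h = real_comb a b (g - h)"
  "real_comb a b g - real_comb a' b' g = real_comb (a - a') (b - b') g"
  by (simp_all add: real_comb_def vec_eq_iff algebra_simps)

lemma norm_real_comb_le: "norm (real_comb a b g) \<le> (\<bar>a\<bar> + \<bar>b\<bar>) * norm g"
proof -
  have "norm (real_comb a b g) \<le> L2_set (\<lambda>i. (\<bar>a\<bar> + \<bar>b\<bar>) * norm (g $ i)) UNIV"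
    unfolding norm_vec_def
  proof (rule L2_set_mono)
    fix i
    have "\<bar>a * Re (g $ i)\<bar> \<le> \<bar>a\<bar> * norm (g $ i)" "\<bar>b * Im (g $ i)\<bar> \<le> \<bar>b\<bar> * norm (g $ i)"
      unfolding abs_mult by (intro mult_left_mono abs_Re_le_cmod abs_Im_le_cmod; simp)+
    then have "\<bar>a * Re (g $ i) + b * Im (g $ i)\<bar> \<le> (\<bar>a\<bar> + \<bar>b\<bar>) * norm (g $ i)"
      by (simp add: distrib_right)
    then show "norm (real_comb a b g $ i) \<le> (\<bar>a\<bar> + \<bar>b\<bar>) * norm (g $ i)"
      by (simp add: real_comb_def del: of_real_add)
  qed auto
  then show ?thesis
    by (simp add: L2_set_right_distrib norm_vec_def)
qed

lemma test_fun_primH: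
  assumes \<psi>: "test_fun \<psi>"
  shows "test_fun (\<lambda>x. complex_of_real (primH (\<psi> x)))"
    and "classical_grad (\<lambda>x. complex_of_real (primH (\<psi> x))) x
      = real_comb (primH1 (\<psi> x)) (primH2 (\<psi> x)) (classical_grad \<psi> x)"
proof -
  let ?A = "\<lambda>x. complex_of_real (Re (\<psi> x))" and ?B = "\<lambda>x. complex_of_real (Im (\<psi> x))"
  have A: "C_diff m ?A" "C_diff m ?B" for m
    using C_diff_linear[OF bounded_linear_compose[OF bounded_linear_of_real bounded_linear_Re] test_fun_smooth[OF \<psi>]]
      C_diff_linear[OF bounded_linear_compose[OF bounded_linear_of_real bounded_linear_Im] test_fun_smooth[OF \<psi>]]
    by auto
  \<comment> \<open>Written with complex sums, products and an inverse so that the closure rules for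
    \<open>C_diff\<close> apply; the denominator is nonzero as the image of a positive real
    number.\<close>
  have eq: "complex_of_real (primH (\<psi> x)) = (?A x * ?B x + ?B x ^ 3 * inverse 3) * inverse (1 + ((?A x)\<^sup>2 + (?B x)\<^sup>2)\<^sup>2)" for x
    by (simp only: primH_def divide_inverse of_real_mult of_real_add of_real_inverse of_real_power
        of_real_1 of_real_numeral)
  have nz: "1 + ((?A x)\<^sup>2 + (?B x)\<^sup>2)\<^sup>2 \<noteq> 0" for x
  proof -
    have "1 + ((?A x)\<^sup>2 + (?B x)\<^sup>2)\<^sup>2 = complex_of_real (1 + ((Re (\<psi> x))\<^sup>2 + (Im (\<psi> x))\<^sup>2)\<^sup>2)" by simp
    moreover have "complex_of_real (1 + ((Re (\<psi> x))\<^sup>2 + (Im (\<psi> x))\<^sup>2)\<^sup>2) \<noteq> 0"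
      unfolding of_real_eq_0_iff using primH_denom(2)[of "\<psi> x"] by linarith
    ultimately show ?thesis by simp
  qed
  have C: "C_diff m (\<lambda>x. complex_of_real (primH (\<psi> x)))" for m
    unfolding eq by (intro C_diff_mult C_diff_add C_diff_power C_diff_const A C_diff_inverse nz)
  obtain B where B: "\<And>x. norm x \<ge> B \<Longrightarrow> \<psi> x = 0"
    using classical_grad_supp[OF \<psi>] by metis
  show "test_fun (\<lambda>x. complex_of_real (primH (\<psi> x)))"
    using B by (intro test_funI[OF C, of B]) (simp add: primH_0)
  have "((\<lambda>x. complex_of_real (primH (\<psi> x))) has_derivative (\<lambda>h. complex_of_real
      (primH1 (\<psi> x) * Re (frechet_derivative \<psi> (at x) h) + primH2 (\<psi> x) * Im (frechet_derivative \<psi> (at x) h)))) (at x)"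
    by (intro has_derivative_of_real has_derivative_compose[OF test_fun_has_derivative[OF \<psi>] primH_has_derivative])
  note frechet_derivative_at[OF this, symmetric]
  then show "classical_grad (\<lambda>x. complex_of_real (primH (\<psi> x))) x
      = real_comb (primH1 (\<psi> x)) (primH2 (\<psi> x)) (classical_grad \<psi> x)"
    by (simp add: vec_eq_iff classical_grad_nth real_comb_def)
qed

lemma real_comb_measurable:
  assumes "a \<in> borel_measurable M" "b \<in> borel_measurable M" "g \<in> borel_measurable M"
  shows "(\<lambda>x. real_comb (a x) (b x) (g x)) \<in> borel_measurable M"
proof -
  have "continuous_on UNIV (\<lambda>p. real_comb (fst p) (fst (snd p)) (snd (snd p)) :: complex ^ 'n)"
    unfolding real_comb_def by (intro continuous_on_vec_lambda continuous_intros)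
  from borel_measurable_continuous_onI[OF this]
  have "(\<lambda>p. real_comb (fst p) (fst (snd p)) (snd (snd p)) :: complex ^ 'n) \<in> borel_measurable borel" .
  moreover have "(\<lambda>x. (a x, b x, g x)) \<in> borel_measurable M"
    using assms by (intro borel_measurable_Pair)
  ultimately show ?thesis
    using measurable_compose[of "\<lambda>x. (a x, b x, g x)" M borel "\<lambda>p. real_comb (fst p) (fst (snd p)) (snd (snd p))" borel]
    by simp
qed

lemma norm_add_power2_le: "(norm (x + y))\<^sup>2 \<le> 2 * (norm x)\<^sup>2 + 2 * (norm (y :: 'a::real_inner))\<^sup>2"
proof -
  have "2 * (norm x)\<^sup>2 + 2 * (norm y)\<^sup>2 - (norm (x + y))\<^sup>2 = (norm (x - y))\<^sup>2"
    by (simp add: power2_norm_eq_inner inner_add_left inner_add_right inner_diff_left inner_diff_right inner_commute)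
  then show ?thesis using zero_le_power2[of "norm (x - y)"] by linarith
qed

text \<open>The gradients differ by the coefficients at \<open>\<psi> j\<close> applied to
  \<open>classical_grad (\<psi> j) - G\<close>, which is small in \<open>L\<^sup>2\<close>, and by
  the change \<open>T j\<close> of the coefficients applied to \<open>G\<close>. The latter is
  handled by dominated convergence, from the almost everywhere convergence of
  \<open>\<psi> j\<close> and the boundedness of \<open>primH1\<close> and
  \<open>primH2\<close>.\<close>

lemma D12_grad_primH:
  fixes u :: "real ^ 'n \<Rightarrow> complex"
  assumes D: "D12_grad u G" and d: "CARD('n) \<ge> 3"
  shows "D12_grad (\<lambda>x. complex_of_real (primH (u x))) (\<lambda>x. real_comb (primH1 (u x)) (primH2 (u x)) (G x))"
    (is "D12_grad ?v ?K")
proof -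
  let ?p = "crit_exp CARD('n)"
  have p: "?p > 0" using crit_exp_gt_2[OF d] by simp
  obtain \<psi> where "D12_approx u G \<psi>"
    by (rule D12_grad_approx[OF D d])
  note \<psi> = D12_approxD[OF this]
  have uG: "in_Lp ?p u" "in_Lp 2 G" using D by (auto simp: D12_grad_def)
  then have um: "u \<in> borel_measurable lebesgue" and Gm: "G \<in> borel_measurable lebesgue"
    and Gi: "integrable lebesgue (\<lambda>x. (norm (G x))\<^sup>2)"
    by (auto simp: in_Lp_def)
  have \<psi>m: "\<psi> j \<in> borel_measurable lebesgue" for j
    using test_fun_in_Lp[OF \<psi>(1) p] by (simp add: in_Lp_def)
  have comp: "(\<lambda>x. f (h x)) \<in> borel_measurable lebesgue"
    if "continuous_on UNIV f" "h \<in> borel_measurable lebesgue" for f :: "complex \<Rightarrow> real" and h :: "real ^ 'n \<Rightarrow> complex"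
    using measurable_compose[OF that(2) borel_measurable_continuous_onI[OF that(1)]] .
  have vm: "?v \<in> borel_measurable lebesgue"
    using comp[OF continuous_primH(1) um] by measurable
  have Km: "?K \<in> borel_measurable lebesgue"
    by (intro real_comb_measurable comp continuous_primH um Gm)
  have rc: "norm (real_comb (primH1 z) (primH2 z) g) \<le> 19 * norm g" for z and g :: "complex ^ 'n"
  proof -
    have "norm (real_comb (primH1 z) (primH2 z) g) \<le> (\<bar>primH1 z\<bar> + \<bar>primH2 z\<bar>) * norm g"
      by (rule norm_real_comb_le)
    also have "\<dots> \<le> 19 * norm g"
      using primH_bounds(1,2)[of z] by (intro mult_right_mono) auto
    finally show ?thesis .
  qed
  have vL: "in_Lp ?p ?v"
    using primH_lipschitz[of _ 0] p by (intro in_Lp_mono[OF uG(1) vm, where C = 19]) (simp_all add: primH_0)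
  have KL: "in_Lp 2 ?K"
    using rc by (intro in_Lp_mono[OF uG(2) Km, where C = 19]) simp_all
  let ?\<xi> = "\<lambda>j x. complex_of_real (primH (\<psi> j x))"
  have lim1: "(\<lambda>j. \<integral>x. norm (?\<xi> j x - ?v x) powr ?p \<partial>lebesgue) \<longlonglongrightarrow> 0"
  proof (rule Lim_null_comparison)
    show "(\<lambda>j. 19 powr ?p * (\<integral>x. norm (\<psi> j x - u x) powr ?p \<partial>lebesgue)) \<longlonglongrightarrow> 0"
      using tendsto_mult_right_zero[OF \<psi>(2)] by simp
    have "(\<integral>x. norm (?\<xi> j x - ?v x) powr ?p \<partial>lebesgue) \<le> (\<integral>x. 19 powr ?p * norm (\<psi> j x - u x) powr ?p \<partial>lebesgue)" for j
    proof (rule integral_mono)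
      have "in_Lp ?p (\<lambda>x. ?\<xi> j x - ?v x)"
        using test_fun_in_Lp[OF test_fun_primH(1)[OF \<psi>(1)] p] vL p by (intro in_Lp_diff) auto
      then show "integrable lebesgue (\<lambda>x. norm (?\<xi> j x - ?v x) powr ?p)" by (simp add: in_Lp_def)
      show "integrable lebesgue (\<lambda>x. 19 powr ?p * norm (\<psi> j x - u x) powr ?p)"
        using \<psi>(4)[of j] by (simp add: in_Lp_def)
      show "norm (?\<xi> j x - ?v x) powr ?p \<le> 19 powr ?p * norm (\<psi> j x - u x) powr ?p" for x
        using primH_lipschitz[of "\<psi> j x" "u x"] p
        by (simp add: powr_mono2 flip: powr_mult of_real_diff)
    qed
    then show "\<forall>\<^sub>F j in sequentially. norm (\<integral>x. norm (?\<xi> j x - ?v x) powr ?p \<partial>lebesgue)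
        \<le> 19 powr ?p * (\<integral>x. norm (\<psi> j x - u x) powr ?p \<partial>lebesgue)"
      by (auto intro!: always_eventually)
  qed
  define T where "T j x = real_comb (primH1 (\<psi> j x) - primH1 (u x)) (primH2 (\<psi> j x) - primH2 (u x)) (G x)" for j x
  have Tm: "T j \<in> borel_measurable lebesgue" for j
    unfolding T_def[abs_def] by (intro real_comb_measurable borel_measurable_diff comp continuous_primH um Gm \<psi>m)
  have Tb: "norm (T j x) \<le> 38 * norm (G x)" for j x
  proof -
    have "norm (T j x) \<le> 19 * norm (G x) + 19 * norm (G x)"
      unfolding T_def real_comb_diff(2)[symmetric]
      by (rule order_trans[OF norm_triangle_ineq4 add_mono[OF rc rc]])
    then show ?thesis by simp
  qed
  have TL: "in_Lp 2 (T j)" for j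
    using Tb by (intro in_Lp_mono[OF uG(2) Tm, where C = 38]) simp_all
  then have Ti: "integrable lebesgue (\<lambda>x. (norm (T j x))\<^sup>2)" for j
    by (simp add: in_Lp_def)
  have limT: "(\<lambda>j. \<integral>x. (norm (T j x))\<^sup>2 \<partial>lebesgue) \<longlonglongrightarrow> (\<integral>x. 0 \<partial>(lebesgue :: (real ^ 'n) measure))"
  proof (rule integral_dominated_convergence[where w = "\<lambda>x. (38 * norm (G x))\<^sup>2"])
    show "integrable lebesgue (\<lambda>x. (38 * norm (G x))\<^sup>2)"
      using Gi by (simp add: power_mult_distrib)
    show "(\<lambda>x. (norm (T j x))\<^sup>2) \<in> borel_measurable lebesgue" for j
      using Ti by (rule borel_measurable_integrable)
    show "AE x in lebesgue. norm ((norm (T j x))\<^sup>2) \<le> (38 * norm (G x))\<^sup>2" for j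
      using power_mono[OF Tb norm_ge_zero, of j _ 2] by (intro AE_I2) simp
    show "AE x in lebesgue. (\<lambda>j. (norm (T j x))\<^sup>2) \<longlonglongrightarrow> 0"
      using \<psi>(6)
    proof eventually_elim
      case (elim x)
      have l: "(\<lambda>j. primH1 (\<psi> j x) - primH1 (u x)) \<longlonglongrightarrow> 0" "(\<lambda>j. primH2 (\<psi> j x) - primH2 (u x)) \<longlonglongrightarrow> 0"
        using continuous_on_tendsto_compose[OF continuous_primH(2) elim]
          continuous_on_tendsto_compose[OF continuous_primH(3) elim] by (simp_all add: LIM_zero)
      have "(\<lambda>j. norm (T j x)) \<longlonglongrightarrow> 0"
      proof (rule Lim_null_comparison[OF always_eventually], rule allI)
        show "norm (norm (T j x)) \<le> (\<bar>primH1 (\<psi> j x) - primH1 (u x)\<bar> + \<bar>primH2 (\<psi> j x) - primH2 (u x)\<bar>) * norm (G x)" for j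
          unfolding T_def by (simp add: norm_real_comb_le)
        show "(\<lambda>j. (\<bar>primH1 (\<psi> j x) - primH1 (u x)\<bar> + \<bar>primH2 (\<psi> j x) - primH2 (u x)\<bar>) * norm (G x)) \<longlonglongrightarrow> 0"
          using tendsto_mult_left_zero[OF tendsto_add_zero[OF tendsto_rabs_zero[OF l(1)] tendsto_rabs_zero[OF l(2)]]] .
      qed
      then show ?case
        using tendsto_power[of "\<lambda>j. norm (T j x)" 0 sequentially 2] by simp
    qed
  qed simp
  have lim2: "(\<lambda>j. \<integral>x. (norm (classical_grad (?\<xi> j) x - ?K x))\<^sup>2 \<partial>lebesgue) \<longlonglongrightarrow> 0"
  proof (rule Lim_null_comparison)
    \<comment> \<open>The factor 722 is \<open>2 * 19\<^sup>2\<close>, with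
      \<open>19 = 9 + 10\<close> from \<open>primH_bounds\<close>.\<close>
    let ?c = "\<lambda>j. 722 * (\<integral>x. (norm (classical_grad (\<psi> j) x - G x))\<^sup>2 \<partial>lebesgue) + 2 * (\<integral>x. (norm (T j x))\<^sup>2 \<partial>lebesgue)"
    have "?c \<longlonglongrightarrow> 722 * 0 + 2 * (\<integral>x. 0 \<partial>(lebesgue :: (real ^ 'n) measure))"
      by (intro tendsto_intros limT \<psi>)
    then show "?c \<longlonglongrightarrow> 0" by simp
    have "(\<integral>x. (norm (classical_grad (?\<xi> j) x - ?K x))\<^sup>2 \<partial>lebesgue) \<le> ?c j" for j
    proof -
      have i: "integrable lebesgue (\<lambda>x. (norm (classical_grad (\<psi> j) x - G x))\<^sup>2)"
        using \<psi>(5)[of j] by (simp add: in_Lp_2_iff)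
      have "(\<integral>x. (norm (classical_grad (?\<xi> j) x - ?K x))\<^sup>2 \<partial>lebesgue)
        \<le> (\<integral>x. 722 * (norm (classical_grad (\<psi> j) x - G x))\<^sup>2 + 2 * (norm (T j x))\<^sup>2 \<partial>lebesgue)"
      proof (rule integral_mono)
        have "in_Lp 2 (\<lambda>x. classical_grad (?\<xi> j) x - ?K x)"
          using classical_grad_in_Lp[OF test_fun_primH(1)[OF \<psi>(1)], of 2] KL by (intro in_Lp_diff) auto
        then show "integrable lebesgue (\<lambda>x. (norm (classical_grad (?\<xi> j) x - ?K x))\<^sup>2)" by (simp add: in_Lp_2_iff)
        show "integrable lebesgue (\<lambda>x. 722 * (norm (classical_grad (\<psi> j) x - G x))\<^sup>2 + 2 * (norm (T j x))\<^sup>2)"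
          using i Ti by simp
        fix x
        let ?a = "real_comb (primH1 (\<psi> j x)) (primH2 (\<psi> j x)) (classical_grad (\<psi> j) x - G x)"
        have "classical_grad (?\<xi> j) x - ?K x = ?a + T j x"
          unfolding test_fun_primH(2)[OF \<psi>(1)] T_def
          by (simp flip: real_comb_diff)
        then have "(norm (classical_grad (?\<xi> j) x - ?K x))\<^sup>2 \<le> 2 * (norm ?a)\<^sup>2 + 2 * (norm (T j x))\<^sup>2"
          using norm_add_power2_le by metis
        moreover have "(norm ?a)\<^sup>2 \<le> (19 * norm (classical_grad (\<psi> j) x - G x))\<^sup>2"
          by (intro power_mono rc) simp
        ultimately show "(norm (classical_grad (?\<xi> j) x - ?K x))\<^sup>2 \<le> 722 * (norm (classical_grad (\<psi> j) x - G x))\<^sup>2 + 2 * (norm (T j x))\<^sup>2"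
          by (simp add: power_mult_distrib)
      qed
      also have "\<dots> = ?c j" using i Ti by simp
      finally show ?thesis .
    qed
    then show "\<forall>\<^sub>F j in sequentially. norm (\<integral>x. (norm (classical_grad (?\<xi> j) x - ?K x))\<^sup>2 \<partial>lebesgue) \<le> ?c j"
      by (auto intro!: always_eventually)
  qed
  show ?thesis
    unfolding D12_grad_def
    by (intro conjI vL KL exI[of _ ?\<xi>] allI test_fun_primH(1)[OF \<psi>(1)] lim1 lim2)
qed

text \<open>What is left of \<open>\<langle>\<i>\<partial>u, u\<rangle>\<close> once the derivative
  of \<open>primH\<close> composed with \<open>u\<close> is subtracted; \<open>z\<close> is the
  value and \<open>g\<close> the partial derivative of \<open>u\<close>.\<close>

definition mom_density :: "complex \<Rightarrow> complex \<Rightarrow> real" where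
  "mom_density z g = (Im z - primH1 z) * Re g - (Re z + primH2 z) * Im g"

text \<open>The subtracted part is a partial derivative of a real element of \<open>D12\<close>,
  hence lies in \<open>Y_space k\<close> and does not contribute to \<open>Lam\<close>. Uniqueness
  of the gradient reconciles the representative chosen by \<open>grad\<close> with the one from the
  chain rule.\<close>

lemma momentum_eq:
  fixes u :: "real ^ 'n \<Rightarrow> complex"
  assumes d: "CARD('n) \<ge> 3" and u: "u \<in> D12"
    and int: "integrable lebesgue (\<lambda>x. mom_density (u x) (grad u x $ k))"
  shows "momentum k u = 1 / 2 * (\<integral>x. mom_density (u x) (grad u x $ k) \<partial>lebesgue)"
proof -
  define w where "w x = primH1 (u x) * Re (grad u x $ k) + primH2 (u x) * Im (grad u x $ k)" for x
  let ?h = "\<lambda>x. complex_of_real (primH (u x))"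
  have D: "D12_grad u (grad u)" using u by (rule D12_grad_grad)
  note DH = D12_grad_primH[OF D d]
  have hD: "?h \<in> D12" using DH by (auto simp: D12_def)
  have w: "w \<in> Y_space k"
    unfolding Y_space_def
  proof (intro CollectI conjI bexI[OF _ hD] allI)
    have "(\<lambda>x. real_comb (primH1 (u x)) (primH2 (u x)) (grad u x) $ k) \<in> borel_measurable lebesgue"
      using DH measurable_compose[OF _ vec_nth_measurable] by (auto simp: D12_grad_def in_Lp_def)
    then have "(\<lambda>x. Re (real_comb (primH1 (u x)) (primH2 (u x)) (grad u x) $ k)) \<in> borel_measurable lebesgue"
      using measurable_compose[of _ lebesgue borel Re borel] borel_measurable_continuous_onI[OF continuous_on_Re[OF continuous_on_id]]
      by blast
    then show "w \<in> borel_measurable lebesgue"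
      by (simp add: w_def[abs_def] real_comb_def del: of_real_add)
    show "AE x in lebesgue. complex_of_real (w x) = grad ?h x $ k"
      using D12_grad_unique[OF D12_grad_grad[OF hD] DH d]
      by eventually_elim (simp add: w_def real_comb_def)
  qed simp
  have "(\<i> * grad u x $ k) \<bullet> u x = mom_density (u x) (grad u x $ k) + w x" for x
    by (simp add: inner_complex_def mom_density_def w_def algebra_simps)
  then have "Lam k (\<lambda>x. (\<i> * grad u x $ k) \<bullet> u x) = (\<integral>x. mom_density (u x) (grad u x $ k) \<partial>lebesgue)"
    by (intro Lam_eq[OF d int w]) simp
  then show ?thesis by (simp add: momentum_def)
qed

section \<open>Pointwise bounds for \<open>\<phi>\<close> and for the momentum density\<close>

lemma admissible_phi_bounds:
  assumes "admissible_phi \<phi>"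
  shows "continuous_on UNIV \<phi>" "s \<ge> 0 \<Longrightarrow> s \<le> 2 \<Longrightarrow> \<phi> s = s"
    and "s \<ge> 0 \<Longrightarrow> \<bar>(\<phi> s)\<^sup>2 - 1\<bar> \<le> 8"
    and "s \<ge> 0 \<Longrightarrow> \<bar>(\<phi> s)\<^sup>2 - 1\<bar> \<le> 4 * \<bar>s - 1\<bar>"
proof -
  have sm: "C_diff m \<phi>" for m using assms by (simp add: admissible_phi_def smooth_def)
  show "continuous_on UNIV \<phi>" using sm[of 0] by simp
  have id: "\<phi> s = s" if "s \<ge> 0" "s \<le> 2" for s using assms that by (simp add: admissible_phi_def)
  then show "s \<ge> 0 \<Longrightarrow> s \<le> 2 \<Longrightarrow> \<phi> s = s" .
  have diff: "\<phi> differentiable (at x)" for x using sm[of "Suc 0"] by simp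
  have der: "(\<phi> has_real_derivative deriv \<phi> x) (at x)" "0 \<le> deriv \<phi> x" "deriv \<phi> x \<le> 1" for x
    using diff[of x] assms by (auto simp: admissible_phi_def DERIV_deriv_iff_real_differentiable)
  have mono: "\<phi> a \<le> \<phi> b" if "a \<le> b" for a b
    using DERIV_nonneg_imp_nondecreasing[OF that] der by blast
  \<comment> \<open>\<open>s - \<phi> s\<close> is nondecreasing because
    \<open>deriv \<phi> \<le> 1\<close>; together with \<open>mono\<close> and the fixed point 1
    this gives \<open>|\<phi> s - 1| \<le> |s - 1|\<close>.\<close>
  have mono': "b - \<phi> b \<ge> a - \<phi> a" if "a \<le> b" for a b
  proof (rule DERIV_nonneg_imp_nondecreasing[OF that])
    show "\<exists>y. ((\<lambda>b. b - \<phi> b) has_real_derivative y) (at x) \<and> 0 \<le> y" for x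
      using der[of x] by (intro exI[of _ "1 - deriv \<phi> x"]) (auto intro!: derivative_eq_intros)
  qed
  have b: "0 \<le> \<phi> s \<and> \<phi> s \<le> 3" if "s \<ge> 0" for s
  proof -
    have "\<phi> s \<le> \<phi> (max s 4)" by (rule mono) simp
    also have "\<dots> = 3" using assms by (simp add: admissible_phi_def)
    finally show ?thesis using mono[OF that] id[of 0] by simp
  qed
  have "\<bar>\<phi> s - 1\<bar> \<le> \<bar>s - 1\<bar>" for s
    using mono[of 1 s] mono[of s 1] mono'[of 1 s] mono'[of s 1] id[of 1] by (cases "s \<le> 1") auto
  moreover have e: "\<bar>(\<phi> s)\<^sup>2 - 1\<bar> = (\<phi> s + 1) * \<bar>\<phi> s - 1\<bar>" if "s \<ge> 0" for s
  proof -
    have "(\<phi> s)\<^sup>2 - 1 = (\<phi> s + 1) * (\<phi> s - 1)" by (simp add: power2_eq_square algebra_simps)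
    then show ?thesis using b[OF that] by (simp add: abs_mult)
  qed
  \<comment> \<open>The factor \<open>\<phi> s + 1\<close> lies between 1 and 4, since
    \<open>\<phi>\<close> stays between 0 and 3 for nonnegative arguments.\<close>
  ultimately show "\<bar>(\<phi> s)\<^sup>2 - 1\<bar> \<le> 4 * \<bar>s - 1\<bar>" if "s \<ge> 0"
    unfolding e[OF that] using b[OF that] by (intro mult_mono) auto
  show "\<bar>(\<phi> s)\<^sup>2 - 1\<bar> \<le> 8" if "s \<ge> 0"
  proof -
    have "(\<phi> s)\<^sup>2 \<le> 3\<^sup>2" using b[OF that] by (intro power_mono) auto
    then have "(\<phi> s)\<^sup>2 \<le> 9" by simp
    then show ?thesis using zero_le_power2[of "\<phi> s"] by (intro abs_leI) linarith+
  qed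
qed

text \<open>For \<open>|z| \<le> \<delta>\<close> one has \<open>|1 + z| \<le> 2\<close>, where
  \<open>\<phi>\<close> is the identity and \<open>\<phi>\<^sup>2 - 1\<close> is
  \<open>\<rho>\<close> itself, so the fourth-order expansion applies. For larger \<open>|z|\<close>
  the linear bounds on \<open>primH1\<close> and \<open>primH2\<close> and a weighted
  arithmetic-geometric mean inequality suffice.\<close>

lemma mom_density_le:
  assumes \<phi>: "admissible_phi \<phi>" and q: "2 < q" "q \<le> 6" and \<delta>: "0 < \<delta>" "\<delta> \<le> 1" and g: "norm g \<le> N"
  shows "\<bar>mom_density z g\<bar> \<le> \<bar>(\<phi> (cmod (1 + z)))\<^sup>2 - 1\<bar> * N
    + 12 * \<delta> * (((\<phi> (cmod (1 + z)))\<^sup>2 - 1)\<^sup>2 + cmod z powr q + N\<^sup>2)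
    + 12 / \<delta> * ((cmod z)\<^sup>2 * indicator {\<delta><..} (cmod z))"
proof -
  let ?n = "cmod z" and ?R = "(\<phi> (cmod (1 + z)))\<^sup>2 - 1"
  have N: "N \<ge> 0" using g norm_ge_zero order_trans by blast
  have re: "\<bar>Re g\<bar> \<le> N" "\<bar>Im g\<bar> \<le> N" using abs_Re_le_cmod[of g] abs_Im_le_cmod[of g] g by linarith+
  have amgm: "a * b \<le> (a\<^sup>2 + b\<^sup>2) / 2" for a b :: real
    using sum_squares_bound[of a b] by simp
  show ?thesis
  proof (cases "?n \<le> \<delta>")
    case True
    then have n1: "?n \<le> 1" using \<delta> by linarith
    have "cmod (1 + z) \<le> 2" using norm_triangle_ineq[of 1 z] n1 by simp
    then have R: "?R = (cmod (1 + z))\<^sup>2 - 1" by (simp add: admissible_phi_bounds(2)[OF \<phi>])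
    have "mom_density z g = (Im z - primH1 z) * Re g + ((?R - Re z - primH2 z) - ?R) * Im g"
      by (simp add: mom_density_def algebra_simps)
    also have "\<bar>\<dots>\<bar> \<le> 9 * ?n ^ 4 * N + ((?R\<^sup>2 + 11 * ?n ^ 4) + \<bar>?R\<bar>) * N"
    proof (rule order_trans[OF abs_triangle_ineq add_mono])
      show "\<bar>(Im z - primH1 z) * Re g\<bar> \<le> 9 * ?n ^ 4 * N"
        unfolding abs_mult by (intro mult_mono primH_bounds_small n1 re) auto
      have "\<bar>(?R - Re z - primH2 z) - ?R\<bar> \<le> (?R\<^sup>2 + 11 * ?n ^ 4) + \<bar>?R\<bar>"
        using primH_bounds_small(2)[OF n1] unfolding R by linarith
      then show "\<bar>((?R - Re z - primH2 z) - ?R) * Im g\<bar> \<le> ((?R\<^sup>2 + 11 * ?n ^ 4) + \<bar>?R\<bar>) * N"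
        unfolding abs_mult by (intro mult_mono re) auto
    qed
    also have "\<dots> = \<bar>?R\<bar> * N + ?R\<^sup>2 * N + 20 * (?n ^ 4 * N)" by (simp add: algebra_simps)
    \<comment> \<open>\<open>|\<rho>| \<le> 3 * |z| \<le> 3 * \<delta>\<close>, so one of the two
      factors \<open>|\<rho>|\<close> is traded for \<open>\<delta>\<close>.\<close>
    also have "?R\<^sup>2 * N \<le> 2 * \<delta> * (?R\<^sup>2 + N\<^sup>2)"
    proof -
      have "?R = 2 * Re z + ?n\<^sup>2"
        unfolding R cmod_power2 by (simp add: power2_eq_square algebra_simps)
      moreover have "?n\<^sup>2 \<le> ?n" using n1 power_decreasing[of 1 2 ?n] by simp
      ultimately have "\<bar>?R\<bar> \<le> 3 * \<delta>"
        using abs_Re_le_cmod[of z] True zero_le_power2[of ?n] by linarith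
      then have "\<bar>?R\<bar> * \<bar>?R\<bar> \<le> 3 * \<delta> * \<bar>?R\<bar>"
        by (intro mult_right_mono) auto
      then have "?R\<^sup>2 \<le> 3 * \<delta> * \<bar>?R\<bar>"
        by (simp only: power2_eq_square abs_mult_self_eq)
      then have "?R\<^sup>2 * N \<le> (3 * \<delta> * \<bar>?R\<bar>) * N"
        using N by (rule mult_right_mono)
      also have "\<dots> = 3 * \<delta> * (\<bar>?R\<bar> * N)" by simp
      also have "\<dots> \<le> 3 * \<delta> * ((\<bar>?R\<bar>\<^sup>2 + N\<^sup>2) / 2)"
        using \<delta> by (intro mult_left_mono amgm) auto
      also have "\<dots> \<le> 2 * \<delta> * (?R\<^sup>2 + N\<^sup>2)"
        using \<delta> by (simp add: mult_right_mono)
      finally show ?thesis .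
    qed
    \<comment> \<open>One factor \<open>|z|\<close> is at most \<open>\<delta>\<close>; the other
      three are below \<open>|z| powr (q / 2)\<close> because \<open>|z| \<le> 1\<close> and
      \<open>q \<le> 6\<close>.\<close>
    also have "20 * (?n ^ 4 * N) \<le> 10 * \<delta> * (?n powr q + N\<^sup>2)"
    proof -
      have "?n ^ 3 \<le> ?n powr (q / 2)"
      proof (cases "z = 0")
        case False
        then have "?n powr 3 \<le> ?n powr (q / 2)"
          using n1 q by (intro powr_mono') auto
        then show ?thesis using False by (simp add: powr_numeral)
      qed simp
      then have "?n ^ 4 \<le> \<delta> * ?n powr (q / 2)"
        using True \<delta> mult_mono[of ?n \<delta> "?n ^ 3" "?n powr (q / 2)"] by (simp add: eval_nat_numeral mult_ac)
      then have "20 * (?n ^ 4 * N) \<le> 20 * (\<delta> * ?n powr (q / 2) * N)"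
        using N by (intro mult_left_mono mult_right_mono) auto
      also have "\<dots> = 20 * \<delta> * (?n powr (q / 2) * N)" by simp
      also have "\<dots> \<le> 20 * \<delta> * (((?n powr (q / 2))\<^sup>2 + N\<^sup>2) / 2)"
        using \<delta> by (intro mult_left_mono amgm) auto
      also have "(?n powr (q / 2))\<^sup>2 = ?n powr q"
        by (simp add: power2_eq_square flip: powr_add)
      finally show ?thesis by simp
    qed
    finally have "\<bar>mom_density z g\<bar> \<le> \<bar>?R\<bar> * N + 2 * \<delta> * (?R\<^sup>2 + N\<^sup>2) + 10 * \<delta> * (?n powr q + N\<^sup>2)" by simp
    also have "\<dots> \<le> \<bar>?R\<bar> * N + 12 * \<delta> * (?R\<^sup>2 + ?n powr q + N\<^sup>2)"
    proof -
      have "\<delta> * ?R\<^sup>2 \<ge> 0" "\<delta> * ?n powr q \<ge> 0" using \<delta> by auto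
      then show ?thesis by (simp add: algebra_simps)
    qed
    finally show ?thesis using True by simp
  next
    case False
    have "\<bar>mom_density z g\<bar> \<le> 10 * ?n * N + 11 * ?n * N"
      unfolding mom_density_def
    proof (rule order_trans[OF abs_triangle_ineq4 add_mono])
      have "\<bar>Im z - primH1 z\<bar> \<le> 10 * ?n" "\<bar>Re z + primH2 z\<bar> \<le> 11 * ?n"
        using abs_Im_le_cmod[of z] abs_Re_le_cmod[of z] primH_bounds(3,4)[of z] by linarith+
      then show "\<bar>(Im z - primH1 z) * Re g\<bar> \<le> 10 * ?n * N" "\<bar>(Re z + primH2 z) * Im g\<bar> \<le> 11 * ?n * N"
        unfolding abs_mult by (intro mult_mono re; simp)+
    qed
    also have "\<dots> = 21 * (?n * N)" by simp
    also have "\<dots> \<le> 12 * \<delta> * N\<^sup>2 + 12 / \<delta> * ?n\<^sup>2"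
    proof -
      \<comment> \<open>Weighting by \<open>sqrt \<delta>\<close> puts the small factor on
        \<open>N\<^sup>2\<close> and \<open>1 / \<delta>\<close> on \<open>|z|\<^sup>2\<close>; the
        resulting \<open>21 / 2\<close> is rounded up to 12.\<close>
      have "?n * N = (?n / sqrt \<delta>) * (sqrt \<delta> * N)" using \<delta> by simp
      also have "\<dots> \<le> ((?n / sqrt \<delta>)\<^sup>2 + (sqrt \<delta> * N)\<^sup>2) / 2" by (rule amgm)
      also have "\<dots> = (?n\<^sup>2 / \<delta> + \<delta> * N\<^sup>2) / 2" using \<delta> by (simp add: power_divide power_mult_distrib)
      finally have "?n * N \<le> (?n\<^sup>2 / \<delta> + \<delta> * N\<^sup>2) / 2" .
      moreover have "?n\<^sup>2 / \<delta> \<ge> 0" "\<delta> * N\<^sup>2 \<ge> 0" using \<delta> by auto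
      moreover have "21 * y \<le> 12 * a + 12 * b" if "y \<le> (b + a) / 2" "b \<ge> 0" "a \<ge> 0" for y a b :: real
      proof -
        have "2 * y \<le> b + a" using that(1) by simp
        then show ?thesis using that(2,3) by linarith
      qed
      ultimately have "21 * (?n * N) \<le> 12 * (\<delta> * N\<^sup>2) + 12 * (?n\<^sup>2 / \<delta>)" by blast
      then show ?thesis by (simp add: mult.assoc)
    qed
    also have "12 * \<delta> * N\<^sup>2 \<le> 12 * \<delta> * (?R\<^sup>2 + ?n powr q + N\<^sup>2)"
      using \<delta> by (intro mult_left_mono) auto
    also have "\<dots> \<le> \<bar>?R\<bar> * N + 12 * \<delta> * (?R\<^sup>2 + ?n powr q + N\<^sup>2)" using N by simp
    finally show ?thesis using False by simp
  qed
qed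

section \<open>Translation estimate and Poincare inequality\<close>

lemma pred_ball [measurable]:
  fixes f :: "'b \<Rightarrow> 'a::euclidean_space"
  assumes [measurable]: "f \<in> borel_measurable M"
  shows "Measurable.pred M (\<lambda>x. f x \<in> ball a l)"
  unfolding mem_ball by measurable

lemma nn_integral_translation':
  fixes f :: "'a::euclidean_space \<Rightarrow> ennreal"
  assumes "f \<in> borel_measurable borel"
  shows "(\<integral>\<^sup>+x. f (x + c) \<partial>lborel) = (\<integral>\<^sup>+x. f x \<partial>lborel)"
  using nn_integral_translation[OF assms, of c] by (simp add: add.commute)

text \<open>The increment is the integral of the derivative over the segment from \<open>x\<close>
  to \<open>x + h\<close>; its square is at most the integral of the square over the parameter
  interval, and after exchanging integrals the shift \<open>t *\<^sub>R h\<close> drops out by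
  translation invariance.\<close>

lemma translation_estimate:
  fixes g :: "'a::euclidean_space \<Rightarrow> 'b::euclidean_space" and N :: "'a \<Rightarrow> real"
  assumes der: "\<And>x. (g has_derivative g' x) (at x)"
    and bound: "\<And>x h. norm (g' x h) \<le> norm h * N x" and N: "continuous_on UNIV N" "\<And>x. N x \<ge> 0"
  shows "(\<integral>\<^sup>+x. ennreal ((norm (g (x + h) - g x))\<^sup>2) \<partial>lborel)
    \<le> ennreal ((norm h)\<^sup>2) * (\<integral>\<^sup>+x. ennreal ((N x)\<^sup>2) \<partial>lborel)"
proof -
  have [measurable]: "N \<in> borel_measurable borel" by (intro borel_measurable_continuous_onI N)
  have pt: "ennreal ((norm (g (x + h) - g x))\<^sup>2)
      \<le> (\<integral>\<^sup>+t. ennreal ((norm h)\<^sup>2) * (ennreal ((N (x + t *\<^sub>R h))\<^sup>2) * indicator {0..1} t) \<partial>lborel)" for x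
  proof -
    let ?f = "\<lambda>t. (norm h * N (x + t *\<^sub>R h))"
    have c: "continuous_on {0..1} ?f"
      by (intro continuous_intros continuous_on_compose2[OF N(1)]) auto
    have c2: "continuous_on {0..1} (\<lambda>t. (?f t)\<^sup>2)"
      by (intro continuous_intros c)
    have "norm (g (x + 1 *\<^sub>R h) - g (x + 0 *\<^sub>R h)) \<le> integral {0..1} ?f"
    proof -
      have "((\<lambda>t. g' (x + t *\<^sub>R h) h) has_integral g (x + 1 *\<^sub>R h) - g (x + 0 *\<^sub>R h)) {0..1}"
        by (intro fundamental_theorem_of_calculus has_derivative_along_line[OF der]) simp
      moreover have "(?f has_integral integral {0..1} ?f) {0..1}"
        by (intro integrable_integral integrable_continuous_real c)
      ultimately show ?thesis
        using integral_norm_bound_integral[of "\<lambda>t. g' (x + t *\<^sub>R h) h" "{0..1}" ?f] bound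
        by (metis has_integral_integrable_integral)
    qed
    then have "(norm (g (x + h) - g x))\<^sup>2 \<le> (integral {0..1} ?f)\<^sup>2"
      by (intro power_mono) auto
    also have "\<dots> \<le> integral {0..1} (\<lambda>t. (?f t)\<^sup>2)"
    proof -
      let ?I = "integral {0..1} ?f"
      have i: "?f integrable_on {0..1}" "(\<lambda>t. (?f t)\<^sup>2) integrable_on {0..1}"
        by (intro integrable_continuous_real c c2)+
      \<comment> \<open>Jensen's inequality on the unit interval, obtained as nonnegativity of the
        variance of \<open>?f\<close>.\<close>
      have "0 \<le> integral {0..1} (\<lambda>t. (?f t - ?I)\<^sup>2)"
        by (intro Henstock_Kurzweil_Integration.integral_nonneg integrable_continuous_real continuous_intros c) auto
      also have "(\<lambda>t. (?f t - ?I)\<^sup>2) = (\<lambda>t. (?f t)\<^sup>2 - (2 * ?I) * ?f t + ?I\<^sup>2)"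
        by (simp add: fun_eq_iff power2_diff algebra_simps)
      also have "integral {0..1} (\<lambda>t. (?f t)\<^sup>2 - (2 * ?I) * ?f t + ?I\<^sup>2)
          = integral {0..1} (\<lambda>t. (?f t)\<^sup>2) - 2 * ?I * ?I + ?I\<^sup>2"
      proof (rule integral_unique)
        have k: "((\<lambda>t::real. ?I\<^sup>2) has_integral ?I\<^sup>2) {0..1}"
          using has_integral_const_real[of "?I\<^sup>2" 0 1] by simp
        show "((\<lambda>t. (?f t)\<^sup>2 - (2 * ?I) * ?f t + ?I\<^sup>2) has_integral
            (integral {0..1} (\<lambda>t. (?f t)\<^sup>2) - 2 * ?I * ?I + ?I\<^sup>2)) {0..1}"
          by (intro has_integral_add has_integral_diff has_integral_mult_right k integrable_integral i)
      qed
      finally have "2 * ?I * ?I - ?I\<^sup>2 \<le> integral {0..1} (\<lambda>t. (?f t)\<^sup>2)" by linarith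
      moreover have "2 * ?I * ?I - ?I\<^sup>2 = ?I\<^sup>2" unfolding power2_eq_square by linarith
      ultimately show ?thesis by (simp only:)
    qed
    finally have "ennreal ((norm (g (x + h) - g x))\<^sup>2) \<le> ennreal (integral {0..1} (\<lambda>t. (?f t)\<^sup>2))"
      by (rule ennreal_leI)
    also have "\<dots> = (\<integral>\<^sup>+t. ennreal ((?f t)\<^sup>2) * indicator {0..1} t \<partial>lborel)"
    proof -
      have "((\<lambda>t. (?f t)\<^sup>2) has_integral integral {0..1} (\<lambda>t. (?f t)\<^sup>2)) {0..1}"
        by (intro integrable_integral integrable_continuous_real c2)
      from nn_integral_has_integral_lebesgue'[OF _ this] show ?thesis by simp
    qed
    also have "\<dots> = (\<integral>\<^sup>+t. ennreal ((norm h)\<^sup>2) * (ennreal ((N (x + t *\<^sub>R h))\<^sup>2) * indicator {0..1} t) \<partial>lborel)"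
      by (intro nn_integral_cong) (simp add: power_mult_distrib ennreal_mult mult.assoc)
    finally show ?thesis .
  qed
  have "(\<integral>\<^sup>+x. ennreal ((norm (g (x + h) - g x))\<^sup>2) \<partial>lborel)
      \<le> (\<integral>\<^sup>+x. (\<integral>\<^sup>+t. ennreal ((norm h)\<^sup>2) * (ennreal ((N (x + t *\<^sub>R h))\<^sup>2) * indicator {0..1} t) \<partial>lborel) \<partial>lborel)"
    by (intro nn_integral_mono pt)
  also have "\<dots> = (\<integral>\<^sup>+t. (\<integral>\<^sup>+x. ennreal ((norm h)\<^sup>2) * (ennreal ((N (x + t *\<^sub>R h))\<^sup>2) * indicator {0..1} t) \<partial>lborel) \<partial>lborel)"
    by (rule lborel_pair.Fubini') measurable
  also have "\<dots> = (\<integral>\<^sup>+t. ennreal ((norm h)\<^sup>2) * (\<integral>\<^sup>+x. ennreal ((N x)\<^sup>2) \<partial>lborel) * indicator {0..1::real} t \<partial>lborel)"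
  proof (rule nn_integral_cong)
    fix t :: real
    have "(\<integral>\<^sup>+x. ennreal ((norm h)\<^sup>2) * (ennreal ((N (x + t *\<^sub>R h))\<^sup>2) * indicator {0..1} t) \<partial>lborel)
        = ennreal ((norm h)\<^sup>2) * ((\<integral>\<^sup>+x. ennreal ((N (x + t *\<^sub>R h))\<^sup>2) \<partial>lborel) * indicator {0..1} t)"
      by (simp add: nn_integral_cmult nn_integral_multc)
    also have "(\<integral>\<^sup>+x. ennreal ((N (x + t *\<^sub>R h))\<^sup>2) \<partial>lborel) = (\<integral>\<^sup>+x. ennreal ((N x)\<^sup>2) \<partial>lborel)"
      by (intro nn_integral_translation'[where f = "\<lambda>x. ennreal ((N x)\<^sup>2)"]) measurable
    finally show "(\<integral>\<^sup>+x. ennreal ((norm h)\<^sup>2) * (ennreal ((N (x + t *\<^sub>R h))\<^sup>2) * indicator {0..1} t) \<partial>lborel)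
        = ennreal ((norm h)\<^sup>2) * (\<integral>\<^sup>+x. ennreal ((N x)\<^sup>2) \<partial>lborel) * indicator {0..1} t"
      by (simp add: mult.assoc)
  qed
  also have "\<dots> = ennreal ((norm h)\<^sup>2) * (\<integral>\<^sup>+x. ennreal ((N x)\<^sup>2) \<partial>lborel)"
    by (simp add: nn_integral_cmult_indicator)
  finally show ?thesis .
qed

text \<open>Integrate \<open>|g(x + h) - g(x)|\<^sup>2\<close> over \<open>x\<close> and \<open>|h| < l\<close>: for each \<open>x\<close>, at least half of the
  points \<open>x + h\<close> are zeros of \<open>g\<close>.\<close>

lemma faber_krahn:
  fixes g :: "'a::euclidean_space \<Rightarrow> real"
  assumes gm[measurable]: "g \<in> borel_measurable borel" and l: "l > 0"
    and trans: "\<And>h. norm h \<le> l \<Longrightarrow> (\<integral>\<^sup>+x. ennreal ((g (x + h) - g x)\<^sup>2) \<partial>lborel) \<le> ennreal ((norm h)\<^sup>2) * \<Gamma>"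
    and small: "\<And>x. 2 * emeasure lborel ({y. g y \<noteq> 0} \<inter> ball x l) \<le> emeasure lborel (ball (0::'a) l)"
  shows "(\<integral>\<^sup>+x. ennreal ((g x)\<^sup>2) \<partial>lborel) \<le> 2 * ennreal (l\<^sup>2) * \<Gamma>"
proof -
  define b where "b = emeasure lborel (ball (0::'a) l)"
  have ball_shift: "emeasure lborel (ball x l) = b" for x :: 'a
    unfolding b_def using l by (simp add: emeasure_lborel_ball_finite emeasure_ball)
  have b0: "b \<noteq> 0" and bfin: "b \<noteq> \<infinity>"
    unfolding b_def using l emeasure_lborel_ball_finite[of "0::'a" l] unit_ball_vol_pos[of "real DIM('a)"]
    by (auto simp: emeasure_ball simp del: unit_ball_vol_pos)
  have half: "b \<le> 2 * emeasure lborel ({y. g y = 0} \<inter> ball x l)" for x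
  proof -
    have "2 * b = 2 * (emeasure lborel ({y. g y \<noteq> 0} \<inter> ball x l) + emeasure lborel ({y. g y = 0} \<inter> ball x l))"
    proof -
      have "ball x l = ({y. g y \<noteq> 0} \<inter> ball x l) \<union> ({y. g y = 0} \<inter> ball x l)" by auto
      then show ?thesis
        unfolding ball_shift[of x, symmetric] by (subst plus_emeasure) auto
    qed
    also have "\<dots> \<le> b + 2 * emeasure lborel ({y. g y = 0} \<inter> ball x l)"
      using small[of x] unfolding b_def distrib_left by (intro add_right_mono)
    finally have "b + b \<le> b + 2 * emeasure lborel ({y. g y = 0} \<inter> ball x l)" by (simp add: mult_2)
    then show ?thesis using bfin by (simp add: ennreal_add_left_cancel_le)
  qed
  have "b * (\<integral>\<^sup>+x. ennreal ((g x)\<^sup>2) \<partial>lborel) = (\<integral>\<^sup>+x. b * ennreal ((g x)\<^sup>2) \<partial>lborel)"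
    by (simp add: nn_integral_cmult)
  also have "\<dots> \<le> (\<integral>\<^sup>+x. 2 * (\<integral>\<^sup>+h. ennreal ((g (x + h) - g x)\<^sup>2) * indicator (ball 0 l) h \<partial>lborel) \<partial>lborel)"
  proof (rule nn_integral_mono)
    fix x :: 'a
    \<comment> \<open>At a zero \<open>y\<close> of \<open>g\<close> the value
      \<open>(g x)\<^sup>2\<close> is the squared increment from \<open>x\<close> to
      \<open>y\<close>, so integrating over these zeros bounds it by an integral of
      increments.\<close>
    have "b * ennreal ((g x)\<^sup>2) \<le> 2 * (emeasure lborel ({y. g y = 0} \<inter> ball x l) * ennreal ((g x)\<^sup>2))"
      using mult_right_mono[OF half, of "ennreal ((g x)\<^sup>2)" x] by (simp add: mult.assoc)
    also have "emeasure lborel ({y. g y = 0} \<inter> ball x l) * ennreal ((g x)\<^sup>2)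
        = (\<integral>\<^sup>+y. ennreal ((g x)\<^sup>2) * indicator ({y. g y = 0} \<inter> ball x l) y \<partial>lborel)"
      by (subst nn_integral_cmult_indicator) (auto simp: mult.commute)
    also have "\<dots> \<le> (\<integral>\<^sup>+y. ennreal ((g y - g x)\<^sup>2) * indicator (ball x l) y \<partial>lborel)"
      by (intro nn_integral_mono) (auto simp: indicator_def dist_norm norm_minus_commute)
    also have "\<dots> = (\<integral>\<^sup>+h. ennreal ((g (h + x) - g x)\<^sup>2) * indicator (ball x l) (h + x) \<partial>lborel)"
      by (rule nn_integral_translation'[symmetric]) measurable
    finally show "b * ennreal ((g x)\<^sup>2) \<le> 2 * (\<integral>\<^sup>+h. ennreal ((g (x + h) - g x)\<^sup>2) * indicator (ball 0 l) h \<partial>lborel)"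
      by (simp add: add.commute mult_left_mono indicator_def dist_norm)
  qed
  also have "\<dots> = 2 * (\<integral>\<^sup>+x. (\<integral>\<^sup>+h. ennreal ((g (x + h) - g x)\<^sup>2) * indicator (ball 0 l) h \<partial>lborel) \<partial>lborel)"
    by (rule nn_integral_cmult) measurable
  finally have outer: "b * (\<integral>\<^sup>+x. ennreal ((g x)\<^sup>2) \<partial>lborel)
      \<le> 2 * (\<integral>\<^sup>+x. (\<integral>\<^sup>+h. ennreal ((g (x + h) - g x)\<^sup>2) * indicator (ball 0 l) h \<partial>lborel) \<partial>lborel)" .
  have "(\<integral>\<^sup>+x. (\<integral>\<^sup>+h. ennreal ((g (x + h) - g x)\<^sup>2) * indicator (ball 0 l) h \<partial>lborel) \<partial>lborel)
      = (\<integral>\<^sup>+h. (\<integral>\<^sup>+x. ennreal ((g (x + h) - g x)\<^sup>2) * indicator (ball 0 l) h \<partial>lborel) \<partial>lborel)"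
    by (rule lborel_pair.Fubini') measurable
  also have "\<dots> \<le> (\<integral>\<^sup>+h. (ennreal (l\<^sup>2) * \<Gamma>) * indicator (ball (0::'a) l) h \<partial>lborel)"
  proof (rule nn_integral_mono)
    fix h :: 'a
    show "(\<integral>\<^sup>+x. ennreal ((g (x + h) - g x)\<^sup>2) * indicator (ball 0 l) h \<partial>lborel) \<le> (ennreal (l\<^sup>2) * \<Gamma>) * indicator (ball (0::'a) l) h"
    proof (cases "h \<in> ball 0 l")
      case True
      then have "(\<integral>\<^sup>+x. ennreal ((g (x + h) - g x)\<^sup>2) \<partial>lborel) \<le> ennreal ((norm h)\<^sup>2) * \<Gamma>"
        by (intro trans) simp
      also have "\<dots> \<le> ennreal (l\<^sup>2) * \<Gamma>"
        using True by (intro mult_right_mono ennreal_leI power_mono) auto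
      finally show ?thesis using True by simp
    qed simp
  qed
  also have "\<dots> = (ennreal (l\<^sup>2) * \<Gamma>) * b"
    unfolding b_def by (rule nn_integral_cmult_indicator) simp
  finally have "b * (\<integral>\<^sup>+x. ennreal ((g x)\<^sup>2) \<partial>lborel) \<le> 2 * ((ennreal (l\<^sup>2) * \<Gamma>) * b)"
    by (intro order_trans[OF outer] mult_left_mono) simp_all
  then have "b * (\<integral>\<^sup>+x. ennreal ((g x)\<^sup>2) \<partial>lborel) \<le> b * (2 * ennreal (l\<^sup>2) * \<Gamma>)"
    by (simp only: mult_ac)
  then show ?thesis
    using b0 bfin by (simp add: ennreal_mult_le_mult_iff)
qed

section \<open>Sobolev inequality\<close>

text \<open>A continuously differentiable step from 0 at 1 to 1 at 4. It is applied to
  \<open>|\<psi>|\<^sup>2 / t\<^sup>2\<close>, which is differentiable even where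
  \<open>\<psi>\<close> vanishes, so the thresholds correspond to the levels \<open>t\<close> and
  \<open>2 t\<close> of \<open>|\<psi>|\<close>.\<close>

definition smooth_step :: "real \<Rightarrow> real" where
  "smooth_step s = (max 0 (s - 1))\<^sup>2 / ((max 0 (s - 1))\<^sup>2 + (max 0 (4 - s))\<^sup>2)"

definition smooth_step' :: "real \<Rightarrow> real" where
  "smooth_step' s = (2 * max 0 (s - 1) * (max 0 (4 - s))\<^sup>2 + 2 * max 0 (4 - s) * (max 0 (s - 1))\<^sup>2)
    / ((max 0 (s - 1))\<^sup>2 + (max 0 (4 - s))\<^sup>2)\<^sup>2"

text \<open>The two positive parts sum to at least 3, and
  \<open>(a + b)\<^sup>2 \<le> 2 * (a\<^sup>2 + b\<^sup>2)\<close>.\<close>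

lemma smooth_step_denom: "(max 0 (s - 1))\<^sup>2 + (max 0 (4 - s))\<^sup>2 \<ge> (9 / 2 :: real)"
proof -
  have le: "9 \<le> 2 * (a\<^sup>2 + b\<^sup>2)" if "a + b \<ge> 3" for a b :: real
  proof -
    have "9 \<le> (a + b)\<^sup>2" using power_mono[OF that, of 2] by simp
    moreover have "2 * (a\<^sup>2 + b\<^sup>2) - (a + b)\<^sup>2 = (a - b)\<^sup>2" by (simp add: power2_eq_square algebra_simps)
    ultimately show ?thesis using zero_le_power2[of "a - b"] by linarith
  qed
  have "max 0 (s - 1) + max 0 (4 - s) \<ge> 3" by (simp add: max_def)
  from le[OF this] show ?thesis by simp
qed

lemma smooth_step_deriv: "(smooth_step has_real_derivative smooth_step' s) (at s)"
proof -
  let ?D = "(max 0 (s - 1))\<^sup>2 + (max 0 (4 - s))\<^sup>2"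
  have nz: "?D \<noteq> 0" using smooth_step_denom[of s] by linarith
  have A: "((\<lambda>s. (max 0 (s - 1))\<^sup>2) has_real_derivative 2 * max 0 (s - 1) * 1) (at s)"
    by (rule DERIV_chain2[OF DERIV_max_0_power2]) (auto intro!: derivative_eq_intros)
  have B: "((\<lambda>s. (max 0 (4 - s))\<^sup>2) has_real_derivative 2 * max 0 (4 - s) * (-1)) (at s)"
    by (rule DERIV_chain2[OF DERIV_max_0_power2]) (auto intro!: derivative_eq_intros)
  have "((\<lambda>s. (max 0 (s - 1))\<^sup>2 / ((max 0 (s - 1))\<^sup>2 + (max 0 (4 - s))\<^sup>2)) has_real_derivative
      ((2 * max 0 (s - 1) * 1) * ?D - (max 0 (s - 1))\<^sup>2 * (2 * max 0 (s - 1) * 1 + 2 * max 0 (4 - s) * (-1))) / (?D * ?D)) (at s)"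
    by (rule DERIV_divide[OF A DERIV_add[OF A B] nz])
  moreover have "((2 * max 0 (s - 1) * 1) * ?D - (max 0 (s - 1))\<^sup>2 * (2 * max 0 (s - 1) * 1 + 2 * max 0 (4 - s) * (-1))) / (?D * ?D)
      = smooth_step' s"
  proof -
    have "(2 * a * 1) * (a\<^sup>2 + b\<^sup>2) - a\<^sup>2 * (2 * a * 1 + 2 * b * (-1)) = 2 * a * b\<^sup>2 + 2 * b * a\<^sup>2" for a b :: real
      by (simp add: power2_eq_square algebra_simps)
    then show ?thesis unfolding smooth_step'_def power2_eq_square[of ?D] by presburger
  qed
  ultimately show ?thesis by (simp add: smooth_step_def[abs_def])
qed

lemma smooth_step'_bounds:
  "0 \<le> smooth_step' s" "smooth_step' s \<le> 1" "\<not> (1 < s \<and> s < 4) \<Longrightarrow> smooth_step' s = 0"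
proof -
  show "0 \<le> smooth_step' s" unfolding smooth_step'_def by simp
  show z: "smooth_step' s = 0" if "\<not> (1 < s \<and> s < 4)"
    using that by (auto simp: smooth_step'_def not_less max_absorb1)
  show "smooth_step' s \<le> 1"
  proof (cases "1 < s \<and> s < 4")
    case True
    define a b where "a = s - 1" and "b = 4 - s"
    have ab: "a > 0" "b > 0" "a + b = 3" using True by (auto simp: a_def b_def)
    have D: "a\<^sup>2 + b\<^sup>2 \<ge> 9 / 2" using smooth_step_denom[of s] True by (simp add: a_def b_def)
    \<comment> \<open>With \<open>a + b = 3\<close> the numerator equals \<open>6 * a * b\<close>,
      at most 3 times \<open>a\<^sup>2 + b\<^sup>2\<close>; since this sum is itself at least
      \<open>9 / 2\<close>, the factor 3 is absorbed by squaring it.\<close>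
    have "2 * a * b\<^sup>2 + 2 * b * a\<^sup>2 = 2 * a * b * (a + b)" by (simp add: power2_eq_square algebra_simps)
    also have "\<dots> = 3 * (2 * a * b)" using ab by simp
    also have "\<dots> \<le> 3 * (a\<^sup>2 + b\<^sup>2)" using sum_squares_bound[of a b] by simp
    also have "\<dots> \<le> (a\<^sup>2 + b\<^sup>2)\<^sup>2" unfolding power2_eq_square[of "a\<^sup>2 + b\<^sup>2"] using D by (intro mult_right_mono) auto
    finally have "2 * a * b\<^sup>2 + 2 * b * a\<^sup>2 \<le> (a\<^sup>2 + b\<^sup>2)\<^sup>2" .
    moreover have "smooth_step' s = (2 * a * b\<^sup>2 + 2 * b * a\<^sup>2) / (a\<^sup>2 + b\<^sup>2)\<^sup>2"
      using True by (simp add: smooth_step'_def a_def b_def)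
    moreover have "(a\<^sup>2 + b\<^sup>2)\<^sup>2 > 0" using D by (intro zero_less_power) linarith
    ultimately show ?thesis by (simp add: divide_le_eq)
  qed (use z in simp)
qed

lemma smooth_step_values: "s \<le> 1 \<Longrightarrow> smooth_step s = 0" "s \<ge> 4 \<Longrightarrow> smooth_step s = 1"
  by (auto simp: smooth_step_def max_absorb1)

lemma continuous_smooth_step: "continuous_on UNIV smooth_step" "continuous_on UNIV smooth_step'"
proof -
  have nz: "(max 0 (s - 1))\<^sup>2 + (max 0 (4 - s))\<^sup>2 \<noteq> (0::real)" for s :: real
    using smooth_step_denom[of s] by linarith
  show "continuous_on UNIV smooth_step"
    unfolding smooth_step_def[abs_def] by (intro continuous_intros ballI nz)
  show "continuous_on UNIV smooth_step'"
    unfolding smooth_step'_def[abs_def] by (intro continuous_intros ballI power_not_zero nz)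
qed

text \<open>An application of \<open>faber_krahn\<close> to the step function \<open>g\<close>: it
  equals 1 where \<open>|\<psi>| > 2 t\<close>, vanishes where \<open>|\<psi>| \<le> t\<close>, and
  its derivative lives in the shell between, with size at most
  \<open>4 |\<nabla>\<psi>| / t\<close>. The factor 32 is \<open>2 * 4\<^sup>2\<close>.\<close>

lemma sobolev_test_fun_level:
  fixes \<psi> :: "real ^ 'n \<Rightarrow> complex"
  assumes \<psi>: "test_fun \<psi>" and t: "t > 0" and l: "l > 0"
    and small: "2 * emeasure lborel {x. norm (\<psi> x) > t} \<le> emeasure lborel (ball (0 :: real ^ 'n) l)"
  shows "emeasure lborel {x. norm (\<psi> x) > 2 * t}
    \<le> (\<integral>\<^sup>+x. ennreal (if t < norm (\<psi> x) \<and> norm (\<psi> x) < 2 * t then 32 * l\<^sup>2 / t\<^sup>2 * (norm (classical_grad \<psi> x))\<^sup>2 else 0) \<partial>lborel)"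
proof -
  define g where "g x = smooth_step ((norm (\<psi> x))\<^sup>2 / t\<^sup>2)" for x
  define N where "N x = smooth_step' ((norm (\<psi> x))\<^sup>2 / t\<^sup>2) * (2 / t\<^sup>2) * (norm (\<psi> x) * norm (classical_grad \<psi> x))" for x
  note c = test_fun_continuous[OF \<psi>] test_fun_grad_continuous[OF \<psi>]
  have gc: "continuous_on UNIV g"
    unfolding g_def using t by (intro continuous_on_compose2[OF continuous_smooth_step(1)] continuous_intros c) auto
  have Nc: "continuous_on UNIV N"
    unfolding N_def using t
    by (intro continuous_on_mult continuous_on_compose2[OF continuous_smooth_step(2)] continuous_intros c) auto
  note [measurable] = borel_measurable_continuous_onI[OF c(1)] borel_measurable_continuous_onI[OF c(2)]
    borel_measurable_continuous_onI[OF gc] borel_measurable_continuous_onI[OF Nc]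
  have N0: "N x \<ge> 0" for x
    unfolding N_def using smooth_step'_bounds(1) by (intro mult_nonneg_nonneg) auto
  have lev: "(norm (\<psi> x))\<^sup>2 / t\<^sup>2 > 1 \<longleftrightarrow> norm (\<psi> x) > t" "(norm (\<psi> x))\<^sup>2 / t\<^sup>2 < 4 \<longleftrightarrow> norm (\<psi> x) < 2 * t" for x
  proof -
    have "(norm (\<psi> x))\<^sup>2 / t\<^sup>2 > 1 \<longleftrightarrow> t\<^sup>2 < (norm (\<psi> x))\<^sup>2" using t by (simp add: less_divide_eq)
    then show "(norm (\<psi> x))\<^sup>2 / t\<^sup>2 > 1 \<longleftrightarrow> norm (\<psi> x) > t" using t by (simp add: power_mono_iff flip: not_le)
    have "(norm (\<psi> x))\<^sup>2 / t\<^sup>2 < 4 \<longleftrightarrow> (norm (\<psi> x))\<^sup>2 < (2 * t)\<^sup>2" using t by (simp add: divide_less_eq power_mult_distrib)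
    moreover have "(2 * t)\<^sup>2 \<le> (norm (\<psi> x))\<^sup>2 \<longleftrightarrow> 2 * t \<le> norm (\<psi> x)" using t by (intro power_mono_iff) auto
    ultimately show "(norm (\<psi> x))\<^sup>2 / t\<^sup>2 < 4 \<longleftrightarrow> norm (\<psi> x) < 2 * t" by (metis not_le)
  qed
  have der: "(g has_derivative (\<lambda>h. smooth_step' ((norm (\<psi> x))\<^sup>2 / t\<^sup>2) * (2 * (\<psi> x \<bullet> frechet_derivative \<psi> (at x) h) / t\<^sup>2))) (at x)" for x
  proof -
    have D: "(\<psi> has_derivative frechet_derivative \<psi> (at x)) (at x)" by (rule test_fun_has_derivative[OF \<psi>])
    have "((\<lambda>x. (\<psi> x \<bullet> \<psi> x) * (1 / t\<^sup>2)) has_derivative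
        (\<lambda>h. (\<psi> x \<bullet> frechet_derivative \<psi> (at x) h + frechet_derivative \<psi> (at x) h \<bullet> \<psi> x) * (1 / t\<^sup>2))) (at x)"
      by (intro has_derivative_mult_left has_derivative_inner D)
    then have "((\<lambda>x. (norm (\<psi> x))\<^sup>2 / t\<^sup>2) has_derivative (\<lambda>h. 2 * (\<psi> x \<bullet> frechet_derivative \<psi> (at x) h) / t\<^sup>2)) (at x)"
      by (simp add: power2_norm_eq_inner inner_commute)
    from has_derivative_compose[OF this smooth_step_deriv[unfolded has_field_derivative_def]]
    show ?thesis by (simp add: g_def[abs_def])
  qed
  have bound: "norm (smooth_step' ((norm (\<psi> x))\<^sup>2 / t\<^sup>2) * (2 * (\<psi> x \<bullet> frechet_derivative \<psi> (at x) h) / t\<^sup>2)) \<le> norm h * N x" for x h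
  proof -
    have "\<bar>\<psi> x \<bullet> frechet_derivative \<psi> (at x) h\<bar> \<le> norm (\<psi> x) * (norm h * norm (classical_grad \<psi> x))"
      by (rule order_trans[OF Cauchy_Schwarz_ineq2 mult_left_mono[OF norm_frechet_le_classical_grad[OF \<psi>] norm_ge_zero]])
    then have "smooth_step' ((norm (\<psi> x))\<^sup>2 / t\<^sup>2) * (2 / t\<^sup>2) * \<bar>\<psi> x \<bullet> frechet_derivative \<psi> (at x) h\<bar>
        \<le> smooth_step' ((norm (\<psi> x))\<^sup>2 / t\<^sup>2) * (2 / t\<^sup>2) * (norm (\<psi> x) * (norm h * norm (classical_grad \<psi> x)))"
      using smooth_step'_bounds(1) by (intro mult_left_mono mult_nonneg_nonneg) auto
    then show ?thesis
      using smooth_step'_bounds(1) by (simp add: abs_mult N_def mult_ac)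
  qed
  have NN: "(N x)\<^sup>2 \<le> (if t < norm (\<psi> x) \<and> norm (\<psi> x) < 2 * t then 16 / t\<^sup>2 * (norm (classical_grad \<psi> x))\<^sup>2 else 0)" for x
  proof (cases "t < norm (\<psi> x) \<and> norm (\<psi> x) < 2 * t")
    case True
    have "N x \<le> 1 * (2 / t\<^sup>2) * (2 * t * norm (classical_grad \<psi> x))"
      unfolding N_def using True smooth_step'_bounds t by (intro mult_mono mult_nonneg_nonneg) auto
    also have "\<dots> = 4 / t * norm (classical_grad \<psi> x)" using t by (simp add: power2_eq_square)
    finally have "(N x)\<^sup>2 \<le> (4 / t * norm (classical_grad \<psi> x))\<^sup>2" using N0 by (intro power_mono) auto
    then show ?thesis using True by (simp add: power_mult_distrib power_divide)
  next
    case False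
    then have "N x = 0" unfolding N_def using smooth_step'_bounds(3) lev[of x] by auto
    then show ?thesis using False by simp
  qed
  have "emeasure lborel {x. norm (\<psi> x) > 2 * t} = (\<integral>\<^sup>+x. indicator {x. norm (\<psi> x) > 2 * t} x \<partial>lborel)"
    by (rule nn_integral_indicator[symmetric]) simp
  also have "\<dots> \<le> (\<integral>\<^sup>+x. ennreal ((g x)\<^sup>2) \<partial>lborel)"
  proof (intro nn_integral_mono)
    fix x
    show "indicator {x. norm (\<psi> x) > 2 * t} x \<le> ennreal ((g x)\<^sup>2)"
      using lev(2)[of x] smooth_step_values(2) by (auto simp: indicator_def g_def)
  qed
  also have "\<dots> \<le> 2 * ennreal (l\<^sup>2) * (\<integral>\<^sup>+x. ennreal ((N x)\<^sup>2) \<partial>lborel)"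
  proof (rule faber_krahn[OF _ l])
    show "(\<integral>\<^sup>+x. ennreal ((g (x + h) - g x)\<^sup>2) \<partial>lborel) \<le> ennreal ((norm h)\<^sup>2) * (\<integral>\<^sup>+x. ennreal ((N x)\<^sup>2) \<partial>lborel)" for h
      using translation_estimate[OF der bound Nc N0, of h] by simp
    have sub: "{y. g y \<noteq> 0} \<inter> ball x l \<subseteq> {x. norm (\<psi> x) > t}" for x
      using smooth_step_values(1) lev(1) by (auto simp: g_def not_le[symmetric])
    show "2 * emeasure lborel ({y. g y \<noteq> 0} \<inter> ball x l) \<le> emeasure lborel (ball (0 :: real ^ 'n) l)" for x
      by (rule order_trans[OF mult_left_mono[OF emeasure_mono[OF sub]] small]) simp_all
  qed measurable
  also have "\<dots> \<le> 2 * ennreal (l\<^sup>2) * (\<integral>\<^sup>+x. ennreal (if t < norm (\<psi> x) \<and> norm (\<psi> x) < 2 * t then 16 / t\<^sup>2 * (norm (classical_grad \<psi> x))\<^sup>2 else 0) \<partial>lborel)"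
    by (intro mult_left_mono nn_integral_mono ennreal_leI NN) simp
  also have "\<dots> = (\<integral>\<^sup>+x. ennreal (2 * l\<^sup>2) * ennreal (if t < norm (\<psi> x) \<and> norm (\<psi> x) < 2 * t then 16 / t\<^sup>2 * (norm (classical_grad \<psi> x))\<^sup>2 else 0) \<partial>lborel)"
    by (subst nn_integral_cmult) (auto simp: ennreal_mult)
  also have "\<dots> = (\<integral>\<^sup>+x. ennreal (if t < norm (\<psi> x) \<and> norm (\<psi> x) < 2 * t then 32 * l\<^sup>2 / t\<^sup>2 * (norm (classical_grad \<psi> x))\<^sup>2 else 0) \<partial>lborel)"
    by (intro nn_integral_cong) (simp flip: ennreal_mult)
  finally show ?thesis .
qed

text \<open>With \<open>l\<close> chosen so that a ball of radius \<open>l\<close> has volume \<open>2 S t\<^sup>-\<^sup>p\<close>, where \<open>S = \<integral> |\<psi>|\<^sup>p\<close>, the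
  level estimate is multiplied by \<open>t\<^sup>p\<^sup>-\<^sup>1\<close> and integrated over \<open>t\<close>.\<close>

lemma sobolev_test_fun:
  fixes \<psi> :: "real ^ 'n \<Rightarrow> complex"
  assumes \<psi>: "test_fun \<psi>" and d: "CARD('n) \<ge> 3"
  defines "p \<equiv> crit_exp CARD('n)"
    and "C \<equiv> 4 powr crit_exp CARD('n) * 32 * (2 / unit_ball_vol (real CARD('n))) powr (2 / CARD('n))"
  shows "(\<integral>x. norm (\<psi> x) powr p \<partial>lborel)
    \<le> (C * (\<integral>x. (norm (classical_grad \<psi> x))\<^sup>2 \<partial>lborel)) powr (p / 2)"
proof -
  let ?d = "real CARD('n)"
  have p2: "p > 2" unfolding p_def by (rule crit_exp_gt_2[OF d])
  have d3: "?d \<ge> 3" using d by simp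
  \<comment> \<open>The first identity makes the powers of \<open>t\<close> below combine to exactly
    \<open>1 / t\<close>, which is the scale invariance of the critical exponent; the second gives
    the power of \<open>S\<close> left at the end.\<close>
  have pd: "p - 2 * p / ?d = 2" "1 - 2 / ?d = 2 / p"
  proof -
    have "2 * x / (x - 2) - 2 * (2 * x / (x - 2)) / x = 2 \<and> 1 - 2 / x = 2 / (2 * x / (x - 2))"
      if "x \<ge> 3" for x :: real
    proof -
      have "x \<noteq> 0" "x - 2 \<noteq> 0" using that by auto
      then show ?thesis by (simp add: divide_simps)
    qed
    from this[OF d3] show "p - 2 * p / ?d = 2" "1 - 2 / ?d = 2 / p"
      by (simp_all add: p_def crit_exp_def)
  qed
  define \<omega> where "\<omega> = unit_ball_vol ?d"
  have \<omega>: "\<omega> > 0" unfolding \<omega>_def by (rule unit_ball_vol_pos) simp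
  let ?N = "\<lambda>x. norm (classical_grad \<psi> x)"
  note c = test_fun_continuous[OF \<psi>] test_fun_grad_continuous[OF \<psi>]
  note [measurable] = borel_measurable_continuous_onI[OF c(1)] borel_measurable_continuous_onI[OF c(2)]
  define S where "S = (\<integral>x. norm (\<psi> x) powr p \<partial>lborel)"
  define \<gamma> where "\<gamma> = (\<integral>x. (?N x)\<^sup>2 \<partial>lborel)"
  have iS: "integrable lborel (\<lambda>x. norm (\<psi> x) powr p)"
    using test_fun_in_Lp[OF \<psi>, of p] p2 by (simp add: in_Lp_def integrable_lebesgue_iff_lborel)
  have i\<gamma>: "integrable lborel (\<lambda>x. (?N x)\<^sup>2)"
    using classical_grad_in_Lp[OF \<psi>, of 2] by (simp add: in_Lp_2_iff integrable_lebesgue_iff_lborel)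
  have S: "(\<integral>\<^sup>+x. ennreal (norm (\<psi> x) powr p) \<partial>lborel) = ennreal S" and S0: "S \<ge> 0"
    unfolding S_def using iS by (auto intro!: nn_integral_eq_integral integral_nonneg_AE)
  have \<gamma>: "(\<integral>\<^sup>+x. ennreal ((?N x)\<^sup>2) \<partial>lborel) = ennreal \<gamma>" and \<gamma>0: "\<gamma> \<ge> 0"
    unfolding \<gamma>_def using i\<gamma> by (auto intro!: nn_integral_eq_integral integral_nonneg_AE)
  show ?thesis
  proof (cases "S = 0")
    case True
    then show ?thesis unfolding S_def by simp
  next
    case False
    then have Sp: "S > 0" using S0 by simp
    define \<kappa> where "\<kappa> = 32 * (2 * S / \<omega>) powr (2 / ?d)"
    have \<kappa>0: "\<kappa> \<ge> 0" by (simp add: \<kappa>_def)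
    have level: "(\<integral>\<^sup>+x. ennreal (if 0 < t \<and> 2 * t < norm (\<psi> x) then t powr (p - 1) else 0) \<partial>lborel)
        \<le> (\<integral>\<^sup>+x. ennreal (if 0 < t \<and> t < norm (\<psi> x) \<and> norm (\<psi> x) < 2 * t then \<kappa> * (?N x)\<^sup>2 / t else 0) \<partial>lborel)" for t :: real
    proof (cases "t > 0")
      case t: True
      define l where "l = (2 * S / \<omega> * t powr - p) powr (1 / ?d)"
      have arg: "2 * S / \<omega> * t powr - p > 0" using Sp \<omega> t by simp
      have l: "l > 0" unfolding l_def powr_gt_zero using arg by linarith
      have ld: "\<omega> * l ^ CARD('n) = 2 * S * t powr - p"
      proof -
        have "l ^ CARD('n) = l powr ?d" using l by (simp add: powr_realpow)
        also have "\<dots> = 2 * S / \<omega> * t powr - p"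
        proof -
          have "(a powr (1 / ?d)) powr ?d = a" if "a > 0" for a
            using that d3 by (simp add: powr_powr)
          from this[OF arg] show ?thesis by (simp only: l_def)
        qed
        finally show ?thesis using \<omega> by simp
      qed
      have l2: "l\<^sup>2 = (2 * S / \<omega>) powr (2 / ?d) * t powr (- 2 * p / ?d)"
      proof -
        have "l\<^sup>2 = l powr 2" using l by (simp add: powr_numeral)
        also have "\<dots> = (2 * S / \<omega> * t powr - p) powr (2 / ?d)" by (simp add: l_def powr_powr)
        also have "\<dots> = (2 * S / \<omega>) powr (2 / ?d) * (t powr - p) powr (2 / ?d)"
          by (rule powr_mult)
        finally show ?thesis by (simp add: powr_powr mult.commute)
      qed
      have markov: "emeasure lborel {x. norm (\<psi> x) > t} \<le> ennreal (S * t powr - p)"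
      proof -
        have "emeasure lborel {x. norm (\<psi> x) > t} = (\<integral>\<^sup>+x. indicator {x. norm (\<psi> x) > t} x \<partial>lborel)"
          by (rule nn_integral_indicator[symmetric]) simp
        also have "\<dots> \<le> (\<integral>\<^sup>+x. ennreal (t powr - p) * ennreal (norm (\<psi> x) powr p) \<partial>lborel)"
        proof (rule nn_integral_mono)
          fix x
          show "indicator {x. norm (\<psi> x) > t} x \<le> ennreal (t powr - p) * ennreal (norm (\<psi> x) powr p)"
          proof (cases "norm (\<psi> x) > t")
            case True
            then have "t powr p \<le> norm (\<psi> x) powr p" using t p2 by (intro powr_mono2) auto
            then have "1 \<le> t powr - p * norm (\<psi> x) powr p"
              using t by (simp add: powr_minus field_simps)
            then have "ennreal 1 \<le> ennreal (t powr - p * norm (\<psi> x) powr p)" by (rule ennreal_leI)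
            then show ?thesis using True by (simp add: ennreal_mult)
          qed simp
        qed
        also have "\<dots> = ennreal (S * t powr - p)"
          using S0 by (subst nn_integral_cmult) (auto simp: S ennreal_mult mult.commute)
        finally show ?thesis .
      qed
      have small: "2 * emeasure lborel {x. norm (\<psi> x) > t} \<le> emeasure lborel (ball (0 :: real ^ 'n) l)"
      proof -
        have "emeasure lborel (ball (0 :: real ^ 'n) l) = ennreal (\<omega> * l ^ CARD('n))"
          unfolding \<omega>_def using l by (subst emeasure_ball) auto
        also have "\<dots> = 2 * ennreal (S * t powr - p)"
          unfolding ld using S0 by (simp add: ennreal_mult mult.assoc)
        finally show ?thesis using mult_left_mono[OF markov, of 2] by simp
      qed
      have "(\<integral>\<^sup>+x. ennreal (if 0 < t \<and> 2 * t < norm (\<psi> x) then t powr (p - 1) else 0) \<partial>lborel)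
          = (\<integral>\<^sup>+x. ennreal (t powr (p - 1)) * indicator {x. norm (\<psi> x) > 2 * t} x \<partial>lborel)"
        using t by (intro nn_integral_cong) (simp add: indicator_def)
      also have "\<dots> = ennreal (t powr (p - 1)) * emeasure lborel {x. norm (\<psi> x) > 2 * t}"
        by (rule nn_integral_cmult_indicator) simp
      also have "\<dots> \<le> ennreal (t powr (p - 1)) * (\<integral>\<^sup>+x. ennreal (if t < norm (\<psi> x) \<and> norm (\<psi> x) < 2 * t then 32 * l\<^sup>2 / t\<^sup>2 * (?N x)\<^sup>2 else 0) \<partial>lborel)"
        by (intro mult_left_mono sobolev_test_fun_level[OF \<psi> t l small]) simp
      also have "\<dots> = (\<integral>\<^sup>+x. ennreal (t powr (p - 1)) * ennreal (if t < norm (\<psi> x) \<and> norm (\<psi> x) < 2 * t then 32 * l\<^sup>2 / t\<^sup>2 * (?N x)\<^sup>2 else 0) \<partial>lborel)"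
        by (rule nn_integral_cmult[symmetric]) measurable
      also have "\<dots> = (\<integral>\<^sup>+x. ennreal (if 0 < t \<and> t < norm (\<psi> x) \<and> norm (\<psi> x) < 2 * t then \<kappa> * (?N x)\<^sup>2 / t else 0) \<partial>lborel)"
      proof (rule nn_integral_cong)
        fix x
        have "t powr (p - 1) * (32 * l\<^sup>2 / t\<^sup>2 * (?N x)\<^sup>2) = \<kappa> * (?N x)\<^sup>2 / t"
        proof -
          have "t powr (p - 1) * t powr (- 2 * p / ?d) / t\<^sup>2 = t powr (p - 1) * t powr (- 2 * p / ?d) * t powr (- 2)"
            using t by (simp add: powr_minus powr_numeral divide_inverse)
          also have "\<dots> = t powr ((p - 1) + (- 2 * p / ?d) + - 2)" by (simp only: powr_add)
          also have "(p - 1) + (- 2 * p / ?d) + - 2 = - 1" using pd(1) by simp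
          finally have "t powr (p - 1) * t powr (- 2 * p / ?d) / t\<^sup>2 = 1 / t"
            using t by (simp add: powr_minus divide_inverse)
          then have "(32 * (2 * S / \<omega>) powr (2 / ?d) * (?N x)\<^sup>2) * (t powr (p - 1) * t powr (- 2 * p / ?d) / t\<^sup>2)
             = (32 * (2 * S / \<omega>) powr (2 / ?d) * (?N x)\<^sup>2) * (1 / t)" by (simp only:)
          then show ?thesis unfolding l2 \<kappa>_def by (simp add: mult_ac)
        qed
        then show "ennreal (t powr (p - 1)) * ennreal (if t < norm (\<psi> x) \<and> norm (\<psi> x) < 2 * t then 32 * l\<^sup>2 / t\<^sup>2 * (?N x)\<^sup>2 else 0)
          = ennreal (if 0 < t \<and> t < norm (\<psi> x) \<and> norm (\<psi> x) < 2 * t then \<kappa> * (?N x)\<^sup>2 / t else 0)"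
          using t by (simp flip: ennreal_mult')
      qed
      finally show ?thesis .
    qed simp
    \<comment> \<open>Only levels between \<open>norm (\<psi> x) / 4\<close> and
      \<open>norm (\<psi> x) / 2\<close> are kept; there \<open>t powr (p - 1)\<close> is at least
      its value at the left end, and the interval has length
      \<open>norm (\<psi> x) / 4\<close>.\<close>
    have lower: "ennreal ((norm (\<psi> x) / 4) powr p) \<le> (\<integral>\<^sup>+t. ennreal (if 0 < t \<and> 2 * t < norm (\<psi> x) then t powr (p - 1) else 0) \<partial>lborel)" for x
    proof (cases "\<psi> x = 0")
      case False
      let ?n = "norm (\<psi> x)"
      have n: "?n > 0" using False by simp
      have "ennreal ((?n / 4) powr p) = ennreal ((?n / 4) powr (p - 1)) * ennreal (?n / 4)"
        using n by (simp add: powr_diff flip: ennreal_mult)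
      also have "\<dots> = ennreal ((?n / 4) powr (p - 1)) * emeasure lborel {?n / 4 <..< ?n / 2}"
        using n by (simp add: emeasure_lborel_Ioo field_simps)
      also have "\<dots> = (\<integral>\<^sup>+t. ennreal ((?n / 4) powr (p - 1)) * indicator {?n / 4 <..< ?n / 2} t \<partial>lborel)"
        by (rule nn_integral_cmult_indicator[symmetric]) simp
      also have "\<dots> \<le> (\<integral>\<^sup>+t. ennreal (if 0 < t \<and> 2 * t < ?n then t powr (p - 1) else 0) \<partial>lborel)"
      proof (rule nn_integral_mono)
        fix t
        show "ennreal ((?n / 4) powr (p - 1)) * indicator {?n / 4 <..< ?n / 2} t \<le> ennreal (if 0 < t \<and> 2 * t < ?n then t powr (p - 1) else 0)"
        proof (cases "t \<in> {?n / 4 <..< ?n / 2}")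
          case True
          then have "t > ?n / 4" by simp
          moreover have "?n / 4 > 0" using n by simp
          ultimately have "t > 0" by linarith
          then show ?thesis using True n p2 by (auto intro!: ennreal_leI powr_mono2)
        qed simp
      qed
      finally show ?thesis .
    qed simp
    \<comment> \<open>For fixed \<open>x\<close> the contributing levels form an interval of length
      \<open>norm (\<psi> x) / 2\<close> on which \<open>1 / t\<close> is at most
      \<open>2 / norm (\<psi> x)\<close>, so the integral of \<open>1 / t\<close> is at most
      1.\<close>
    have upper: "(\<integral>\<^sup>+t. ennreal (if 0 < t \<and> t < norm (\<psi> x) \<and> norm (\<psi> x) < 2 * t then \<kappa> * (?N x)\<^sup>2 / t else 0) \<partial>lborel) \<le> ennreal \<kappa> * ennreal ((?N x)\<^sup>2)" for x
    proof (cases "\<psi> x = 0")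
      case False
      let ?n = "norm (\<psi> x)" and ?a = "\<kappa> * (?N x)\<^sup>2"
      have n: "?n > 0" using False by simp
      have "(\<integral>\<^sup>+t. ennreal (if 0 < t \<and> t < ?n \<and> ?n < 2 * t then ?a / t else 0) \<partial>lborel)
          \<le> (\<integral>\<^sup>+t. ennreal (?a * 2 / ?n) * indicator {?n / 2 <..< ?n} t \<partial>lborel)"
      proof (rule nn_integral_mono)
        fix t
        show "ennreal (if 0 < t \<and> t < ?n \<and> ?n < 2 * t then ?a / t else 0) \<le> ennreal (?a * 2 / ?n) * indicator {?n / 2 <..< ?n} t"
        proof (cases "0 < t \<and> t < ?n \<and> ?n < 2 * t")
          case True
          then have "?n * ?a \<le> (2 * t) * ?a" using \<kappa>0 by (intro mult_right_mono) auto
          then have "?a / t \<le> ?a * 2 / ?n" using True n by (simp add: field_simps)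
          then show ?thesis using True by (auto intro!: ennreal_leI)
        next
          case False
          then show ?thesis by (subst if_not_P) simp_all
        qed
      qed
      also have "\<dots> = ennreal (?a * 2 / ?n) * emeasure lborel {?n / 2 <..< ?n}"
        by (rule nn_integral_cmult_indicator) simp
      also have "\<dots> = ennreal (?a * 2 / ?n) * ennreal (?n / 2)" using n by (simp add: emeasure_lborel_Ioo)
      also have "\<dots> = ennreal \<kappa> * ennreal ((?N x)\<^sup>2)" using n \<kappa>0 by (simp flip: ennreal_mult)
      finally show ?thesis .
    next
      case True
      then have "(if 0 < t \<and> t < norm (\<psi> x) \<and> norm (\<psi> x) < 2 * t then \<kappa> * (?N x)\<^sup>2 / t else 0) = 0" for t
        by (subst if_not_P) auto
      then show ?thesis by (simp only: ennreal_0 nn_integral_const mult_zero_left zero_le)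
    qed
    have "ennreal (S / 4 powr p) = (\<integral>\<^sup>+x. ennreal (1 / 4 powr p) * ennreal (norm (\<psi> x) powr p) \<partial>lborel)"
      using S0 by (subst nn_integral_cmult) (auto simp: S simp flip: ennreal_mult)
    also have "\<dots> = (\<integral>\<^sup>+x. ennreal ((norm (\<psi> x) / 4) powr p) \<partial>lborel)"
      by (intro nn_integral_cong) (simp add: powr_divide flip: ennreal_mult)
    also have "\<dots> \<le> (\<integral>\<^sup>+x. (\<integral>\<^sup>+t. ennreal (if 0 < t \<and> 2 * t < norm (\<psi> x) then t powr (p - 1) else 0) \<partial>lborel) \<partial>lborel)"
      by (intro nn_integral_mono lower)
    also have "\<dots> = (\<integral>\<^sup>+t. (\<integral>\<^sup>+x. ennreal (if 0 < t \<and> 2 * t < norm (\<psi> x) then t powr (p - 1) else 0) \<partial>lborel) \<partial>lborel)"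
      by (rule lborel_pair.Fubini') measurable
    also have "\<dots> \<le> (\<integral>\<^sup>+t. (\<integral>\<^sup>+x. ennreal (if 0 < t \<and> t < norm (\<psi> x) \<and> norm (\<psi> x) < 2 * t then \<kappa> * (?N x)\<^sup>2 / t else 0) \<partial>lborel) \<partial>lborel)"
      by (intro nn_integral_mono level)
    also have "\<dots> = (\<integral>\<^sup>+x. (\<integral>\<^sup>+t. ennreal (if 0 < t \<and> t < norm (\<psi> x) \<and> norm (\<psi> x) < 2 * t then \<kappa> * (?N x)\<^sup>2 / t else 0) \<partial>lborel) \<partial>lborel)"
      by (rule lborel_pair.Fubini') measurable
    also have "\<dots> \<le> (\<integral>\<^sup>+x. ennreal \<kappa> * ennreal ((?N x)\<^sup>2) \<partial>lborel)"
      by (intro nn_integral_mono upper)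
    also have "\<dots> = ennreal (\<kappa> * \<gamma>)"
      using \<kappa>0 \<gamma>0 by (subst nn_integral_cmult) (auto simp: \<gamma> ennreal_mult)
    finally have "S / 4 powr p \<le> \<kappa> * \<gamma>"
      using \<kappa>0 \<gamma>0 by simp
    then have "S \<le> 4 powr p * (\<kappa> * \<gamma>)" by (simp add: divide_le_eq mult.commute)
    also have "\<kappa> = 32 * ((2 / \<omega>) powr (2 / ?d) * S powr (2 / ?d))"
      unfolding \<kappa>_def using Sp \<omega> powr_mult[of "2 / \<omega>" S "2 / ?d"] by simp
    \<comment> \<open>\<open>\<kappa>\<close> contains \<open>S powr (2 / d)\<close> through the
      choice of \<open>l\<close>. As \<open>S\<close> is a positive real number, this power is
      absorbed on the left and \<open>S powr (2 / p)\<close> remains.\<close>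
    finally have "S \<le> C * \<gamma> * S powr (2 / ?d)"
      unfolding C_def \<omega>_def p_def by (simp add: mult_ac)
    then have "S / S powr (2 / ?d) \<le> C * \<gamma>" using Sp by (simp add: divide_le_eq)
    moreover have "S / S powr (2 / ?d) = S powr (2 / p)"
      using Sp by (simp add: powr_diff flip: pd(2))
    ultimately have "(S powr (2 / p)) powr (p / 2) \<le> (C * \<gamma>) powr (p / 2)"
      using p2 by (intro powr_mono2) auto
    then show ?thesis
      using p2 Sp unfolding S_def \<gamma>_def by (simp add: powr_powr)
  qed
qed

section \<open>Passing estimates to limits of test functions\<close>

lemma AE_translation:
  fixes P :: "'a::euclidean_space \<Rightarrow> bool"
  assumes "AE x in lborel. P x"
  shows "AE x in lborel. P (x + h)"
proof -
  obtain M where M: "{x \<in> space lborel. \<not> P x} \<subseteq> M" "emeasure lborel M = 0" "M \<in> sets lborel"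
    using assms by (rule AE_E)
  have Mb[measurable]: "M \<in> sets borel" using M(3) by simp
  have "(\<integral>\<^sup>+x. indicator M (x + h) \<partial>lborel) = (\<integral>\<^sup>+x. indicator M x \<partial>lborel)"
    by (rule nn_integral_translation') simp
  also have "\<dots> = 0" using M by simp
  finally have "AE x in lborel. (indicator M (x + h) :: ennreal) = 0"
    by (subst (asm) nn_integral_0_iff_AE) measurable
  then show ?thesis
    by eventually_elim (use M(1) in \<open>auto simp: indicator_eq_0_iff\<close>)
qed

lemma Fatou_AE:
  fixes f :: "nat \<Rightarrow> 'a \<Rightarrow> real"
  assumes "\<And>j. f j \<in> borel_measurable M" and lim: "AE x in M. (\<lambda>j. f j x) \<longlonglongrightarrow> g x"
    and le: "\<And>j. (\<integral>\<^sup>+x. ennreal (f j x) \<partial>M) \<le> ennreal (c j)" and c: "c \<longlonglongrightarrow> c'"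
  shows "(\<integral>\<^sup>+x. ennreal (g x) \<partial>M) \<le> ennreal c'"
proof -
  have "(\<integral>\<^sup>+x. ennreal (g x) \<partial>M) = (\<integral>\<^sup>+x. liminf (\<lambda>j. ennreal (f j x)) \<partial>M)"
  proof (rule nn_integral_cong_AE)
    show "AE x in M. ennreal (g x) = liminf (\<lambda>j. ennreal (f j x))"
      using lim by eventually_elim (intro lim_imp_Liminf[symmetric] tendsto_ennrealI; simp)
  qed
  also have "\<dots> \<le> liminf (\<lambda>j. \<integral>\<^sup>+x. ennreal (f j x) \<partial>M)"
    using assms(1) by (intro nn_integral_liminf) measurable
  also have "\<dots> \<le> liminf (\<lambda>j. ennreal (c j))"
    using le by (intro Liminf_mono) auto
  also have "\<dots> = ennreal c'"
    using c by (intro lim_imp_Liminf tendsto_ennrealI) auto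
  finally show ?thesis .
qed

section \<open>The large part of a function in \<open>D\<^sup>1\<^sup>,\<^sup>2\<close>\<close>

text \<open>The first term tends to zero along an approximating sequence, so gradient bounds survive
  the approximation up to a factor 2; this is the 2 in front of \<open>C\<close> in the Sobolev
  inequality for \<open>D12\<close>.\<close>

lemma grad_approx_bound:
  fixes u :: "real ^ 'n \<Rightarrow> complex"
  assumes D: "D12_grad u G" and \<psi>: "test_fun \<psi>" and L: "in_Lp 2 (\<lambda>x. classical_grad \<psi> x - G x)"
  shows "(\<integral>x. (norm (classical_grad \<psi> x))\<^sup>2 \<partial>lborel)
    \<le> 2 * (\<integral>x. (norm (classical_grad \<psi> x - G x))\<^sup>2 \<partial>lebesgue) + 2 * (\<integral>x. (norm (G x))\<^sup>2 \<partial>lebesgue)"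
proof -
  have i: "integrable lebesgue (\<lambda>x. (norm (classical_grad \<psi> x - G x))\<^sup>2)" "integrable lebesgue (\<lambda>x. (norm (G x))\<^sup>2)"
    "integrable lebesgue (\<lambda>x. (norm (classical_grad \<psi> x))\<^sup>2)"
    using L D classical_grad_in_Lp[OF \<psi>, of 2] by (auto simp: D12_grad_def in_Lp_2_iff)
  have "(\<lambda>x. (norm (classical_grad \<psi> x))\<^sup>2) \<in> borel_measurable borel"
    by (intro borel_measurable_continuous_onI continuous_intros test_fun_grad_continuous \<psi>)
  then have "(\<integral>x. (norm (classical_grad \<psi> x))\<^sup>2 \<partial>lborel) = (\<integral>x. (norm (classical_grad \<psi> x))\<^sup>2 \<partial>lebesgue)"
    by (rule integral_lebesgue_eq_lborel[symmetric])
  also have "\<dots> \<le> (\<integral>x. 2 * (norm (classical_grad \<psi> x - G x))\<^sup>2 + 2 * (norm (G x))\<^sup>2 \<partial>lebesgue)"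
  proof (rule integral_mono)
    show "(norm (classical_grad \<psi> x))\<^sup>2 \<le> 2 * (norm (classical_grad \<psi> x - G x))\<^sup>2 + 2 * (norm (G x))\<^sup>2" for x
      using norm_add_power2_le[of "classical_grad \<psi> x - G x" "G x"] by simp
  qed (use i in auto)
  also have "\<dots> = 2 * (\<integral>x. (norm (classical_grad \<psi> x - G x))\<^sup>2 \<partial>lebesgue) + 2 * (\<integral>x. (norm (G x))\<^sup>2 \<partial>lebesgue)"
    using i by simp
  finally show ?thesis .
qed

lemma sobolev_D12:
  fixes u :: "real ^ 'n \<Rightarrow> complex"
  assumes D: "D12_grad u G" and d: "CARD('n) \<ge> 3"
  defines "p \<equiv> crit_exp CARD('n)"
    and "C \<equiv> 4 powr crit_exp CARD('n) * 32 * (2 / unit_ball_vol (real CARD('n))) powr (2 / CARD('n))"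
  shows "(\<integral>x. norm (u x) powr p \<partial>lebesgue) \<le> (2 * C * (\<integral>x. (norm (G x))\<^sup>2 \<partial>lebesgue)) powr (p / 2)"
proof -
  have p2: "p > 2" unfolding p_def by (rule crit_exp_gt_2[OF d])
  have C: "C \<ge> 0" by (simp add: C_def unit_ball_vol_nonneg)
  define \<gamma> where "\<gamma> = (\<integral>x. (norm (G x))\<^sup>2 \<partial>lebesgue)"
  obtain \<psi> where "D12_approx u G \<psi>"
    by (rule D12_grad_approx[OF D d])
  note \<psi> = D12_approxD[OF this]
  define e where "e j = (\<integral>x. (norm (classical_grad (\<psi> j) x - G x))\<^sup>2 \<partial>lebesgue)" for j
  have "(\<integral>\<^sup>+x. ennreal (norm (u x) powr p) \<partial>lebesgue) \<le> ennreal ((C * (2 * 0 + 2 * \<gamma>)) powr (p / 2))"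
  proof (rule Fatou_AE)
    show "(\<lambda>x. norm (\<psi> j x) powr p) \<in> borel_measurable lebesgue" for j
      using test_fun_in_Lp[OF \<psi>(1), of p] p2 by (auto simp: in_Lp_def)
    show "AE x in lebesgue. (\<lambda>j. norm (\<psi> j x) powr p) \<longlonglongrightarrow> norm (u x) powr p"
      using \<psi>(6) by eventually_elim (use p2 in \<open>intro tendsto_powr' tendsto_norm tendsto_const; simp\<close>)
    show "(\<lambda>j. (C * (2 * e j + 2 * \<gamma>)) powr (p / 2)) \<longlonglongrightarrow> (C * (2 * 0 + 2 * \<gamma>)) powr (p / 2)"
    proof (rule tendsto_powr')
      show "(\<lambda>j. C * (2 * e j + 2 * \<gamma>)) \<longlonglongrightarrow> C * (2 * 0 + 2 * \<gamma>)"
        unfolding e_def by (intro tendsto_intros \<psi>)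
    qed (use p2 C in \<open>auto intro!: always_eventually mult_nonneg_nonneg add_nonneg_nonneg integral_nonneg_AE simp: e_def \<gamma>_def\<close>)
    show "(\<integral>\<^sup>+x. ennreal (norm (\<psi> j x) powr p) \<partial>lebesgue) \<le> ennreal ((C * (2 * e j + 2 * \<gamma>)) powr (p / 2))" for j
    proof -
      have i: "integrable lebesgue (\<lambda>x. norm (\<psi> j x) powr p)"
        using test_fun_in_Lp[OF \<psi>(1), of p] p2 by (auto simp: in_Lp_def)
      have m: "(\<lambda>x. norm (\<psi> j x) powr p) \<in> borel_measurable borel"
        using borel_measurable_continuous_onI[OF test_fun_continuous[OF \<psi>(1)]] by measurable
      have "(\<integral>\<^sup>+x. ennreal (norm (\<psi> j x) powr p) \<partial>lebesgue) = ennreal (\<integral>x. norm (\<psi> j x) powr p \<partial>lborel)"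
        using i m by (subst nn_integral_eq_integral) (auto simp: integral_lebesgue_eq_lborel)
      also have "\<dots> \<le> ennreal ((C * (\<integral>x. (norm (classical_grad (\<psi> j) x))\<^sup>2 \<partial>lborel)) powr (p / 2))"
        unfolding p_def C_def by (intro ennreal_leI sobolev_test_fun[OF \<psi>(1) d])
      also have "\<dots> \<le> ennreal ((C * (2 * e j + 2 * \<gamma>)) powr (p / 2))"
        unfolding e_def \<gamma>_def using p2 C grad_approx_bound[OF D \<psi>(1) \<psi>(5)]
        by (intro ennreal_leI powr_mono2 mult_left_mono) (auto intro!: mult_nonneg_nonneg integral_nonneg_AE)
      finally show ?thesis .
    qed
  qed
  moreover have "integrable lebesgue (\<lambda>x. norm (u x) powr p)"
    using D by (auto simp: D12_grad_def in_Lp_def p_def)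
  ultimately have "(\<integral>x. norm (u x) powr p \<partial>lebesgue) \<le> (C * (2 * 0 + 2 * \<gamma>)) powr (p / 2)"
    by (subst (asm) nn_integral_eq_integral) auto
  then show ?thesis unfolding \<gamma>_def by (simp add: mult_ac)
qed

text \<open>Translation invariance and Fubini's theorem are applied for \<open>lborel\<close>,
  whereas elements of \<open>D12\<close> are Lebesgue measurable; a Borel representative bridges the
  two.\<close>

lemma complex_borel_representative:
  fixes u :: "'a \<Rightarrow> complex"
  assumes "u \<in> borel_measurable (completion M)"
  obtains u' where "u' \<in> borel_measurable M" "AE x in M. u x = u' x"
proof -
  have re: "(\<lambda>x. Re (u x)) \<in> borel_measurable (completion M)" and im: "(\<lambda>x. Im (u x)) \<in> borel_measurable (completion M)"
    using measurable_compose[OF assms, of Re borel] measurable_compose[OF assms, of Im borel]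
      borel_measurable_continuous_onI[OF continuous_on_Re[OF continuous_on_id]]
      borel_measurable_continuous_onI[OF continuous_on_Im[OF continuous_on_id]] by blast+
  obtain a where a: "a \<in> borel_measurable M" "AE x in M. Re (u x) = a x"
    using completion_ex_borel_measurable_real[OF re] by blast
  obtain b where b: "b \<in> borel_measurable M" "AE x in M. Im (u x) = b x"
    using completion_ex_borel_measurable_real[OF im] by blast
  show ?thesis
  proof
    show "(\<lambda>x. complex_of_real (a x) + \<i> * complex_of_real (b x)) \<in> borel_measurable M"
      using a(1) b(1) by measurable
    show "AE x in M. u x = complex_of_real (a x) + \<i> * complex_of_real (b x)"
      using a(2) b(2) by eventually_elim (simp add: complex_eq_iff)
  qed
qed

text \<open>If \<open>|u|\<close> exceeds \<open>\<delta>\<close> only on a set occupying at most half of every ball of radius \<open>l\<close>, then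
  \<open>(|u| - \<delta>)\<^sub>+\<close> satisfies a Poincare inequality on these balls with constant of order \<open>l\<close>.\<close>

lemma D12_large_part:
  fixes u :: "real ^ 'n \<Rightarrow> complex"
  assumes D: "D12_grad u G" and d: "CARD('n) \<ge> 3" and \<delta>: "\<delta> > 0" and l: "0 < l" "l \<le> 1"
    and small: "\<And>y. 2 * (\<integral>\<^sup>+x\<in>ball y 1. ennreal ((cmod (u x))\<^sup>2) \<partial>lebesgue)
      \<le> ennreal (\<delta>\<^sup>2) * emeasure lborel (ball (0 :: real ^ 'n) l)"
  shows "(\<integral>\<^sup>+x. ennreal ((cmod (u x))\<^sup>2 * indicator {2 * \<delta><..} (cmod (u x))) \<partial>lebesgue)
    \<le> ennreal (16 * l\<^sup>2 * (\<integral>x. (norm (G x))\<^sup>2 \<partial>lebesgue))"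
proof -
  define \<gamma> where "\<gamma> = (\<integral>x. (norm (G x))\<^sup>2 \<partial>lebesgue)"
  have \<gamma>0: "\<gamma> \<ge> 0" unfolding \<gamma>_def by (intro integral_nonneg_AE) auto
  obtain \<psi> where "D12_approx u G \<psi>"
    by (rule D12_grad_approx[OF D d])
  note \<psi> = D12_approxD[OF this]
  have um: "u \<in> borel_measurable lebesgue"
    using D by (auto simp: D12_grad_def in_Lp_def)
  obtain v where v: "v \<in> borel_measurable lborel" "AE x in lborel. u x = v x"
    using complex_borel_representative[OF um] .
  have [measurable]: "v \<in> borel_measurable borel" using v(1) by simp
  have ae: "AE x in lebesgue. u x = v x" using v(2) by (rule AE_completion)
  have lim: "AE x in lborel. (\<lambda>j. \<psi> j x) \<longlonglongrightarrow> v x"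
  proof -
    have "AE x in lborel. (\<lambda>j. \<psi> j x) \<longlonglongrightarrow> u x" using \<psi>(6) by (simp add: AE_completion_iff)
    then show ?thesis using v(2) by eventually_elim simp
  qed
  define e where "e j = (\<integral>x. (norm (classical_grad (\<psi> j) x - G x))\<^sup>2 \<partial>lebesgue)" for j
  \<comment> \<open>The translation estimate for the limit, by Fatou's lemma; the term
    \<open>2 * 0\<close> is the limit of \<open>2 * e j\<close>.\<close>
  have trans_v: "(\<integral>\<^sup>+x. ennreal ((norm (v (x + h) - v x))\<^sup>2) \<partial>lborel) \<le> ennreal ((norm h)\<^sup>2 * (2 * 0 + 2 * \<gamma>))" for h
  proof (rule Fatou_AE)
    note [measurable] = borel_measurable_continuous_onI[OF test_fun_continuous[OF \<psi>(1)]]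
    show "(\<lambda>x. (norm (\<psi> j (x + h) - \<psi> j x))\<^sup>2) \<in> borel_measurable lborel" for j by measurable
    show "AE x in lborel. (\<lambda>j. (norm (\<psi> j (x + h) - \<psi> j x))\<^sup>2) \<longlonglongrightarrow> (norm (v (x + h) - v x))\<^sup>2"
      using lim AE_translation[OF lim] by eventually_elim (intro tendsto_intros)
    show "(\<lambda>j. (norm h)\<^sup>2 * (2 * e j + 2 * \<gamma>)) \<longlonglongrightarrow> (norm h)\<^sup>2 * (2 * 0 + 2 * \<gamma>)"
      unfolding e_def by (intro tendsto_intros \<psi>)
    show "(\<integral>\<^sup>+x. ennreal ((norm (\<psi> j (x + h) - \<psi> j x))\<^sup>2) \<partial>lborel) \<le> ennreal ((norm h)\<^sup>2 * (2 * e j + 2 * \<gamma>))" for j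
    proof -
      have i: "integrable lborel (\<lambda>x. (norm (classical_grad (\<psi> j) x))\<^sup>2)"
      proof -
        have "(\<lambda>x. (norm (classical_grad (\<psi> j) x))\<^sup>2) \<in> borel_measurable borel"
          by (intro borel_measurable_continuous_onI continuous_intros test_fun_grad_continuous \<psi>)
        then show ?thesis
          using classical_grad_in_Lp[OF \<psi>(1), of 2 j] by (simp add: in_Lp_2_iff integrable_lebesgue_iff_lborel)
      qed
      have "(\<integral>\<^sup>+x. ennreal ((norm (\<psi> j (x + h) - \<psi> j x))\<^sup>2) \<partial>lborel)
          \<le> ennreal ((norm h)\<^sup>2) * (\<integral>\<^sup>+x. ennreal ((norm (classical_grad (\<psi> j) x))\<^sup>2) \<partial>lborel)"
        by (intro translation_estimate[OF test_fun_has_derivative[OF \<psi>(1)] norm_frechet_le_classical_grad[OF \<psi>(1)]]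
            continuous_intros test_fun_grad_continuous \<psi>) simp
      also have "\<dots> = ennreal ((norm h)\<^sup>2) * ennreal (\<integral>x. (norm (classical_grad (\<psi> j) x))\<^sup>2 \<partial>lborel)"
        using i by (subst nn_integral_eq_integral) auto
      also have "\<dots> \<le> ennreal ((norm h)\<^sup>2) * ennreal (2 * e j + 2 * \<gamma>)"
        unfolding e_def \<gamma>_def by (intro mult_left_mono ennreal_leI grad_approx_bound[OF D \<psi>(1) \<psi>(5)]) simp
      finally show ?thesis by (simp add: ennreal_mult')
    qed
  qed
  \<comment> \<open>As a 1-Lipschitz function of \<open>v\<close>, \<open>g\<close> inherits the
    translation estimate directly, without being differentiated.\<close>
  define g where "g x = max 0 (norm (v x) - \<delta>)" for x
  have gm[measurable]: "g \<in> borel_measurable borel" unfolding g_def by measurable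
  have "(\<integral>\<^sup>+x. ennreal ((g x)\<^sup>2) \<partial>lborel) \<le> 2 * ennreal (l\<^sup>2) * ennreal (2 * \<gamma>)"
  proof (rule faber_krahn[OF gm l(1)])
    fix h :: "real ^ 'n"
    have "(\<integral>\<^sup>+x. ennreal ((g (x + h) - g x)\<^sup>2) \<partial>lborel) \<le> (\<integral>\<^sup>+x. ennreal ((norm (v (x + h) - v x))\<^sup>2) \<partial>lborel)"
    proof (intro nn_integral_mono ennreal_leI)
      fix x
      have "\<bar>g (x + h) - g x\<bar> \<le> norm (v (x + h) - v x)"
        using norm_triangle_ineq3[of "v (x + h)" "v x"] unfolding g_def by linarith
      then show "(g (x + h) - g x)\<^sup>2 \<le> (norm (v (x + h) - v x))\<^sup>2"
        using power_mono[of "\<bar>g (x + h) - g x\<bar>" _ 2] by simp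
    qed
    also have "\<dots> \<le> ennreal ((norm h)\<^sup>2) * ennreal (2 * \<gamma>)"
      using trans_v[of h] \<gamma>0 by (simp add: ennreal_mult)
    finally show "(\<integral>\<^sup>+x. ennreal ((g (x + h) - g x)\<^sup>2) \<partial>lborel) \<le> ennreal ((norm h)\<^sup>2) * ennreal (2 * \<gamma>)" .
  next
    fix y
    have sets: "{z. g z \<noteq> 0} \<inter> ball y l \<in> sets lborel"
      by measurable
    \<comment> \<open>Chebyshev's inequality: \<open>|v| > \<delta>\<close> where \<open>g\<close>
      is nonzero, and \<open>l \<le> 1\<close> places the ball of radius \<open>l\<close> inside the
      unit ball of the hypothesis \<open>small\<close>.\<close>
    have "ennreal (\<delta>\<^sup>2) * emeasure lborel ({z. g z \<noteq> 0} \<inter> ball y l)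
        = (\<integral>\<^sup>+x. ennreal (\<delta>\<^sup>2) * indicator ({z. g z \<noteq> 0} \<inter> ball y l) x \<partial>lborel)"
      by (rule nn_integral_cmult_indicator[OF sets, symmetric])
    also have "\<dots> \<le> (\<integral>\<^sup>+x. ennreal ((norm (v x))\<^sup>2) * indicator (ball y 1) x \<partial>lborel)"
    proof (rule nn_integral_mono)
      fix x
      show "ennreal (\<delta>\<^sup>2) * indicator ({z. g z \<noteq> 0} \<inter> ball y l) x \<le> ennreal ((norm (v x))\<^sup>2) * indicator (ball y 1) x"
      proof (cases "x \<in> {z. g z \<noteq> 0} \<inter> ball y l")
        case True
        then have "\<delta> \<le> norm (v x)" "x \<in> ball y 1" using l(2) by (auto simp: g_def max_def split: if_splits)
        then show ?thesis using True \<delta> by (auto intro!: ennreal_leI power_mono)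
      qed simp
    qed
    also have "\<dots> = (\<integral>\<^sup>+x. ennreal ((norm (v x))\<^sup>2) * indicator (ball y 1) x \<partial>lebesgue)"
      by (rule nn_integral_completion[symmetric])
    also have "\<dots> = (\<integral>\<^sup>+x. ennreal ((norm (u x))\<^sup>2) * indicator (ball y 1) x \<partial>lebesgue)"
      by (rule nn_integral_cong_AE) (use ae in eventually_elim, simp)
    finally have "2 * (ennreal (\<delta>\<^sup>2) * emeasure lborel ({z. g z \<noteq> 0} \<inter> ball y l))
        \<le> 2 * (\<integral>\<^sup>+x. ennreal ((norm (u x))\<^sup>2) * indicator (ball y 1) x \<partial>lebesgue)"
      by (rule mult_left_mono) simp
    also have "\<dots> \<le> ennreal (\<delta>\<^sup>2) * emeasure lborel (ball (0 :: real ^ 'n) l)"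
      using small[of y] by (simp add: mult.commute)
    finally have "ennreal (\<delta>\<^sup>2) * (2 * emeasure lborel ({z. g z \<noteq> 0} \<inter> ball y l)) \<le> ennreal (\<delta>\<^sup>2) * emeasure lborel (ball (0 :: real ^ 'n) l)"
      by (simp only: mult_ac)
    then show "2 * emeasure lborel ({z. g z \<noteq> 0} \<inter> ball y l) \<le> emeasure lborel (ball (0 :: real ^ 'n) l)"
      using \<delta> by (simp add: ennreal_mult_le_mult_iff)
  qed
  also have "2 * ennreal (l\<^sup>2) * ennreal (2 * \<gamma>) = ennreal (4 * l\<^sup>2 * \<gamma>)"
    using \<gamma>0 by (simp add: ennreal_mult mult_ac)
  finally have g: "(\<integral>\<^sup>+x. ennreal ((g x)\<^sup>2) \<partial>lborel) \<le> ennreal (4 * l\<^sup>2 * \<gamma>)" .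
  have "(\<integral>\<^sup>+x. ennreal ((cmod (u x))\<^sup>2 * indicator {2 * \<delta><..} (cmod (u x))) \<partial>lebesgue)
      = (\<integral>\<^sup>+x. ennreal ((cmod (v x))\<^sup>2 * indicator {2 * \<delta><..} (cmod (v x))) \<partial>lebesgue)"
    by (rule nn_integral_cong_AE) (use ae in eventually_elim, simp)
  also have "\<dots> = (\<integral>\<^sup>+x. ennreal ((cmod (v x))\<^sup>2 * indicator {2 * \<delta><..} (cmod (v x))) \<partial>lborel)"
    by (rule nn_integral_completion)
  also have "\<dots> \<le> (\<integral>\<^sup>+x. 4 * ennreal ((g x)\<^sup>2) \<partial>lborel)"
  proof (rule nn_integral_mono)
    fix x
    show "ennreal ((cmod (v x))\<^sup>2 * indicator {2 * \<delta><..} (cmod (v x))) \<le> 4 * ennreal ((g x)\<^sup>2)"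
    proof (cases "cmod (v x) > 2 * \<delta>")
      case True
      \<comment> \<open>Above the doubled threshold \<open>|v|\<close> is at most twice
        \<open>|v| - \<delta>\<close>; squaring gives 4, and with the bound
        \<open>4 * l\<^sup>2 * \<gamma>\<close> the constant 16.\<close>
      then have "cmod (v x) \<le> 2 * g x" using \<delta> by (simp add: g_def)
      then have "(cmod (v x))\<^sup>2 \<le> (2 * g x)\<^sup>2" by (intro power_mono) auto
      then have "ennreal ((cmod (v x))\<^sup>2) \<le> ennreal (4 * (g x)\<^sup>2)" by (intro ennreal_leI) (simp add: power_mult_distrib)
      then show ?thesis using True by (simp add: ennreal_mult)
    qed simp
  qed
  also have "\<dots> = 4 * (\<integral>\<^sup>+x. ennreal ((g x)\<^sup>2) \<partial>lborel)"
    by (rule nn_integral_cmult) measurable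
  also have "\<dots> \<le> 4 * ennreal (4 * l\<^sup>2 * \<gamma>)"
    using g by (rule mult_left_mono) simp
  also have "\<dots> = ennreal (16 * l\<^sup>2 * \<gamma>)"
    using \<gamma>0 ennreal_mult[of 4 "4 * l\<^sup>2 * \<gamma>"] by (simp add: mult.assoc)
  finally show ?thesis unfolding \<gamma>_def .
qed

section \<open>The potential\<close>

lemma V_pot_eq:
  assumes F: "continuous_on {0..} F" and s: "s \<ge> 0"
  shows "V_pot F s = (if s \<le> 1 then integral {s..1} F else - integral {1..s} F)"
proof -
  have i: "(LBINT t=ereal a..ereal b. F t) = integral {a..b} F" if "0 \<le> a" "a \<le> b" for a b
  proof -
    have "continuous_on {a..b} F" by (rule continuous_on_subset[OF F]) (use that in auto)
    then have "set_integrable lborel {a..b} F" by (rule borel_integrable_atLeastAtMost')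
    then show ?thesis using that by (intro interval_integral_eq_integral) auto
  qed
  show ?thesis
  proof (cases "s \<le> 1")
    case True
    then show ?thesis unfolding V_pot_def using i[OF s True] by simp
  next
    case False
    then have "1 \<le> s" by simp
    then show ?thesis
      unfolding V_pot_def using i[of 1 s] False
      by (subst interval_integral_endpoints_reverse) simp
  qed
qed

lemma V_pot_continuous:
  assumes F: "continuous_on {0..} F"
  shows "continuous_on {0..} (V_pot F)"
proof -
  have c: "continuous_on {a..b} F" if "0 \<le> a" for a b
    by (rule continuous_on_subset[OF F]) (use that in auto)
  have i: "F integrable_on {a..b}" if "0 \<le> a" for a b
    by (intro integrable_continuous_real c that)
  have eq: "V_pot F s = integral {0..1} F - integral {0..s} F" if "s \<ge> 0" for s
  proof (cases "s \<le> 1")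
    case True
    then show ?thesis
      using V_pot_eq[OF F that] Henstock_Kurzweil_Integration.integral_combine[OF that True i] by simp
  next
    case False
    then show ?thesis
      using V_pot_eq[OF F that] Henstock_Kurzweil_Integration.integral_combine[of 0 1 s F] i by simp
  qed
  have "continuous_on {0..} (\<lambda>s. integral {0..s} F)"
    unfolding continuous_on_eq_continuous_within
  proof
    fix s :: real assume s: "s \<in> {0..}"
    have "continuous_on {0..s + 1} (\<lambda>s. integral {0..s} F)"
      by (intro indefinite_integral_continuous_1 i) simp
    then have "continuous (at s within {0..s + 1}) (\<lambda>s. integral {0..s} F)"
      using s by (simp add: continuous_on_eq_continuous_within)
    moreover have "at s within {0..s + 1} = at s within {0..}"
      by (rule at_within_nhd[where S = "{..<s + 1}"]) auto
    ultimately show "continuous (at s within {0..}) (\<lambda>s. integral {0..s} F)" by simp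
  qed
  then have "continuous_on {0..} (\<lambda>s. integral {0..1} F - integral {0..s} F)"
    by (intro continuous_intros)
  then show ?thesis
    by (rule continuous_on_eq) (simp add: eq)
qed

text \<open>Since \<open>(s - 1)\<^sup>2 / 2\<close> is the oriented integral of
  \<open>1 - t\<close> from \<open>s\<close> to 1, the difference is that of
  \<open>F t + (t - 1)\<close>, which is at most \<open>\<epsilon> * |s - 1|\<close> on an interval
  of length \<open>|s - 1|\<close>.\<close>

lemma V_pot_near_1:
  assumes F: "continuous_on {0..} F" and s: "s \<ge> 0" and \<epsilon>: "\<epsilon> \<ge> 0"
    and near: "\<And>t. \<bar>t - 1\<bar> \<le> \<bar>s - 1\<bar> \<Longrightarrow> \<bar>F t + (t - 1)\<bar> \<le> \<epsilon> * \<bar>t - 1\<bar>"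
  shows "\<bar>V_pot F s - (s - 1)\<^sup>2 / 2\<bar> \<le> \<epsilon> * (s - 1)\<^sup>2"
proof -
  have bd: "\<bar>F t + (t - 1)\<bar> \<le> \<epsilon> * \<bar>s - 1\<bar>" if "\<bar>t - 1\<bar> \<le> \<bar>s - 1\<bar>" for t
    using near[OF that] mult_left_mono[OF that \<epsilon>] by linarith
  have c: "continuous_on {a..b} F" if "0 \<le> a" for a b
    by (rule continuous_on_subset[OF F]) (use that in auto)
  have lin: "((\<lambda>t. t - 1) has_integral ((b - 1)\<^sup>2 / 2 - (a - 1)\<^sup>2 / 2)) {a..b}" if "a \<le> b" for a b :: real
    using that by (intro fundamental_theorem_of_calculus)
      (auto intro!: derivative_eq_intros simp flip: has_real_derivative_iff_has_vector_derivative)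
  have I: "integral {a..b} (\<lambda>t. F t + (t - 1)) = integral {a..b} F + ((b - 1)\<^sup>2 / 2 - (a - 1)\<^sup>2 / 2)"
    if "0 \<le> a" "a \<le> b" for a b
    using integrable_integral[OF integrable_continuous_real[OF c[OF that(1), of b]]] lin[OF that(2)]
    by (intro integral_unique has_integral_add)
  have bound: "\<bar>integral {a..b} (\<lambda>t. F t + (t - 1))\<bar> \<le> \<epsilon> * \<bar>s - 1\<bar> * (b - a)"
    if "0 \<le> a" "a \<le> b" "\<And>t. t \<in> {a..b} \<Longrightarrow> \<bar>t - 1\<bar> \<le> \<bar>s - 1\<bar>" for a b
  proof -
    have "continuous_on {a..b} (\<lambda>t. F t + (t - 1))"
      by (intro continuous_on_add continuous_on_diff continuous_on_id continuous_on_const c that(1))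
    then show ?thesis
      using integral_bound[of a b "\<lambda>t. F t + (t - 1)" "\<epsilon> * \<bar>s - 1\<bar>"] that bd by simp
  qed
  show ?thesis
  proof (cases "s \<le> 1")
    case True
    have "V_pot F s - (s - 1)\<^sup>2 / 2 = integral {s..1} (\<lambda>t. F t + (t - 1))"
      using V_pot_eq[OF F s] I[OF s True] True by simp
    moreover have "\<bar>integral {s..1} (\<lambda>t. F t + (t - 1))\<bar> \<le> \<epsilon> * \<bar>s - 1\<bar> * (1 - s)"
      by (rule bound[OF s True]) auto
    moreover have "\<epsilon> * \<bar>s - 1\<bar> * (1 - s) = \<epsilon> * (s - 1)\<^sup>2"
    proof -
      have "\<bar>s - 1\<bar> = 1 - s" using True by simp
      then show ?thesis by (simp add: power2_eq_square algebra_simps)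
    qed
    ultimately show ?thesis by simp
  next
    case False
    then have "V_pot F s - (s - 1)\<^sup>2 / 2 = - integral {1..s} (\<lambda>t. F t + (t - 1))"
      using V_pot_eq[OF F s] I[of 1 s] by simp
    moreover have "\<bar>integral {1..s} (\<lambda>t. F t + (t - 1))\<bar> \<le> \<epsilon> * \<bar>s - 1\<bar> * (s - 1)"
      by (rule bound) (use False in auto)
    moreover have "\<epsilon> * \<bar>s - 1\<bar> * (s - 1) = \<epsilon> * (s - 1)\<^sup>2"
      using False by (simp add: power2_eq_square)
    ultimately show ?thesis by simp
  qed
qed

text \<open>\<open>cond_F2\<close> handles large \<open>s\<close> with an arbitrarily small factor,
  and compactness handles the rest.\<close>

lemma F_growth:
  assumes F: "continuous_on {0..} F" and F2: "cond_F2 d F" and \<epsilon>: "\<epsilon> > 0"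
  obtains K where "K \<ge> 0" "\<And>s. s \<ge> 0 \<Longrightarrow> \<bar>F s\<bar> \<le> \<epsilon> * s powr ((crit_exp d - 2) / 2) + K"
proof -
  let ?r = "(crit_exp d - 2) / 2"
  have "Limsup at_top (\<lambda>s. ereal (\<bar>F s\<bar> / s powr ?r)) \<le> 0"
    using F2 by (simp add: cond_F2_def)
  then have "\<forall>y>0. \<forall>\<^sub>F s in at_top. ereal (\<bar>F s\<bar> / s powr ?r) < y"
    by (simp only: Limsup_le_iff)
  from this[rule_format, of "ereal \<epsilon>"]
  have "\<forall>\<^sub>F s in at_top. ereal (\<bar>F s\<bar> / s powr ?r) < ereal \<epsilon>"
    using \<epsilon> by simp
  then obtain s0 where s0: "\<And>s. s \<ge> s0 \<Longrightarrow> \<bar>F s\<bar> / s powr ?r < \<epsilon>"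
    by (auto simp: eventually_at_top_linorder)
  define s1 where "s1 = max 1 s0"
  have "continuous_on {0..s1} F" by (rule continuous_on_subset[OF F]) auto
  then have "bounded (F ` {0..s1})"
    by (intro compact_imp_bounded compact_continuous_image) auto
  then obtain K where "\<forall>s\<in>{0..s1}. \<bar>F s\<bar> \<le> K"
    unfolding bounded_iff by auto
  then have K: "\<bar>F s\<bar> \<le> K" if "s \<in> {0..s1}" for s
    using that by blast
  show ?thesis
  proof
    show "K \<ge> 0" using order_trans[OF abs_ge_zero K[of 0]] by (simp add: s1_def le_max_iff_disj)
    show "\<bar>F s\<bar> \<le> \<epsilon> * s powr ?r + K" if "s \<ge> 0" for s
    proof (cases "s \<le> s1")
      case True
      then show ?thesis using K[of s] that \<epsilon> by (simp add: add_increasing)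
    next
      case False
      then have "s \<ge> s0" "s > 0" by (auto simp: s1_def)
      then have "\<bar>F s\<bar> \<le> \<epsilon> * s powr ?r" using s0[of s] by (simp add: divide_less_eq split: if_splits)
      then show ?thesis using \<open>K \<ge> 0\<close> by simp
    qed
  qed
qed

text \<open>Integration raises the exponent by one: \<open>r = (p - 2) / 2\<close> becomes
  \<open>p / 2\<close>, so at \<open>s = |1 + z|\<^sup>2\<close> the growth is that of
  \<open>|z| powr p\<close>. Writing \<open>1 + s\<close> bounds both endpoints of the interval,
  whether \<open>s\<close> lies below or above 1.\<close>

lemma V_pot_growth:
  assumes F: "continuous_on {0..} F" and r: "r > 0" and K: "K \<ge> 0" and \<epsilon>: "\<epsilon> \<ge> 0" and s: "s \<ge> 0"
    and growth: "\<And>s. s \<ge> 0 \<Longrightarrow> \<bar>F s\<bar> \<le> \<epsilon> * s powr r + K"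
  shows "\<bar>V_pot F s\<bar> \<le> \<epsilon> * (1 + s) powr (r + 1) + K * (1 + s)"
proof -
  have c: "continuous_on {a..b} F" if "0 \<le> a" for a b
    by (rule continuous_on_subset[OF F]) (use that in auto)
  have bd: "\<bar>F t\<bar> \<le> \<epsilon> * (1 + s) powr r + K" if "0 \<le> t" "t \<le> 1 + s" for t
  proof -
    have "\<epsilon> * t powr r \<le> \<epsilon> * (1 + s) powr r"
      using that r \<epsilon> by (intro mult_left_mono powr_mono2) auto
    then show ?thesis using growth[OF that(1)] by linarith
  qed
  let ?B = "\<epsilon> * (1 + s) powr r + K"
  have B0: "?B \<ge> 0" using \<epsilon> K by simp
  have bound: "\<bar>integral {a..b} F\<bar> \<le> ?B * (1 + s)" if "0 \<le> a" "a \<le> b" "b \<le> 1 + s" for a b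
  proof -
    have "norm (integral {a..b} F) \<le> ?B * (b - a)"
      using that bd by (intro integral_bound c) auto
    also have "\<dots> \<le> ?B * (1 + s)" using that B0 by (intro mult_left_mono) auto
    finally show ?thesis by simp
  qed
  have "\<bar>V_pot F s\<bar> \<le> ?B * (1 + s)"
    using V_pot_eq[OF F s] bound[of s 1] bound[of 1 s] s by auto
  also have "?B * (1 + s) = \<epsilon> * (1 + s) powr (r + 1) + K * (1 + s)"
    using s by (simp add: powr_add algebra_simps)
  finally show ?thesis .
qed

text \<open>Near \<open>s = 1\<close> the potentials \<open>V(s) / 2\<close> and
  \<open>(s - 1)\<^sup>2 / 4\<close> agree to second order because \<open>F(1) = 0\<close> and
  \<open>F'(1) = -1\<close>. Away from \<open>z = 0\<close> everything fits into
  \<open>C |z|\<^sup>2\<close> except the critical growth, whose coefficient is arbitrarily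
  small.\<close>

lemma potential_difference_le:
  assumes d: "d \<ge> 3" and F1: "cond_F1 F" and F2: "cond_F2 d F" and \<phi>: "admissible_phi \<phi>" and \<epsilon>: "\<epsilon> > 0"
  obtains \<delta> C where "\<delta> > 0" "C \<ge> 0"
    "\<And>z. \<bar>V_pot F ((cmod (1 + z))\<^sup>2) / 2 - ((\<phi> (cmod (1 + z)))\<^sup>2 - 1)\<^sup>2 / 4\<bar>
      \<le> \<epsilon> * ((\<phi> (cmod (1 + z)))\<^sup>2 - 1)\<^sup>2 + \<epsilon> * cmod z powr crit_exp d + C * ((cmod z)\<^sup>2 * indicator {\<delta><..} (cmod z))"
proof -
  define p where "p = crit_exp d"
  have p: "p > 2" unfolding p_def by (rule crit_exp_gt_2[OF d])
  have F: "continuous_on {0..} F" using F1 by (simp add: cond_F1_def)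
  have near: "\<exists>\<eta>>0. \<eta> \<le> 1 \<and> (\<forall>t. \<bar>t - 1\<bar> < \<eta> \<longrightarrow> \<bar>F t + (t - 1)\<bar> \<le> \<epsilon> * \<bar>t - 1\<bar>)"
  proof -
    obtain e where e: "e > 0" "\<And>s. s \<in> ball 1 e \<Longrightarrow> F differentiable (at s)" and v: "F 1 = 0" "deriv F 1 = -1"
      using F1 by (auto simp: cond_F1_def)
    have "F differentiable (at 1)" using e by simp
    then have "(F has_real_derivative - 1) (at 1)"
      using v by (metis DERIV_deriv_iff_real_differentiable)
    then have "((\<lambda>t. (F t - F 1) / (t - 1)) \<longlongrightarrow> - 1) (at 1)"
      by (simp add: has_field_derivative_iff)
    then have "\<forall>\<^sub>F t in at 1. dist ((F t - F 1) / (t - 1)) (- 1) < \<epsilon>"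
      using \<epsilon> by (rule tendstoD)
    then obtain \<eta> where \<eta>: "\<eta> > 0" "\<And>t. t \<noteq> 1 \<Longrightarrow> dist t 1 < \<eta> \<Longrightarrow> dist ((F t - F 1) / (t - 1)) (- 1) < \<epsilon>"
      unfolding eventually_at by auto
    have "\<bar>F t + (t - 1)\<bar> \<le> \<epsilon> * \<bar>t - 1\<bar>" if "\<bar>t - 1\<bar> < \<eta>" for t
    proof (cases "t = 1")
      case False
      have "F t + (t - 1) = ((F t - F 1) / (t - 1) + 1) * (t - 1)"
        using False v by (simp add: field_simps)
      also have "\<bar>\<dots>\<bar> \<le> \<epsilon> * \<bar>t - 1\<bar>"
        unfolding abs_mult using \<eta>(2)[OF False] that by (intro mult_right_mono) (auto simp: dist_real_def)
      finally show ?thesis .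
    qed (simp add: v)
    then show ?thesis using \<eta>(1) by (intro exI[of _ "min \<eta> 1"]) auto
  qed
  then obtain \<eta> where \<eta>: "\<eta> > 0" "\<eta> \<le> 1" "\<And>t. \<bar>t - 1\<bar> < \<eta> \<Longrightarrow> \<bar>F t + (t - 1)\<bar> \<le> \<epsilon> * \<bar>t - 1\<bar>" by blast
  \<comment> \<open>For \<open>|z| \<le> 1\<close> the number \<open>|1 + z|\<^sup>2\<close> differs
    from 1 by at most \<open>3 * |z|\<close>, so a quarter of \<open>\<eta>\<close> keeps it in the
    range of the linear approximation.\<close>
  define \<delta> where "\<delta> = \<eta> / 4"
  have \<delta>: "0 < \<delta>" "\<delta> \<le> 1" using \<eta> by (auto simp: \<delta>_def)
  \<comment> \<open>The divisor cancels the constants arising from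
    \<open>1 + s \<le> 2 * (1 + |z|)\<^sup>2\<close> raised to the power \<open>p / 2\<close> and
    from \<open>powr_add_le\<close>; the factor 2 is undone when \<open>V\<close> is halved.\<close>
  define \<epsilon>' where "\<epsilon>' = 2 * \<epsilon> / (2 powr (p / 2) * 2 powr p)"
  have \<epsilon>': "\<epsilon>' > 0" using \<epsilon> by (simp add: \<epsilon>'_def)
  obtain K where K: "K \<ge> 0" "\<And>s. s \<ge> 0 \<Longrightarrow> \<bar>F s\<bar> \<le> \<epsilon>' * s powr ((crit_exp d - 2) / 2) + K"
    using F_growth[OF F F2 \<epsilon>'] by blast
  define C where "C = \<epsilon> / \<delta>\<^sup>2 + 2 * K * (1 / \<delta>\<^sup>2 + 1) + 16 / \<delta>\<^sup>2"
  have C: "C \<ge> 0" unfolding C_def using \<epsilon> K \<delta> by (intro add_nonneg_nonneg mult_nonneg_nonneg) auto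
  have main: "\<bar>V_pot F ((cmod (1 + z))\<^sup>2) / 2 - ((\<phi> (cmod (1 + z)))\<^sup>2 - 1)\<^sup>2 / 4\<bar>
      \<le> \<epsilon> * ((\<phi> (cmod (1 + z)))\<^sup>2 - 1)\<^sup>2 + \<epsilon> * cmod z powr p + C * ((cmod z)\<^sup>2 * indicator {\<delta><..} (cmod z))" for z
  proof -
    let ?n = "cmod z" and ?s = "(cmod (1 + z))\<^sup>2" and ?R = "(\<phi> (cmod (1 + z)))\<^sup>2 - 1"
    have c1: "cmod (1 + z) \<le> 1 + ?n" using norm_triangle_ineq[of 1 z] by simp
    have \<epsilon>R: "\<epsilon> * ?R\<^sup>2 \<ge> 0" "\<epsilon> * ?n powr p \<ge> 0" using \<epsilon> by auto
    show ?thesis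
    proof (cases "?n \<le> \<delta>")
      case True
      then have n1: "?n \<le> 1" using \<delta> by linarith
      have R: "?R = ?s - 1" using c1 n1 by (simp add: admissible_phi_bounds(2)[OF \<phi>])
      have "\<bar>?s - 1\<bar> < \<eta>"
      proof -
        have "?s = 1 + 2 * Re z + ?n\<^sup>2" unfolding cmod_power2 by (simp add: power2_eq_square algebra_simps)
        moreover have "?n\<^sup>2 \<le> ?n" using n1 power_decreasing[of 1 2 ?n] by simp
        ultimately have "\<bar>?s - 1\<bar> \<le> 3 * ?n" using abs_Re_le_cmod[of z] zero_le_power2[of ?n] by linarith
        also have "\<dots> < \<eta>" using True \<eta>(1) by (simp add: \<delta>_def)
        finally show ?thesis .
      qed
      then have "\<bar>V_pot F ?s - (?s - 1)\<^sup>2 / 2\<bar> \<le> \<epsilon> * (?s - 1)\<^sup>2"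
        using \<epsilon> \<eta>(3) by (intro V_pot_near_1[OF F]) auto
      moreover have "V_pot F ?s / 2 - ?R\<^sup>2 / 4 = (V_pot F ?s - (?s - 1)\<^sup>2 / 2) / 2" unfolding R by simp
      moreover have "\<bar>x / 2\<bar> \<le> y" if "\<bar>x\<bar> \<le> y" for x y :: real using that by simp
      ultimately have "\<bar>V_pot F ?s / 2 - ?R\<^sup>2 / 4\<bar> \<le> \<epsilon> * ?R\<^sup>2" unfolding R by simp
      then show ?thesis using \<epsilon>R True by simp
    next
      case False
      then have n: "?n > \<delta>" by simp
      \<comment> \<open>This inequality converts every constant in the growth bounds into a multiple
        of \<open>|z|\<^sup>2\<close>.\<close>
      have one: "1 \<le> ?n\<^sup>2 / \<delta>\<^sup>2" using n \<delta> power_mono[of \<delta> ?n 2] by simp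
      have s1: "1 + ?s \<le> 2 * (1 + ?n)\<^sup>2"
      proof -
        have "?s \<le> (1 + ?n)\<^sup>2" using c1 by (intro power_mono) auto
        moreover have "1 \<le> (1 + ?n)\<^sup>2" by (rule one_le_power) simp
        ultimately show ?thesis by linarith
      qed
      have V: "\<bar>V_pot F ?s\<bar> \<le> \<epsilon>' * (1 + ?s) powr (p / 2) + K * (1 + ?s)"
      proof -
        have e: "(crit_exp d - 2) / 2 + 1 = p / 2" by (simp add: p_def diff_divide_distrib)
        have r: "(crit_exp d - 2) / 2 > 0" using p by (simp add: p_def)
        show ?thesis
          using V_pot_growth[OF F r K(1) less_imp_le[OF \<epsilon>'] zero_le_power2[of "cmod (1 + z)"] K(2)] unfolding e by simp
      qed
      have "\<epsilon>' * (1 + ?s) powr (p / 2) \<le> 2 * (\<epsilon> * (?n\<^sup>2 / \<delta>\<^sup>2)) + 2 * (\<epsilon> * ?n powr p)"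
      proof -
        have "(1 + ?s) powr (p / 2) \<le> (2 * (1 + ?n)\<^sup>2) powr (p / 2)"
          using s1 p by (intro powr_mono2) auto
        also have "\<dots> = 2 powr (p / 2) * ((1 + ?n)\<^sup>2) powr (p / 2)" by (rule powr_mult)
        also have "((1 + ?n)\<^sup>2) powr (p / 2) = (1 + ?n) powr p"
        proof -
          have "(1 + ?n)\<^sup>2 = (1 + ?n) powr 2" by simp
          then show ?thesis by (simp only: powr_powr) simp
        qed
        also have "\<dots> \<le> 2 powr p * (1 powr p + ?n powr p)" using p by (intro powr_add_le) auto
        also have "1 powr p + ?n powr p \<le> ?n\<^sup>2 / \<delta>\<^sup>2 + ?n powr p" using one by simp
        finally have "(1 + ?s) powr (p / 2) \<le> 2 powr (p / 2) * (2 powr p * (?n\<^sup>2 / \<delta>\<^sup>2 + ?n powr p))" by simp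
        then have "\<epsilon>' * (1 + ?s) powr (p / 2) \<le> \<epsilon>' * (2 powr (p / 2) * (2 powr p * (?n\<^sup>2 / \<delta>\<^sup>2 + ?n powr p)))"
          using \<epsilon>' by (intro mult_left_mono) auto
        also have "\<dots> = 2 * \<epsilon> * (?n\<^sup>2 / \<delta>\<^sup>2 + ?n powr p)"
        proof -
          have "2 * e / (A * B) * (A * (B * X)) = 2 * e * X" if "A \<noteq> 0" "B \<noteq> 0" for e A B X :: real
            using that by simp
          then show ?thesis unfolding \<epsilon>'_def by (metis powr_eq_0_iff zero_neq_numeral)
        qed
        also have "\<dots> = 2 * (\<epsilon> * (?n\<^sup>2 / \<delta>\<^sup>2)) + 2 * (\<epsilon> * ?n powr p)" by (simp add: distrib_left)
        finally show ?thesis .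
      qed
      moreover have "K * (1 + ?s) \<le> 4 * (K * ((1 / \<delta>\<^sup>2 + 1) * ?n\<^sup>2))"
      proof -
        have "(1 + ?n)\<^sup>2 \<le> 2 * (1 + ?n\<^sup>2)" using sum_squares_bound[of 1 ?n] by (simp add: power2_sum)
        then have "1 + ?s \<le> 4 * (1 + ?n\<^sup>2)" using s1 by linarith
        also have "\<dots> \<le> 4 * (?n\<^sup>2 / \<delta>\<^sup>2 + ?n\<^sup>2)" using one by simp
        finally have "1 + ?s \<le> 4 * (?n\<^sup>2 / \<delta>\<^sup>2 + ?n\<^sup>2)" .
        then have "K * (1 + ?s) \<le> K * (4 * (?n\<^sup>2 / \<delta>\<^sup>2 + ?n\<^sup>2))" using K(1) by (rule mult_left_mono)
        then show ?thesis by (simp add: algebra_simps)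
      qed
      moreover have "?R\<^sup>2 / 4 \<le> 16 * (?n\<^sup>2 / \<delta>\<^sup>2)"
      proof -
        have "\<bar>?R\<bar>\<^sup>2 \<le> 8\<^sup>2" using admissible_phi_bounds(3)[OF \<phi>] by (intro power_mono) auto
        then show ?thesis using one by simp
      qed
      moreover have "?R\<^sup>2 / 4 \<ge> 0" by simp
      moreover have "\<bar>v / 2 - r\<bar> \<le> x + y + 2 * k + 16 * m"
        if "\<bar>v\<bar> \<le> a + b" "a \<le> 2 * x + 2 * y" "b \<le> 4 * k" "r \<le> 16 * m" "r \<ge> 0" for v r a b x y m k :: real
      proof -
        have "\<bar>v\<bar> \<le> (2 * x + 2 * y) + 4 * k" using that(1) add_mono[OF that(2,3)] by (rule order_trans)
        also have "\<dots> = 2 * (x + y + 2 * k)" by simp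
        finally have "\<bar>v\<bar> \<le> 2 * (x + y + 2 * k)" .
        moreover have "\<bar>v / 2 - r\<bar> \<le> \<bar>v / 2\<bar> + \<bar>r\<bar>" by (rule abs_triangle_ineq4)
        ultimately show ?thesis using that by simp
      qed
      ultimately have "\<bar>V_pot F ?s / 2 - ?R\<^sup>2 / 4\<bar> \<le> \<epsilon> * (?n\<^sup>2 / \<delta>\<^sup>2) + \<epsilon> * ?n powr p
          + 2 * (K * ((1 / \<delta>\<^sup>2 + 1) * ?n\<^sup>2)) + 16 * (?n\<^sup>2 / \<delta>\<^sup>2)"
        using V by blast
      also have "\<dots> = \<epsilon> * ?n powr p + C * ?n\<^sup>2"
        unfolding C_def by (simp add: distrib_right)
      finally show ?thesis using \<epsilon>R n by simp
    qed
  qed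
  show ?thesis
    by (rule that[OF \<delta>(1) C]) (use main in \<open>simp add: p_def\<close>)
qed

section \<open>Energy estimates\<close>

text \<open>Where \<open>|u| > \<delta>\<close>, the square of \<open>|u|\<close> is dominated by
  \<open>\<delta> powr (2 - p) * |u| powr p\<close>. This is the substitute for square integrability
  of \<open>u\<close>, which \<open>X_space\<close> does not provide.\<close>

lemma integrable_large_part:
  fixes u :: "real ^ 'n \<Rightarrow> complex"
  assumes "in_Lp p u" "p > 2" "\<delta> > 0"
  shows "integrable lebesgue (\<lambda>x. (cmod (u x))\<^sup>2 * indicator {\<delta><..} (cmod (u x)))"
proof (rule Bochner_Integration.integrable_bound)
  have [measurable]: "u \<in> borel_measurable lebesgue" using assms by (simp add: in_Lp_def)
  show "integrable lebesgue (\<lambda>x. \<delta> powr (2 - p) * cmod (u x) powr p)"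
    using assms by (simp add: in_Lp_def)
  show "(\<lambda>x. (cmod (u x))\<^sup>2 * indicator {\<delta><..} (cmod (u x))) \<in> borel_measurable lebesgue"
    by measurable
  show "AE x in lebesgue. norm ((cmod (u x))\<^sup>2 * indicator {\<delta><..} (cmod (u x))) \<le> norm (\<delta> powr (2 - p) * cmod (u x) powr p)"
  proof (rule AE_I2)
    fix x
    show "norm ((cmod (u x))\<^sup>2 * indicator {\<delta><..} (cmod (u x))) \<le> norm (\<delta> powr (2 - p) * cmod (u x) powr p)"
    proof (cases "cmod (u x) > \<delta>")
      case True
      then have n: "cmod (u x) > 0" using assms by linarith
      have "(cmod (u x))\<^sup>2 = cmod (u x) powr (2 - p) * cmod (u x) powr p"
        using n by (simp flip: powr_add)
      also have "\<dots> \<le> \<delta> powr (2 - p) * cmod (u x) powr p"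
        using True assms by (intro mult_right_mono powr_mono2') auto
      finally show ?thesis using True by simp
    qed simp
  qed
qed

definition grad_energy :: "(real ^ 'n \<Rightarrow> complex) \<Rightarrow> real" where
  "grad_energy u = (\<integral>x. (norm (grad u x))\<^sup>2 \<partial>lebesgue)"

definition potential_energy :: "(real \<Rightarrow> real) \<Rightarrow> (real ^ 'n \<Rightarrow> complex) \<Rightarrow> real" where
  "potential_energy \<phi> u = (\<integral>x. ((\<phi> (cmod (1 + u x)))\<^sup>2 - 1)\<^sup>2 \<partial>lebesgue)"

definition crit_mass :: "(real ^ 'n \<Rightarrow> complex) \<Rightarrow> real" where
  "crit_mass u = (\<integral>x. cmod (u x) powr crit_exp CARD('n) \<partial>lebesgue)"

definition large_mass :: "(real ^ 'n \<Rightarrow> complex) \<Rightarrow> real \<Rightarrow> real" where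
  "large_mass u \<delta> = (\<integral>x. (cmod (u x))\<^sup>2 * indicator {\<delta><..} (cmod (u x)) \<partial>lebesgue)"

context
  fixes u :: "real ^ 'n \<Rightarrow> complex" and \<phi> :: "real \<Rightarrow> real" and k :: 'n
  assumes d: "CARD('n) \<ge> 3" and \<phi>: "admissible_phi \<phi>" and u: "u \<in> X_space"
begin

lemma X_D12_grad: "D12_grad u (grad u)"
  using u by (intro D12_grad_grad) (simp add: X_space_def)

lemma X_measurable: "u \<in> borel_measurable lebesgue" "grad u \<in> borel_measurable lebesgue"
  using X_D12_grad by (auto simp: D12_grad_def in_Lp_def)

lemma X_phi_measurable: "(\<lambda>x. \<phi> (cmod (1 + u x))) \<in> borel_measurable lebesgue"
proof -
  have "(\<lambda>x. cmod (1 + u x)) \<in> borel_measurable lebesgue"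
    using X_measurable(1) by measurable
  from measurable_compose[OF this borel_measurable_continuous_onI[OF admissible_phi_bounds(1)[OF \<phi>]]]
  show ?thesis .
qed

text \<open>These facts guard against the default value 0 of the Bochner integral whenever integrals
  are split or compared. The potential term is dominated, through
  \<open>|(\<phi> s)\<^sup>2 - 1| \<le> 4 * |s - 1|\<close>, by the square-integrable
  \<open>|1 + u| - 1\<close>.\<close>

lemma X_integrable:
  "integrable lebesgue (\<lambda>x. (norm (grad u x))\<^sup>2)"
  "integrable lebesgue (\<lambda>x. ((\<phi> (cmod (1 + u x)))\<^sup>2 - 1)\<^sup>2)"
  "integrable lebesgue (\<lambda>x. cmod (u x) powr crit_exp CARD('n))"
  "\<delta> > 0 \<Longrightarrow> integrable lebesgue (\<lambda>x. (cmod (u x))\<^sup>2 * indicator {\<delta><..} (cmod (u x)))"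
proof -
  have D: "in_Lp (crit_exp CARD('n)) u" "in_Lp 2 (grad u)"
    using X_D12_grad by (auto simp: D12_grad_def)
  show "integrable lebesgue (\<lambda>x. (norm (grad u x))\<^sup>2)" using D by (simp add: in_Lp_2_iff)
  show "integrable lebesgue (\<lambda>x. cmod (u x) powr crit_exp CARD('n))" using D by (simp add: in_Lp_def)
  show "\<delta> > 0 \<Longrightarrow> integrable lebesgue (\<lambda>x. (cmod (u x))\<^sup>2 * indicator {\<delta><..} (cmod (u x)))"
    by (rule integrable_large_part[OF D(1) crit_exp_gt_2[OF d]])
  show "integrable lebesgue (\<lambda>x. ((\<phi> (cmod (1 + u x)))\<^sup>2 - 1)\<^sup>2)"
  proof (rule Bochner_Integration.integrable_bound)
    show "integrable lebesgue (\<lambda>x. 16 * (norm (cmod (1 + u x) - 1))\<^sup>2)"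
      using u by (intro integrable_mult_right) (simp add: X_space_def in_Lp_2_iff)
    show "(\<lambda>x. ((\<phi> (cmod (1 + u x)))\<^sup>2 - 1)\<^sup>2) \<in> borel_measurable lebesgue"
      using X_phi_measurable by measurable
    show "AE x in lebesgue. norm (((\<phi> (cmod (1 + u x)))\<^sup>2 - 1)\<^sup>2) \<le> norm (16 * (norm (cmod (1 + u x) - 1))\<^sup>2)"
    proof (rule AE_I2)
      fix x
      have "\<bar>(\<phi> (cmod (1 + u x)))\<^sup>2 - 1\<bar>\<^sup>2 \<le> (4 * \<bar>cmod (1 + u x) - 1\<bar>)\<^sup>2"
        by (intro power_mono admissible_phi_bounds(4)[OF \<phi>]) auto
      then show "norm (((\<phi> (cmod (1 + u x)))\<^sup>2 - 1)\<^sup>2) \<le> norm (16 * (norm (cmod (1 + u x) - 1))\<^sup>2)"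
        by (simp add: power_mult_distrib)
    qed
  qed
qed

lemma X_nonneg: "grad_energy u \<ge> 0" "potential_energy \<phi> u \<ge> 0" "crit_mass u \<ge> 0" "large_mass u \<delta> \<ge> 0"
  unfolding grad_energy_def potential_energy_def crit_mass_def large_mass_def by (auto intro!: integral_nonneg_AE)

lemma E_GL_eq: "E_GL \<phi> u = grad_energy u / 2 + potential_energy \<phi> u / 4"
  by (simp add: E_GL_def grad_energy_def potential_energy_def)

text \<open>The leading term \<open>|\<phi>\<^sup>2 - 1| |\<nabla>u|\<close> is at most
  \<open>sqrt 2\<close> times the energy density; the factor \<open>1 / 2\<close> in
  \<open>momentum\<close> turns \<open>sqrt 2\<close> into \<open>1 / sqrt 2\<close> and each 12
  into 6. The same pointwise bound supplies the integrability that \<open>momentum_eq\<close> asks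
  for.\<close>

lemma momentum_le:
  assumes \<delta>: "0 < \<delta>" "\<delta> \<le> 1"
  shows "\<bar>momentum k u\<bar> \<le> E_GL \<phi> u / sqrt 2 + 6 * \<delta> * (potential_energy \<phi> u + crit_mass u + grad_energy u) + 6 / \<delta> * large_mass u \<delta>"
proof -
  let ?p = "crit_exp CARD('n)"
  let ?R = "\<lambda>x. (\<phi> (cmod (1 + u x)))\<^sup>2 - 1" and ?N = "\<lambda>x. norm (grad u x)"
  let ?m = "\<lambda>x. mom_density (u x) (grad u x $ k)"
  let ?b = "\<lambda>x. sqrt 2 * ((?N x)\<^sup>2 / 2 + (?R x)\<^sup>2 / 4) + 12 * \<delta> * ((?R x)\<^sup>2 + cmod (u x) powr ?p + (?N x)\<^sup>2)
     + 12 / \<delta> * ((cmod (u x))\<^sup>2 * indicator {\<delta><..} (cmod (u x)))"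
  note i = X_integrable(1,2,3) X_integrable(4)[OF \<delta>(1)]
  have pt: "\<bar>?m x\<bar> \<le> ?b x" for x
  proof -
    have "\<bar>?m x\<bar> \<le> \<bar>?R x\<bar> * ?N x + 12 * \<delta> * ((?R x)\<^sup>2 + cmod (u x) powr ?p + (?N x)\<^sup>2)
     + 12 / \<delta> * ((cmod (u x))\<^sup>2 * indicator {\<delta><..} (cmod (u x)))"
      by (intro mom_density_le \<phi> crit_exp_gt_2 crit_exp_le_6 d \<delta> Finite_Cartesian_Product.norm_nth_le)
    moreover have "\<bar>?R x\<bar> * ?N x \<le> sqrt 2 * ((?N x)\<^sup>2 / 2 + (?R x)\<^sup>2 / 4)"
    proof -
      have "2 * (sqrt 2 * ?N x) * \<bar>?R x\<bar> \<le> (sqrt 2 * ?N x)\<^sup>2 + \<bar>?R x\<bar>\<^sup>2"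
        by (rule sum_squares_bound)
      then have "2 * sqrt 2 * (\<bar>?R x\<bar> * ?N x) \<le> 2 * (?N x)\<^sup>2 + (?R x)\<^sup>2"
        by (simp add: power_mult_distrib mult_ac)
      then have "sqrt 2 * (2 * sqrt 2 * (\<bar>?R x\<bar> * ?N x)) \<le> sqrt 2 * (2 * (?N x)\<^sup>2 + (?R x)\<^sup>2)"
        by (rule mult_left_mono) simp
      also have "sqrt 2 * (2 * sqrt 2 * (\<bar>?R x\<bar> * ?N x)) = 4 * (\<bar>?R x\<bar> * ?N x)" by simp
      also have "sqrt 2 * (2 * (?N x)\<^sup>2 + (?R x)\<^sup>2) = 4 * (sqrt 2 * ((?N x)\<^sup>2 / 2 + (?R x)\<^sup>2 / 4))"
        by (simp add: algebra_simps)
      finally show ?thesis by simp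
    qed
    ultimately show ?thesis by linarith
  qed
  have bi: "integrable lebesgue ?b"
    using i by (intro Bochner_Integration.integrable_add integrable_mult_right integrable_divide) auto
  have mm: "?m \<in> borel_measurable lebesgue"
  proof -
    have g: "(\<lambda>x. grad u x $ k) \<in> borel_measurable lebesgue"
      using measurable_compose[OF X_measurable(2) vec_nth_measurable] .
    have cc: "(\<lambda>x. f (h x)) \<in> borel_measurable lebesgue"
      if "continuous_on UNIV f" "h \<in> borel_measurable lebesgue" for f :: "complex \<Rightarrow> real" and h :: "real ^ 'n \<Rightarrow> complex"
      using measurable_compose[OF that(2) borel_measurable_continuous_onI[OF that(1)]] .
    have RI: "continuous_on UNIV Re" "continuous_on UNIV Im" by (intro continuous_intros)+
    show ?thesis
      unfolding mom_density_def
      by (intro borel_measurable_diff borel_measurable_times borel_measurable_add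
          cc[OF RI(1)] cc[OF RI(2)] cc[OF continuous_primH(2)] cc[OF continuous_primH(3)] g X_measurable)
  qed
  have mi: "integrable lebesgue ?m"
    by (rule Bochner_Integration.integrable_bound[OF bi mm])
      (unfold real_norm_def, intro AE_I2 order_trans[OF pt abs_ge_self])
  have "\<bar>\<integral>x. ?m x \<partial>lebesgue\<bar> \<le> (\<integral>x. \<bar>?m x\<bar> \<partial>lebesgue)"
    using integral_norm_bound[of lebesgue ?m] by simp
  also have "\<dots> \<le> (\<integral>x. ?b x \<partial>lebesgue)"
    using mi by (intro integral_mono bi pt) auto
  also have "\<dots> = sqrt 2 * (grad_energy u / 2 + potential_energy \<phi> u / 4) + 12 * \<delta> * (potential_energy \<phi> u + crit_mass u + grad_energy u) + 12 / \<delta> * large_mass u \<delta>"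
    unfolding grad_energy_def potential_energy_def crit_mass_def large_mass_def using i by simp
  finally have "\<bar>\<integral>x. ?m x \<partial>lebesgue\<bar> \<le> sqrt 2 * E_GL \<phi> u + 12 * \<delta> * (potential_energy \<phi> u + crit_mass u + grad_energy u) + 12 / \<delta> * large_mass u \<delta>"
    by (simp only: E_GL_eq)
  moreover have "momentum k u = 1 / 2 * (\<integral>x. ?m x \<partial>lebesgue)"
    using u by (intro momentum_eq d mi) (simp add: X_space_def)
  ultimately have "2 * \<bar>momentum k u\<bar> \<le> sqrt 2 * E_GL \<phi> u + 12 * \<delta> * (potential_energy \<phi> u + crit_mass u + grad_energy u) + 12 / \<delta> * large_mass u \<delta>"
    by (simp add: abs_mult)
  moreover have "sqrt 2 * E_GL \<phi> u = 2 * (E_GL \<phi> u / sqrt 2)"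
    by (simp add: real_div_sqrt field_simps)
  moreover have "12 / \<delta> * large_mass u \<delta> = 2 * (6 / \<delta> * large_mass u \<delta>)" by simp
  ultimately show ?thesis by linarith
qed

lemma E_lag_diff_le:
  assumes F1: "cond_F1 F" and \<delta>: "\<delta> > 0"
    and V: "\<And>z. \<bar>V_pot F ((cmod (1 + z))\<^sup>2) / 2 - ((\<phi> (cmod (1 + z)))\<^sup>2 - 1)\<^sup>2 / 4\<bar>
      \<le> \<epsilon> * ((\<phi> (cmod (1 + z)))\<^sup>2 - 1)\<^sup>2 + \<epsilon> * cmod z powr crit_exp CARD('n) + C * ((cmod z)\<^sup>2 * indicator {\<delta><..} (cmod z))"
  shows "\<bar>E_lag F k c u - (E_GL \<phi> u + c * momentum k u)\<bar> \<le> \<epsilon> * potential_energy \<phi> u + \<epsilon> * crit_mass u + C * large_mass u \<delta>"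
proof -
  let ?p = "crit_exp CARD('n)"
  let ?R = "\<lambda>x. (\<phi> (cmod (1 + u x)))\<^sup>2 - 1" and ?V = "\<lambda>x. V_pot F ((cmod (1 + u x))\<^sup>2)"
  let ?b = "\<lambda>x. \<epsilon> * (?R x)\<^sup>2 + \<epsilon> * cmod (u x) powr ?p + C * ((cmod (u x))\<^sup>2 * indicator {\<delta><..} (cmod (u x)))"
  note i = X_integrable(1,2,3) X_integrable(4)[OF \<delta>]
  have bi: "integrable lebesgue ?b"
    using i by (intro Bochner_Integration.integrable_add integrable_mult_right) auto
  have "continuous_on UNIV (\<lambda>r. V_pot F (r\<^sup>2))"
    using F1 by (intro continuous_on_compose2[OF V_pot_continuous] continuous_intros) (auto simp: cond_F1_def)
  moreover have "(\<lambda>x. cmod (1 + u x)) \<in> borel_measurable lebesgue"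
    using X_measurable(1) by measurable
  ultimately have Vm: "?V \<in> borel_measurable lebesgue"
    using measurable_compose[OF _ borel_measurable_continuous_onI] by blast
  have Wi: "integrable lebesgue (\<lambda>x. ?V x / 2 - (?R x)\<^sup>2 / 4)"
  proof (rule Bochner_Integration.integrable_bound[OF bi])
    show "(\<lambda>x. ?V x / 2 - (?R x)\<^sup>2 / 4) \<in> borel_measurable lebesgue"
      using Vm X_phi_measurable by measurable
    show "AE x in lebesgue. norm (?V x / 2 - (?R x)\<^sup>2 / 4) \<le> norm (?b x)"
      unfolding real_norm_def by (intro AE_I2 order_trans[OF V abs_ge_self])
  qed
  \<comment> \<open>Integrability of \<open>?V\<close> is recovered from that of the difference of
    potentials, so that the integral in \<open>E_lag\<close> can be split.\<close>
  have "integrable lebesgue (\<lambda>x. 2 * (?V x / 2 - (?R x)\<^sup>2 / 4) + (?R x)\<^sup>2 / 2)"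
    using Wi i(2) by (intro Bochner_Integration.integrable_add integrable_mult_right integrable_divide) auto
  then have Vi: "integrable lebesgue ?V" by (simp add: algebra_simps)
  have "E_lag F k c u - (E_GL \<phi> u + c * momentum k u) = (\<integral>x. ?V x \<partial>lebesgue) / 2 - potential_energy \<phi> u / 4"
  proof -
    have "(\<integral>x. (norm (grad u x))\<^sup>2 + ?V x \<partial>lebesgue) = grad_energy u + (\<integral>x. ?V x \<partial>lebesgue)"
      using Vi i(1) by (simp add: grad_energy_def)
    then show ?thesis
      unfolding E_lag_def E_GL_eq by (simp add: add_divide_distrib)
  qed
  also have "\<dots> = (\<integral>x. ?V x / 2 - (?R x)\<^sup>2 / 4 \<partial>lebesgue)"
    unfolding potential_energy_def using Vi i(2) by simp
  also have "\<bar>\<dots>\<bar> \<le> (\<integral>x. \<bar>?V x / 2 - (?R x)\<^sup>2 / 4\<bar> \<partial>lebesgue)"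
    using integral_norm_bound[of lebesgue "\<lambda>x. ?V x / 2 - (?R x)\<^sup>2 / 4"] by simp
  also have "\<dots> \<le> (\<integral>x. ?b x \<partial>lebesgue)"
    using Wi by (intro integral_mono bi V) auto
  also have "\<dots> = \<epsilon> * potential_energy \<phi> u + \<epsilon> * crit_mass u + C * large_mass u \<delta>"
    unfolding potential_energy_def crit_mass_def large_mass_def using i by simp
  finally show ?thesis .
qed

end

section \<open>Vanishing of the large part, and the conclusion\<close>

lemma large_part_tendsto_0:
  fixes u :: "nat \<Rightarrow> real ^ 'n \<Rightarrow> complex"
  assumes d: "CARD('n) \<ge> 3" and \<phi>: "admissible_phi \<phi>" and u: "\<And>n. u n \<in> X_space"
    and M: "\<And>n. grad_energy (u n) \<le> M"
    and van: "(\<lambda>n. SUP y. \<integral>\<^sup>+x\<in>ball y 1.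
            ennreal ((cmod (u n x))\<^sup>2 + ((\<phi> (cmod (1 + u n x)))\<^sup>2 - 1)\<^sup>2) \<partial>lebesgue) \<longlonglongrightarrow> 0"
    and \<delta>: "\<delta> > 0"
  shows "(\<lambda>n. large_mass (u n) \<delta>) \<longlonglongrightarrow> 0"
proof (rule order_tendstoI)
  have J0: "large_mass (u n) \<delta> \<ge> 0" for n by (rule X_nonneg(4)[OF d \<phi> u])
  show "\<forall>\<^sub>F n in sequentially. a < large_mass (u n) \<delta>" if "a < 0" for a
    using J0 that by (intro always_eventually) (auto intro: less_le_trans)
  fix a :: real assume a: "a > 0"
  have M0: "M \<ge> 0" using order_trans[OF X_nonneg(1)[OF d \<phi> u] M] .
  \<comment> \<open>\<open>l\<close> depends only on \<open>a\<close> and \<open>M\<close>; as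
    \<open>l \<le> 1\<close> gives \<open>l\<^sup>2 \<le> l\<close>, this choice forces
    \<open>16 * l\<^sup>2 * M < a\<close>. The vanishing hypothesis is used afterwards, at this
    fixed \<open>l\<close>.\<close>
  define l where "l = min 1 (a / (16 * M + 1))"
  have l: "0 < l" "l \<le> 1" using a M0 by (auto simp: l_def intro!: divide_pos_pos add_nonneg_pos)
  have la: "16 * l\<^sup>2 * M < a"
  proof -
    have "l\<^sup>2 \<le> l" using l power_decreasing[of 1 2 l] by simp
    then have "16 * l\<^sup>2 * M \<le> l * (16 * M)" using M0 mult_right_mono[of "l\<^sup>2" l "16 * M"] by simp
    also have "\<dots> < l * (16 * M + 1)" using l by simp
    also have "\<dots> \<le> a / (16 * M + 1) * (16 * M + 1)" using M0 by (intro mult_right_mono) (auto simp: l_def)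
    also have "\<dots> = a" using M0 by simp
    finally show ?thesis .
  qed
  \<comment> \<open>The bound that twice the local mass has to meet in \<open>D12_large_part\<close>
    at threshold \<open>\<delta> / 2\<close>; it is positive and independent of
    \<open>n\<close>.\<close>
  define b where "b = ennreal ((\<delta> / 2)\<^sup>2) * emeasure lborel (ball (0 :: real ^ 'n) l)"
  have "emeasure lborel (ball (0 :: real ^ 'n) l) \<noteq> 0"
    using l unit_ball_vol_pos[of "real CARD('n)"] by (simp add: emeasure_ball del: unit_ball_vol_pos)
  then have "b \<noteq> 0" using \<delta> by (simp add: b_def)
  then have "b / 2 > 0" by (simp add: zero_less_iff_neq_zero ennreal_divide_eq_0_iff)
  from order_tendstoD(2)[OF van this]
  show "\<forall>\<^sub>F n in sequentially. large_mass (u n) \<delta> < a"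
  proof eventually_elim
    case (elim n)
    have D: "D12_grad (u n) (grad (u n))" by (rule X_D12_grad[OF d \<phi> u])
    have small: "2 * (\<integral>\<^sup>+x\<in>ball y 1. ennreal ((cmod (u n x))\<^sup>2) \<partial>lebesgue)
      \<le> ennreal ((\<delta> / 2)\<^sup>2) * emeasure lborel (ball (0 :: real ^ 'n) l)" for y
    proof -
      have "(\<integral>\<^sup>+x\<in>ball y 1. ennreal ((cmod (u n x))\<^sup>2) \<partial>lebesgue)
          \<le> (\<integral>\<^sup>+x\<in>ball y 1. ennreal ((cmod (u n x))\<^sup>2 + ((\<phi> (cmod (1 + u n x)))\<^sup>2 - 1)\<^sup>2) \<partial>lebesgue)"
        by (intro nn_integral_mono mult_right_mono ennreal_leI) auto
      also have "\<dots> \<le> (SUP y. \<integral>\<^sup>+x\<in>ball y 1. ennreal ((cmod (u n x))\<^sup>2 + ((\<phi> (cmod (1 + u n x)))\<^sup>2 - 1)\<^sup>2) \<partial>lebesgue)"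
        by (rule SUP_upper) simp
      also have "\<dots> \<le> b / 2" using elim by simp
      finally have "2 * (\<integral>\<^sup>+x\<in>ball y 1. ennreal ((cmod (u n x))\<^sup>2) \<partial>lebesgue) \<le> 2 * (b / 2)"
        by (rule mult_left_mono) simp
      also have "2 * (b / 2) = b"
        by (simp add: ennreal_times_divide ennreal_mult_divide_eq mult.commute)
      finally show ?thesis unfolding b_def .
    qed
    have "ennreal (large_mass (u n) \<delta>) = (\<integral>\<^sup>+x. ennreal ((cmod (u n x))\<^sup>2 * indicator {2 * (\<delta> / 2)<..} (cmod (u n x))) \<partial>lebesgue)"
      using X_integrable(4)[OF d \<phi> u \<delta>] unfolding large_mass_def
      by (subst nn_integral_eq_integral) auto
    also have "\<dots> \<le> ennreal (16 * l\<^sup>2 * (\<integral>x. (norm (grad (u n) x))\<^sup>2 \<partial>lebesgue))"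
      using \<delta> by (intro D12_large_part[OF D d _ l small]) simp
    finally have "large_mass (u n) \<delta> \<le> 16 * l\<^sup>2 * grad_energy (u n)"
      using X_nonneg(1)[OF d \<phi> u] unfolding grad_energy_def by (subst (asm) ennreal_le_iff) auto
    also have "\<dots> \<le> 16 * l\<^sup>2 * M" using M by (intro mult_left_mono) auto
    finally show ?case using la by linarith
  qed
qed

theorem lemma1p2:
  fixes F \<phi> :: "real \<Rightarrow> real"
    and u :: "nat \<Rightarrow> real ^ 'n \<Rightarrow> complex"
    and k :: 'n
    and c :: real
  assumes "CARD('n) \<ge> 3"
    and "admissible_phi \<phi>"
    and "cond_F1 F"
    and "cond_F2 CARD('n) F"
    and "\<And>n. u n \<in> X_space"
    and "bounded (range (\<lambda>n. E_GL \<phi> (u n)))"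
    and "(\<lambda>n. SUP y. \<integral>\<^sup>+x\<in>ball y 1.
            ennreal ((cmod (u n x))\<^sup>2 + ((\<phi> (cmod (1 + u n x)))\<^sup>2 - 1)\<^sup>2) \<partial>lebesgue) \<longlonglongrightarrow> 0"
    and "0 < c" and "c < sqrt 2"
  shows "liminf (\<lambda>n. ereal (E_lag F k c (u n)))
           = liminf (\<lambda>n. ereal (E_GL \<phi> (u n) + c * momentum k (u n)))
       \<and> liminf (\<lambda>n. ereal (E_GL \<phi> (u n) + c * momentum k (u n))) \<ge> 0"
proof -
  note d = assms(1) and \<phi> = assms(2) and F1 = assms(3) and F2 = assms(4) and u = assms(5) and van = assms(7)
  let ?p = "crit_exp CARD('n)"
  let ?E = "\<lambda>n. E_GL \<phi> (u n) + c * momentum k (u n)" and ?L = "\<lambda>n. E_lag F k c (u n)"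
  note nonneg = X_nonneg[OF d \<phi> u] and eq = E_GL_eq[OF d \<phi> u]
  obtain M where M: "\<And>n. \<bar>E_GL \<phi> (u n)\<bar> \<le> M"
    using assms(6) unfolding bounded_iff by auto
  \<comment> \<open>Both parts of \<open>E_GL\<close> are nonnegative, so each is bounded by the
    whole.\<close>
  have GM: "grad_energy (u n) \<le> 2 * M" and RM: "potential_energy \<phi> (u n) \<le> 4 * M" for n
    using M[of n] nonneg(1,2)[of n] unfolding eq by linarith+
  have M0: "M \<ge> 0" using M[of 0] by linarith
  \<comment> \<open>The Sobolev inequality makes the critical mass bounded uniformly in
    \<open>n\<close>, which is why terms carrying a factor \<open>\<epsilon>\<close> or
    \<open>\<delta>\<close> become small.\<close>
  obtain A where A: "A \<ge> 0" "\<And>n. crit_mass (u n) \<le> A"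
  proof -
    define C where "C = 4 powr ?p * 32 * (2 / unit_ball_vol (real CARD('n))) powr (2 / CARD('n))"
    have C: "C \<ge> 0" by (simp add: C_def unit_ball_vol_nonneg)
    have "crit_mass (u n) \<le> (2 * C * (2 * M)) powr (?p / 2)" for n
    proof -
      have "crit_mass (u n) \<le> (2 * C * grad_energy (u n)) powr (?p / 2)"
        unfolding crit_mass_def grad_energy_def C_def by (rule sobolev_D12[OF X_D12_grad[OF d \<phi> u] d])
      also have "\<dots> \<le> (2 * C * (2 * M)) powr (?p / 2)"
        using C nonneg(1) GM crit_exp_gt_2[OF d] by (intro powr_mono2 mult_left_mono) auto
      finally show ?thesis .
    qed
    then show ?thesis by (intro that[of "(2 * C * (2 * M)) powr (?p / 2)"]) auto
  qed
  have J: "(\<lambda>n. large_mass (u n) \<delta>) \<longlonglongrightarrow> 0" if "\<delta> > 0" for \<delta>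
    by (rule large_part_tendsto_0[OF d \<phi> u GM van that])
  have evJ: "\<forall>\<^sub>F n in sequentially. C * large_mass (u n) \<delta> < e" if "\<delta> > 0" "e > 0" for \<delta> C e
    using order_tendstoD(2)[OF tendsto_mult_right_zero[OF J[OF that(1)], of C] that(2)] .
  have half: "e / (2 * X) * X = e / 2" if "X > 0" for e X :: real
    using that by simp
  have diff: "(\<lambda>n. ?L n - ?E n) \<longlonglongrightarrow> 0"
  proof (rule tendsto_rabs_zero_cancel, rule order_tendstoI)
    fix e :: real assume e: "e > 0"
    \<comment> \<open>The potential and critical terms together then cost at most
      \<open>e / 2\<close>; the summand 1 guards against \<open>M = A = 0\<close>.\<close>
    define \<epsilon> where "\<epsilon> = e / (2 * (4 * M + A + 1))"
    have \<epsilon>: "\<epsilon> > 0" using e M0 A by (auto simp: \<epsilon>_def intro!: divide_pos_pos add_nonneg_pos)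
    obtain \<delta> C where \<delta>: "\<delta> > 0" and V: "\<And>z. \<bar>V_pot F ((cmod (1 + z))\<^sup>2) / 2 - ((\<phi> (cmod (1 + z)))\<^sup>2 - 1)\<^sup>2 / 4\<bar>
      \<le> \<epsilon> * ((\<phi> (cmod (1 + z)))\<^sup>2 - 1)\<^sup>2 + \<epsilon> * cmod z powr ?p + C * ((cmod z)\<^sup>2 * indicator {\<delta><..} (cmod z))"
      by (rule potential_difference_le[OF d F1 F2 \<phi> \<epsilon>]) (rule that)
    have "e / 2 > 0" using e by simp
    from evJ[OF \<delta> this, of C]
    show "\<forall>\<^sub>F n in sequentially. \<bar>?L n - ?E n\<bar> < e"
    proof eventually_elim
      case (elim n)
      have "\<bar>?L n - ?E n\<bar> \<le> \<epsilon> * potential_energy \<phi> (u n) + \<epsilon> * crit_mass (u n) + C * large_mass (u n) \<delta>"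
        by (rule E_lag_diff_le[OF d \<phi> u F1 \<delta> V])
      moreover have "\<epsilon> * potential_energy \<phi> (u n) \<le> \<epsilon> * (4 * M)" "\<epsilon> * crit_mass (u n) \<le> \<epsilon> * A"
        using \<epsilon> RM A(2) by (auto intro!: mult_left_mono)
      moreover have "\<epsilon> * (4 * M) + \<epsilon> * A \<le> e / 2"
      proof -
        have "\<epsilon> * (4 * M) + \<epsilon> * A \<le> \<epsilon> * (4 * M + A + 1)" using \<epsilon> by (simp add: algebra_simps)
        also have "\<dots> = e / 2" using M0 A(1) unfolding \<epsilon>_def by (intro half) simp
        finally show ?thesis .
      qed
      ultimately show ?case using elim by linarith
    qed
  qed (auto intro!: always_eventually less_le_trans[OF _ abs_ge_zero])
  have "liminf (\<lambda>n. ereal (?L n)) = liminf (\<lambda>n. ereal (?L n - ?E n) + ereal (?E n))" by simp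
  \<comment> \<open>The difference converges, so it can be pulled out of the lower limit although
    \<open>?E\<close> need not converge.\<close>
  also have "\<dots> = ereal 0 + liminf (\<lambda>n. ereal (?E n))"
    using diff by (intro ereal_liminf_lim_add) auto
  finally have first: "liminf (\<lambda>n. ereal (?L n)) = liminf (\<lambda>n. ereal (?E n))"
    by (simp flip: zero_ereal_def)
  have low: "\<forall>\<^sub>F n in sequentially. - e < ?E n" if e: "e > 0" for e :: real
  proof -
    \<comment> \<open>The factor \<open>6 * \<delta>\<close> multiplies the potential, critical and
      gradient integrals, at most \<open>4 * M\<close>, \<open>A\<close> and \<open>2 * M\<close>;
      this \<open>\<delta>\<close> makes their contribution, times \<open>c\<close>, at most
      \<open>e / 2\<close>.\<close>
    define \<delta> where "\<delta> = min 1 (e / (2 * (c * 6 * (6 * M + A) + 1)))"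
    have q: "c * 6 * (6 * M + A) \<ge> 0" using assms(8) M0 A by simp
    have \<delta>: "0 < \<delta>" "\<delta> \<le> 1" using e q by (auto simp: \<delta>_def intro!: divide_pos_pos add_nonneg_pos)
    have \<delta>e: "c * (6 * \<delta> * (6 * M + A)) \<le> e / 2"
    proof -
      have "c * (6 * \<delta> * (6 * M + A)) = \<delta> * (c * 6 * (6 * M + A))" by simp
      also have "\<dots> \<le> \<delta> * (c * 6 * (6 * M + A) + 1)"
        using \<delta>(1) by (intro mult_left_mono less_imp_le[OF less_add_one]) simp
      also have "\<dots> \<le> e / (2 * (c * 6 * (6 * M + A) + 1)) * (c * 6 * (6 * M + A) + 1)"
        using q by (intro mult_right_mono) (auto simp: \<delta>_def)
      also have "\<dots> = e / 2" using q by (intro half) simp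
      finally show ?thesis .
    qed
    have "e / 2 > 0" using e by simp
    from evJ[OF \<delta>(1) this, of "c * (6 / \<delta>)"]
    show ?thesis
    proof eventually_elim
      case (elim n)
      have E0: "E_GL \<phi> (u n) \<ge> 0" unfolding eq using nonneg(1,2)[of n] by simp
      have "\<bar>momentum k (u n)\<bar> \<le> E_GL \<phi> (u n) / sqrt 2 + 6 * \<delta> * (potential_energy \<phi> (u n) + crit_mass (u n) + grad_energy (u n)) + 6 / \<delta> * large_mass (u n) \<delta>"
        by (rule momentum_le[OF d \<phi> u \<delta>])
      also have "\<dots> \<le> E_GL \<phi> (u n) / sqrt 2 + 6 * \<delta> * (6 * M + A) + 6 / \<delta> * large_mass (u n) \<delta>"
      proof -
        have "potential_energy \<phi> (u n) + crit_mass (u n) + grad_energy (u n) \<le> 6 * M + A"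
          using GM[of n] RM[of n] A(2)[of n] by linarith
        from mult_left_mono[OF this, of "6 * \<delta>"] show ?thesis using \<delta> by simp
      qed
      finally have "c * \<bar>momentum k (u n)\<bar> \<le> c * (E_GL \<phi> (u n) / sqrt 2 + 6 * \<delta> * (6 * M + A) + 6 / \<delta> * large_mass (u n) \<delta>)"
        using assms(8) by (intro mult_left_mono) auto
      also have "\<dots> = c / sqrt 2 * E_GL \<phi> (u n) + c * (6 * \<delta> * (6 * M + A)) + c * (6 / \<delta>) * large_mass (u n) \<delta>"
        by (simp add: distrib_left)
      finally have "c * \<bar>momentum k (u n)\<bar> \<le> c / sqrt 2 * E_GL \<phi> (u n) + c * (6 * \<delta> * (6 * M + A)) + c * (6 / \<delta>) * large_mass (u n) \<delta>" .
      \<comment> \<open>Here \<open>c < sqrt 2\<close> enters: the leading part of the momentum is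
        absorbed by the nonnegative energy.\<close>
      moreover have "c / sqrt 2 * E_GL \<phi> (u n) \<le> 1 * E_GL \<phi> (u n)"
        using assms(9) E0 by (intro mult_right_mono) auto
      moreover have "c * momentum k (u n) \<ge> - (c * \<bar>momentum k (u n)\<bar>)"
        using assms(8) by (cases "momentum k (u n) \<ge> 0") auto
      ultimately show ?case using elim \<delta>e by linarith
    qed
  qed
  have "liminf (\<lambda>n. ereal (?E n)) \<ge> 0"
    unfolding le_Liminf_iff
  proof (intro allI impI)
    fix y :: ereal assume "y < 0"
    then obtain e where e: "y < ereal e" "ereal e < 0" using ereal_dense2 by blast
    then have "- e > 0" by simp
    from low[OF this] show "\<forall>\<^sub>F n in sequentially. y < ereal (?E n)"
      by eventually_elim (use e(1) in \<open>auto intro: less_trans\<close>)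
  qed
  with first show ?thesis by blast
qed

end
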